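(* Let $\boldsymbol{f}\in\mathbf{L}^2(\Omega)$ be the source term of the semidiscrete problem $(\mathring{\mathcal{W}}_h)$ (defined in the context). If the source term is modified to $\boldsymbol{f}+\nabla\Phi$, where $\Phi\in H^1(\Omega)$, then the solution $\boldsymbol{u}_h$ remains unchanged; that is, $\boldsymbol{u}_h$ solves $(\mathring{\mathcal{W}}_h)$ with source term $\boldsymbol{f}$ if and only if $\boldsymbol{u}_h$ solves $(\mathring{\mathcal{W}}_h)$ with source term $\boldsymbol{f}+\nabla\Phi$ (with the same initial data).
   Context: Conventions. $d\in\{2,3\}$. $(\cdot,\cdot)$ is the $L^2(\Omega)$ inner product of scalar, vector or tensor fields, $(\cdot,\cdot)_{\partial\Omega}$ and $(\cdot,\cdot)_e$ are the $L^2$ inner products on $\partial\Omega$ and on a facet $e$. $(\nabla\boldsymbol{a})_{ij}=\partial a_j/\partial x_i$, $\nabla^s\boldsymbol{a}=\frac12(\nabla\boldsymbol{a}+(\nabla\boldsymbol{a})^T)$, $\boldsymbol{C}:\boldsymbol{D}=C_{ij}D_{ij}$. $\mathbf{H}^1_{\boldsymbol{n}}(\Omega)=\{\boldsymbol{u}\in H^1(\Omega)^d : \boldsymbol{u}\cdot\boldsymbol{n}=0 \text{ on }\partial\Omega\}$ (trace sense). Time-dependence of function spaces is suppressed in the notation; $\boldsymbol{f}$, $\Phi$ and $\boldsymbol{u}_h$ may depend on time $t\in(0,T]$. Mesh and spline spaces. $\hat\Omega\subset\mathbb{R}^d$ is a box with a tensor-product mesh $\hat{\mathcal{T}}_h$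 given by unique knots $\zeta_{i,1}<\dots<\zeta_{i,n_i}$ in each direction $i$. The physical domain is $\Omega=\mathcal{F}(\hat\Omega)$ for an invertible parametrization $\mathcal{F}$, as smooth as needed for the expressions below to be defined; $\mathcal{T}_h=\{\mathcal{F}(\hat K):\hat K\in\hat{\mathcal{T}}_h\}$ is quasi-uniform with mesh size $h$. $\mathcal{B}^{k_1,\dots,k_d}_{\boldsymbol{\alpha}_1,\dots,\boldsymbol{\alpha}_d}$ is the tensor product of the univariate spline spaces of piecewise polynomials of degree $k_i$ on the mesh $\{\zeta_{i,j}\}_j$ having $\alpha_{i,j}$ continuous derivatives at each interior knot $\zeta_{i,j}$, with $\boldsymbol{\alpha}_i=[-1,\alpha_{i,2},\dots,\alpha_{i,n_i-1},-1]$; $\boldsymbol{\alpha}_i-1$ denotes $[-1,\alpha_{i,2}-1,\dots,\alpha_{i,n_i-1}-1,-1]$. Fix integers $k'\ge1$ and $\alpha'\ge0$ and take $k_i=k'+1$ for all $i$ and $\alpha_{i,j}=\alpha'+1$ at all interior knots. With $\iota(\boldsymbol{v})=\det(D\mathcal{F})(D\mathcal{F})^{-1}(\boldsymbol{v}\circ\mathcal{F})$, the divergence-conforming B-spline velocity space $\boldsymbol{\mathcal{V}}_h$ is the set of $\boldsymbol{v}\in\mathbf{H}^1_{\boldsymbol{n}}(\Omega)$ with $\iota(\boldsymbol{v})\in\mathcal{B}^{k_1,k_2-1,k_3-1}_{\boldsymbol{\alpha}_1,\boldsymbol{\alpha}_2-1,\boldsymbol{\alpha}_3-1}\times\mathcal{B}^{k_1-1,k_2,k_3-1}_{\boldsymbol{\alpha}_1-1,\boldsymbol{\alpha}_2,\boldsymbol{\alpha}_3-1}\times\mathcal{B}^{k_1-1,k_2-1,k_3}_{\boldsymbol{\alpha}_1-1,\boldsymbol{\alpha}_2-1,\boldsymbol{\alpha}_3}$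 if $d=3$, and $\iota(\boldsymbol{v})\in\mathcal{B}^{k_1,k_2-1}_{\boldsymbol{\alpha}_1,\boldsymbol{\alpha}_2-1}\times\mathcal{B}^{k_1-1,k_2}_{\boldsymbol{\alpha}_1-1,\boldsymbol{\alpha}_2}$ if $d=2$. $\mathring{\boldsymbol{\mathcal{V}}}_h=\{\boldsymbol{v}_h\in\boldsymbol{\mathcal{V}}_h:\nabla\cdot\boldsymbol{v}_h=0\text{ in }\Omega\}$. Facets and jumps. $\mathcal{E}_0$ is the set of interior facets ($(d-1)$-dimensional intersections $e=\partial K_1\cap\partial K_2$ of distinct elements), with unit normal $\boldsymbol{n}$ pointing out of $K_1$; $[\![\phi]\!]=\phi^+-\phi^-$ is the difference of the limits of $\phi$ on $e$ from $K_1$ and $K_2$. On $\partial\Omega$, $\boldsymbol{n}$ is the outward unit normal. $\partial_{\boldsymbol{n}}=\boldsymbol{n}\cdot\nabla$ and $\partial_{\boldsymbol{n}}^{\alpha'+1}$ is its $(\alpha'+1)$-fold iterate. Forms (homogeneous Dirichlet data $\boldsymbol{u}_D=\boldsymbol{0}$). With viscosity $\nu>0$, a dimensionless Nitsche constant $C_{\mathrm{Nit}}>0$ and a dimensionless parameter $\gamma\ge0$, $$J_h(\boldsymbol{u},\boldsymbol{v})=\sum_{e\in\mathcal{E}_0}\big(\eta\,[\![\partial_{\boldsymbol{n}}^{\alpha'+1}\boldsymbol{u}]\!],[\![\partial_{\boldsymbol{n}}^{\alpha'+1}\boldsymbol{v}]\!]\big)_e,\qquad \eta=\gamma\min\{|\boldsymbol{u}|h/\nu,\,1\}\,h^{2\alpha'+2}\,|\boldsymbol{u}\cdot\boldsymbol{n}|$$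 ($\eta$ is evaluated with the first argument of $J_h$), $$A_h(\boldsymbol{u},\boldsymbol{v})=(2\nu\nabla^s\boldsymbol{u},\nabla^s\boldsymbol{v})-(2\nu\boldsymbol{n}\cdot\nabla^s\boldsymbol{u},\boldsymbol{v})_{\partial\Omega}-(2\nu\boldsymbol{n}\cdot\nabla^s\boldsymbol{v},\boldsymbol{u})_{\partial\Omega}+\Big(2\nu\tfrac{C_{\mathrm{Nit}}}{h}\boldsymbol{u},\boldsymbol{v}\Big)_{\partial\Omega}+J_h(\boldsymbol{u},\boldsymbol{v}),$$ $$C(\boldsymbol{w};\boldsymbol{u},\boldsymbol{v})=-(\boldsymbol{w}\otimes\boldsymbol{u},\nabla\boldsymbol{v}),\qquad \mathscr{A}_{\mathrm{stb}}(\boldsymbol{u},\boldsymbol{v})=A_h(\boldsymbol{u},\boldsymbol{v})+C(\boldsymbol{u};\boldsymbol{u},\boldsymbol{v}),\qquad L_h(\boldsymbol{v})=(\boldsymbol{f},\boldsymbol{v}).$$ Semidiscrete problem $(\mathring{\mathcal{W}}_h)$: find $\boldsymbol{u}_h$ (a time-differentiable function of $t$ with values in $\mathring{\boldsymbol{\mathcal{V}}}_h$) such that, for all $\boldsymbol{v}_h\in\mathring{\boldsymbol{\mathcal{V}}}_h$ and all times, $\big(\tfrac{\partial\boldsymbol{u}_h}{\partial t},\boldsymbol{v}_h\big)+\mathscr{A}_{\mathrm{stb}}(\boldsymbol{u}_h,\boldsymbol{v}_h)=L_h(\boldsymbol{v}_h)$. *)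

theory Defs
  imports "HOL-Analysis.Analysis"
begin

section \<open>Smooth functions, $L^2$ and $H^1$\<close>

text \<open>
  Derivatives are taken within \<open>S\<close>. The sets used below are open, or closed nondegenerate boxes;
  on both the derivative within \<open>S\<close> is unique, and on a closed box \<open>Ck_on k\<close> means that all partial
  derivatives up to order \<open>k\<close> exist and are continuous up to the boundary.
\<close>

primrec Ck_on :: "nat \<Rightarrow> (real^'d) set \<Rightarrow> (real^'d \<Rightarrow> 'b::real_normed_vector) \<Rightarrow> bool" where
  "Ck_on 0 S f \<longleftrightarrow> continuous_on S f"
| "Ck_on (Suc k) S f \<longleftrightarrow> (\<forall>x\<in>S. f differentiable (at x within S)) \<and>
     (\<forall>i. Ck_on k S (\<lambda>x. frechet_derivative f (at x within S) (axis i 1)))"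

definition gradient :: "(real^'d \<Rightarrow> real) \<Rightarrow> real^'d \<Rightarrow> real^'d" where
  "gradient \<phi> x = (\<chi> i. frechet_derivative \<phi> (at x) (axis i 1))"

definition test_functions :: "(real^'d) set \<Rightarrow> (real^'d \<Rightarrow> real) set" where
  "test_functions \<Omega> = {\<phi>. (\<forall>k. Ck_on k UNIV \<phi>) \<and>
     (\<exists>K. compact K \<and> K \<subseteq> \<Omega> \<and> (\<forall>x. x \<notin> K \<longrightarrow> \<phi> x = 0))}"

definition L2 :: "'a measure \<Rightarrow> ('a \<Rightarrow> 'b::euclidean_space) set" where
  "L2 M = {f \<in> borel_measurable M. integrable M (\<lambda>x. (norm (f x))\<^sup>2)}"

text \<open>For matrix-valued functions the inner product on \<open>real^'d^'d\<close> is the contraction $C_{ij}D_{ij}$.\<close>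

definition L2_inner :: "'a measure \<Rightarrow> ('a \<Rightarrow> 'b::euclidean_space) \<Rightarrow> ('a \<Rightarrow> 'b) \<Rightarrow> real" where
  "L2_inner M f g = (LINT x|M. f x \<bullet> g x)"

definition L2_norm :: "'a measure \<Rightarrow> ('a \<Rightarrow> 'b::euclidean_space) \<Rightarrow> real" where
  "L2_norm M f = sqrt (L2_inner M f f)"

definition is_weak_grad :: "(real^'d) set \<Rightarrow> (real^'d \<Rightarrow> real) \<Rightarrow> (real^'d \<Rightarrow> real^'d) \<Rightarrow> bool" where
  "is_weak_grad \<Omega> u g \<longleftrightarrow> g \<in> L2 (lebesgue_on \<Omega>) \<and>
     (\<forall>\<phi>\<in>test_functions \<Omega>. \<forall>i.
        (LINT x|lebesgue_on \<Omega>. u x * gradient \<phi> x $ i) = - (LINT x|lebesgue_on \<Omega>. g x $ i * \<phi> x))"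

definition H1 :: "(real^'d) set \<Rightarrow> (real^'d \<Rightarrow> real) set" where
  "H1 \<Omega> = {u \<in> L2 (lebesgue_on \<Omega>). \<exists>g. is_weak_grad \<Omega> u g}"

text \<open>Functions represent their classes modulo null sets; the weak gradient is unique in that sense.\<close>

definition weak_grad :: "(real^'d) set \<Rightarrow> (real^'d \<Rightarrow> real) \<Rightarrow> real^'d \<Rightarrow> real^'d" where
  "weak_grad \<Omega> u = (SOME g. is_weak_grad \<Omega> u g)"

text \<open>$(\nabla a)_{ij} = \partial a_j/\partial x_i$.\<close>

definition weak_vgrad :: "(real^'d) set \<Rightarrow> (real^'d \<Rightarrow> real^'d) \<Rightarrow> real^'d \<Rightarrow> real^'d^'d" where
  "weak_vgrad \<Omega> a x = (\<chi> i j. weak_grad \<Omega> (\<lambda>y. a y $ j) x $ i)"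

definition weak_div :: "(real^'d) set \<Rightarrow> (real^'d \<Rightarrow> real^'d) \<Rightarrow> real^'d \<Rightarrow> real" where
  "weak_div \<Omega> a x = (\<Sum>i\<in>UNIV. weak_vgrad \<Omega> a x $ i $ i)"

definition vgrad :: "(real^'d \<Rightarrow> real^'d) \<Rightarrow> real^'d \<Rightarrow> real^'d^'d" where
  "vgrad a x = (\<chi> i j. gradient (\<lambda>y. a y $ j) x $ i)"

definition sym_part :: "real^'d^'d \<Rightarrow> real^'d^'d" where
  "sym_part A = (1/2) *\<^sub>R (A + transpose A)"

section \<open>Mesh and parametrization\<close>

text \<open>In direction \<open>i\<close> the knots are \<open>knot G i 1 < \<dots> < knot G i (num_knots G i)\<close>.\<close>

record ('d::finite) patch =
  knot :: "'d \<Rightarrow> nat \<Rightarrow> real"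
  num_knots :: "'d \<Rightarrow> nat"
  param :: "real^'d \<Rightarrow> real^'d"

definition first_corner :: "('d::finite) patch \<Rightarrow> real^'d" where
  "first_corner G = (\<chi> i. knot G i 1)"

definition last_corner :: "('d::finite) patch \<Rightarrow> real^'d" where
  "last_corner G = (\<chi> i. knot G i (num_knots G i))"

definition domain :: "('d::finite) patch \<Rightarrow> (real^'d) set" where
  "domain G = param G ` box (first_corner G) (last_corner G)"

definition cells :: "('d::finite) patch \<Rightarrow> ('d \<Rightarrow> nat) set" where
  "cells G = {c. \<forall>i. 1 \<le> c i \<and> c i < num_knots G i}"

definition ref_cell :: "('d::finite) patch \<Rightarrow> ('d \<Rightarrow> nat) \<Rightarrow> (real^'d) set" where
  "ref_cell G c = box (\<chi> i. knot G i (c i)) (\<chi> i. knot G i (Suc (c i)))"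

definition closed_ref_cell :: "('d::finite) patch \<Rightarrow> ('d \<Rightarrow> nat) \<Rightarrow> (real^'d) set" where
  "closed_ref_cell G c = cbox (\<chi> i. knot G i (c i)) (\<chi> i. knot G i (Suc (c i)))"

definition elem :: "('d::finite) patch \<Rightarrow> ('d \<Rightarrow> nat) \<Rightarrow> (real^'d) set" where
  "elem G c = param G ` ref_cell G c"

definition mesh_size :: "('d::finite) patch \<Rightarrow> real" where
  "mesh_size G = Max ((\<lambda>c. diameter (elem G c)) ` cells G)"

definition quasi_uniform :: "real \<Rightarrow> ('d::finite) patch \<Rightarrow> bool" where
  "quasi_uniform \<rho> G \<longleftrightarrow> 0 < \<rho> \<and> (\<forall>c\<in>cells G. \<exists>y. ball y (mesh_size G / \<rho>) \<subseteq> elem G c)"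

text \<open>
  The Jacobian $(D\mathcal F)_{ij} = \partial\mathcal F_i/\partial\hat x_j$. Since the parametrization need
  only be smooth on each closed cell, at points of the mesh skeleton it is taken from inside the cell \<open>c\<close>.
\<close>

definition jac :: "('d::finite) patch \<Rightarrow> ('d \<Rightarrow> nat) \<Rightarrow> real^'d \<Rightarrow> real^'d^'d" where
  "jac G c x = matrix (frechet_derivative (param G) (at x within closed_ref_cell G c))"

text \<open>
  \<open>m\<close> is the order of smoothness demanded of the parametrization on each closed cell; globally it is
  only required to be continuous and injective.
\<close>

definition regular_patch :: "nat \<Rightarrow> ('d::finite) patch \<Rightarrow> bool" where
  "regular_patch m G \<longleftrightarrow>
     (\<forall>i. 2 \<le> num_knots G i \<and> strict_mono_on {1..num_knots G i} (knot G i)) \<and>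
     continuous_on (cbox (first_corner G) (last_corner G)) (param G) \<and>
     inj_on (param G) (cbox (first_corner G) (last_corner G)) \<and>
     (\<forall>c\<in>cells G. Ck_on m (closed_ref_cell G c) (param G) \<and>
        (\<forall>x\<in>closed_ref_cell G c. det (jac G c x) \<noteq> 0))"

section \<open>Facets\<close>

text \<open>
  The facet \<open>(c, i, up)\<close> is the face of cell \<open>c\<close> orthogonal (in the reference domain) to direction
  \<open>i\<close>, on the side of larger \<open>i\<close>-th coordinate if \<open>up\<close> holds and of smaller one otherwise.
  An interior facet is listed once, from the cell with the smaller index, which plays the role of $K_1$;
  the jump terms do not depend on this choice.
  Facets are handled in reference coordinates: a function \<open>g\<close> on the physical facet is
  evaluated at \<open>param G x\<close> for \<open>x\<close> on the reference facet.
\<close>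

type_synonym 'd facet = "('d \<Rightarrow> nat) \<times> 'd \<times> bool"

definition interior_facets :: "('d::finite) patch \<Rightarrow> 'd facet set" where
  "interior_facets G = {(c, i, up). c \<in> cells G \<and> up \<and> Suc (c i) < num_knots G i}"

definition boundary_facets :: "('d::finite) patch \<Rightarrow> 'd facet set" where
  "boundary_facets G =
     {(c, i, up). c \<in> cells G \<and> (if up then Suc (c i) = num_knots G i else c i = 1)}"

fun inner_cell :: "'d facet \<Rightarrow> 'd \<Rightarrow> nat" where
  "inner_cell (c, i, up) = c"

fun outer_cell :: "'d facet \<Rightarrow> 'd \<Rightarrow> nat" where
  "outer_cell (c, i, up) = c(i := if up then Suc (c i) else c i - 1)"

fun facet_coord :: "('d::finite) patch \<Rightarrow> 'd facet \<Rightarrow> real" where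
  "facet_coord G (c, i, up) = knot G i (if up then Suc (c i) else c i)"

fun ref_facet :: "('d::finite) patch \<Rightarrow> 'd facet \<Rightarrow> (real^'d) set" where
  "ref_facet G (c, i, up) = {x. x $ i = facet_coord G (c, i, up) \<and>
     (\<forall>j. j \<noteq> i \<longrightarrow> knot G j (c j) < x $ j \<and> x $ j < knot G j (Suc (c j)))}"

text \<open>
  Unit normal of the physical facet pointing out of the element of \<open>c\<close>:
  the normalization of $(D\mathcal F)^{-T}\hat n$ with $\hat n = \pm e_i$.
\<close>

fun facet_normal :: "('d::finite) patch \<Rightarrow> 'd facet \<Rightarrow> real^'d \<Rightarrow> real^'d" where
  "facet_normal G (c, i, up) x =
     sgn (transpose (matrix_inv (jac G c x)) *v axis i (if up then 1 else -1))"

text \<open>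
  Surface area element: square root of the Gram determinant of the tangent vectors
  $\partial_j\mathcal F$, $j\neq i$. Row and column \<open>i\<close> are those of the identity, so that
  the determinant is that of the Gram matrix with index \<open>i\<close> deleted.
\<close>

fun area_element :: "('d::finite) patch \<Rightarrow> 'd facet \<Rightarrow> real^'d \<Rightarrow> real" where
  "area_element G (c, i, up) x = sqrt (det (\<chi> a b.
     if a = i \<or> b = i then (if a = b then 1 else 0)
     else column a (jac G c x) \<bullet> column b (jac G c x)))"

text \<open>
  The surface measure of the physical facet, in reference coordinates: $(d-1)$-dimensional
  Lebesgue measure (the product over all directions but \<open>i\<close>) on the reference facet, weighted with
  the area element.
\<close>

fun facet_measure :: "('d::finite) patch \<Rightarrow> 'd facet \<Rightarrow> (real^'d) measure" where
  "facet_measure G (c, i, up) =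
     density
       (restrict_space
          (distr (Pi\<^sub>M (UNIV - {i}) (\<lambda>_. lborel)) borel
             (\<lambda>y. \<chi> j. if j = i then facet_coord G (c, i, up) else y j))
          (ref_facet G (c, i, up)))
       (\<lambda>x. ennreal (area_element G (c, i, up) x))"

text \<open>Limit of \<open>g\<close> at the facet point \<open>param G x\<close> from inside the (open) element of \<open>c\<close>.\<close>

definition side_limit ::
  "('d::finite) patch \<Rightarrow> ('d \<Rightarrow> nat) \<Rightarrow> (real^'d \<Rightarrow> 'b::t2_space) \<Rightarrow> real^'d \<Rightarrow> 'b" where
  "side_limit G c g x = Lim (at (param G x) within elem G c) g"

definition jump ::
  "('d::finite) patch \<Rightarrow> 'd facet \<Rightarrow> (real^'d \<Rightarrow> 'b::{t2_space, minus}) \<Rightarrow> real^'d \<Rightarrow> 'b" where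
  "jump G e g x = side_limit G (inner_cell e) g x - side_limit G (outer_cell e) g x"

section \<open>Traces and the space $\mathbf H^1_n$\<close>

text \<open>
  \<open>g\<close> is the trace of \<open>u\<close>: functions smooth up to the boundary converge to \<open>u\<close> in $H^1(\Omega)$ while
  their boundary values converge to \<open>g\<close> in $L^2(\partial\Omega)$.
\<close>

definition has_trace ::
  "('d::finite) patch \<Rightarrow> (real^'d \<Rightarrow> real) \<Rightarrow> (real^'d \<Rightarrow> real) \<Rightarrow> bool" where
  "has_trace G u g \<longleftrightarrow>
     (\<forall>e\<in>boundary_facets G. (\<lambda>x. g (param G x)) \<in> L2 (facet_measure G e)) \<and>
     (\<exists>\<phi>. (\<forall>m k. Ck_on k UNIV (\<phi> m)) \<and>
       (\<lambda>m::nat. L2_norm (lebesgue_on (domain G)) (\<lambda>x. \<phi> m x - u x)) \<longlonglongrightarrow> 0 \<and>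
       (\<lambda>m. L2_norm (lebesgue_on (domain G))
          (\<lambda>x. gradient (\<phi> m) x - weak_grad (domain G) u x)) \<longlonglongrightarrow> 0 \<and>
       (\<forall>e\<in>boundary_facets G.
          (\<lambda>m. L2_norm (facet_measure G e) (\<lambda>x. \<phi> m (param G x) - g (param G x))) \<longlonglongrightarrow> 0))"

definition H1n :: "('d::finite) patch \<Rightarrow> (real^'d \<Rightarrow> real^'d) set" where
  "H1n G = {u. (\<forall>i. (\<lambda>x. u x $ i) \<in> H1 (domain G)) \<and>
     (\<exists>g. (\<forall>i. has_trace G (\<lambda>x. u x $ i) (\<lambda>x. g x $ i)) \<and>
       (\<forall>e\<in>boundary_facets G. AE x in facet_measure G e. g (param G x) \<bullet> facet_normal G e x = 0))}"

section \<open>Divergence-conforming B-splines\<close>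

text \<open>
  Univariate splines on the mesh \<open>\<zeta> 1 < \<dots> < \<zeta> n\<close> with \<open>\<alpha> j\<close> continuous derivatives at the interior knot
  \<open>\<zeta> j\<close> (none, not even continuity, if \<open>\<alpha> j = -1\<close>). The entries of \<open>\<alpha>\<close> at the two end knots, always
  $-1$ by convention, are not used. Values at the knots themselves are left free.
\<close>

definition spline_space :: "(nat \<Rightarrow> real) \<Rightarrow> nat \<Rightarrow> nat \<Rightarrow> (nat \<Rightarrow> int) \<Rightarrow> (real \<Rightarrow> real) set" where
  "spline_space \<zeta> n k \<alpha> = {s. \<exists>p :: nat \<Rightarrow> real poly.
     (\<forall>j\<in>{1..<n}. degree (p j) \<le> k \<and> (\<forall>x\<in>{\<zeta> j<..<\<zeta> (Suc j)}. s x = poly (p j) x)) \<and>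
     (\<forall>j\<in>{2..<n}. \<forall>m. int m \<le> \<alpha> j \<longrightarrow>
        poly ((pderiv ^^ m) (p (j - 1))) (\<zeta> j) = poly ((pderiv ^^ m) (p j)) (\<zeta> j))}"

definition tensor_spline_space ::
  "('d::finite) patch \<Rightarrow> ('d \<Rightarrow> nat) \<Rightarrow> ('d \<Rightarrow> nat \<Rightarrow> int) \<Rightarrow> (real^'d \<Rightarrow> real) set" where
  "tensor_spline_space G k \<alpha> = {s. \<exists>(r::nat) b.
     (\<forall>l<r. \<forall>j. b l j \<in> spline_space (knot G j) (num_knots G j) (k j) (\<alpha> j)) \<and>
     s = (\<lambda>x. \<Sum>l<r. \<Prod>j\<in>UNIV. b l j (x $ j))}"

definition piola_pullback ::
  "('d::finite) patch \<Rightarrow> ('d \<Rightarrow> nat) \<Rightarrow> (real^'d \<Rightarrow> real^'d) \<Rightarrow> real^'d \<Rightarrow> real^'d" where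
  "piola_pullback G c v x = det (jac G c x) *\<^sub>R (matrix_inv (jac G c x) *v v (param G x))"

text \<open>
  The \<open>i\<close>-th component of the pullback has degree \<open>k i\<close> and regularity \<open>\<alpha> i\<close> in direction \<open>i\<close>, and
  degree and regularity lowered by one in the other directions. Membership is tested in the
  interior of the cells, that is, off a null set.
\<close>

definition velocity_space ::
  "('d::finite) patch \<Rightarrow> ('d \<Rightarrow> nat) \<Rightarrow> ('d \<Rightarrow> nat \<Rightarrow> int) \<Rightarrow> (real^'d \<Rightarrow> real^'d) set" where
  "velocity_space G k \<alpha> = {v \<in> H1n G. \<forall>i.
     \<exists>s \<in> tensor_spline_space G (\<lambda>j. if j = i then k j else k j - 1)
            (\<lambda>j l. if j = i then \<alpha> j l else \<alpha> j l - 1).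
       \<forall>c\<in>cells G. \<forall>x\<in>ref_cell G c. piola_pullback G c v x $ i = s x}"

definition divfree_velocity_space ::
  "('d::finite) patch \<Rightarrow> nat \<Rightarrow> nat \<Rightarrow> (real^'d \<Rightarrow> real^'d) set" where
  "divfree_velocity_space G k' \<alpha>' =
     {v \<in> velocity_space G (\<lambda>_. k' + 1) (\<lambda>_ _. int \<alpha>' + 1).
        AE x in lebesgue_on (domain G). weak_div (domain G) v x = 0}"

section \<open>Forms\<close>

text \<open>
  The normal is frozen in the iterate of $n\cdot\nabla$, i.e.
  $\partial_n^m u = D^m u[n,\dots,n]$ at a facet point with normal \<open>n\<close>.
\<close>

definition dir_deriv :: "real^'d \<Rightarrow> (real^'d \<Rightarrow> real^'d) \<Rightarrow> real^'d \<Rightarrow> real^'d" where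
  "dir_deriv n u = (\<lambda>y. frechet_derivative u (at y) n)"

definition normal_deriv_jump ::
  "('d::finite) patch \<Rightarrow> 'd facet \<Rightarrow> nat \<Rightarrow> (real^'d \<Rightarrow> real^'d) \<Rightarrow> real^'d \<Rightarrow> real^'d" where
  "normal_deriv_jump G e m u x = jump G e ((dir_deriv (facet_normal G e x) ^^ m) u) x"

definition skeleton_coeff ::
  "('d::finite) patch \<Rightarrow> nat \<Rightarrow> real \<Rightarrow> real \<Rightarrow> 'd facet \<Rightarrow> (real^'d \<Rightarrow> real^'d) \<Rightarrow> real^'d \<Rightarrow> real" where
  "skeleton_coeff G \<alpha>' \<nu> \<gamma> e u x =
     (let u\<^sub>e = side_limit G (inner_cell e) u x; h = mesh_size G in
      \<gamma> * min (norm u\<^sub>e * h / \<nu>) 1 * h ^ (2 * \<alpha>' + 2) * \<bar>u\<^sub>e \<bullet> facet_normal G e x\<bar>)"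

definition J_form ::
  "('d::finite) patch \<Rightarrow> nat \<Rightarrow> real \<Rightarrow> real \<Rightarrow> (real^'d \<Rightarrow> real^'d) \<Rightarrow> (real^'d \<Rightarrow> real^'d) \<Rightarrow> real" where
  "J_form G \<alpha>' \<nu> \<gamma> u v = (\<Sum>e\<in>interior_facets G. L2_inner (facet_measure G e)
     (\<lambda>x. skeleton_coeff G \<alpha>' \<nu> \<gamma> e u x *\<^sub>R normal_deriv_jump G e (\<alpha>' + 1) u x)
     (normal_deriv_jump G e (\<alpha>' + 1) v))"

text \<open>
  On the boundary, discrete velocities and their gradients are represented by their limits from the
  adjacent element, in which they are smooth.
\<close>

definition boundary_inner ::
  "('d::finite) patch \<Rightarrow> ('d facet \<Rightarrow> real^'d \<Rightarrow> real^'d) \<Rightarrow> ('d facet \<Rightarrow> real^'d \<Rightarrow> real^'d) \<Rightarrow> real" where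
  "boundary_inner G a b = (\<Sum>e\<in>boundary_facets G. L2_inner (facet_measure G e) (a e) (b e))"

definition bdry_value ::
  "('d::finite) patch \<Rightarrow> (real^'d \<Rightarrow> real^'d) \<Rightarrow> 'd facet \<Rightarrow> real^'d \<Rightarrow> real^'d" where
  "bdry_value G u e x = side_limit G (inner_cell e) u x"

definition bdry_normal_strain ::
  "('d::finite) patch \<Rightarrow> (real^'d \<Rightarrow> real^'d) \<Rightarrow> 'd facet \<Rightarrow> real^'d \<Rightarrow> real^'d" where
  "bdry_normal_strain G u e x =
     facet_normal G e x v* side_limit G (inner_cell e) (\<lambda>y. sym_part (vgrad u y)) x"

definition A_form ::
  "('d::finite) patch \<Rightarrow> nat \<Rightarrow> real \<Rightarrow> real \<Rightarrow> real \<Rightarrow>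
   (real^'d \<Rightarrow> real^'d) \<Rightarrow> (real^'d \<Rightarrow> real^'d) \<Rightarrow> real" where
  "A_form G \<alpha>' \<nu> C\<^sub>N \<gamma> u v =
     L2_inner (lebesgue_on (domain G))
       (\<lambda>x. (2 * \<nu>) *\<^sub>R sym_part (weak_vgrad (domain G) u x))
       (\<lambda>x. sym_part (weak_vgrad (domain G) v x))
     - boundary_inner G (\<lambda>e x. (2 * \<nu>) *\<^sub>R bdry_normal_strain G u e x) (bdry_value G v)
     - boundary_inner G (\<lambda>e x. (2 * \<nu>) *\<^sub>R bdry_normal_strain G v e x) (bdry_value G u)
     + boundary_inner G (\<lambda>e x. (2 * \<nu> * (C\<^sub>N / mesh_size G)) *\<^sub>R bdry_value G u e x) (bdry_value G v)
     + J_form G \<alpha>' \<nu> \<gamma> u v"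

definition C_form ::
  "('d::finite) patch \<Rightarrow> (real^'d \<Rightarrow> real^'d) \<Rightarrow> (real^'d \<Rightarrow> real^'d) \<Rightarrow> (real^'d \<Rightarrow> real^'d) \<Rightarrow> real" where
  "C_form G w u v = - L2_inner (lebesgue_on (domain G))
     (\<lambda>x. \<chi> i j. w x $ i * u x $ j) (weak_vgrad (domain G) v)"

definition A_stb ::
  "('d::finite) patch \<Rightarrow> nat \<Rightarrow> real \<Rightarrow> real \<Rightarrow> real \<Rightarrow>
   (real^'d \<Rightarrow> real^'d) \<Rightarrow> (real^'d \<Rightarrow> real^'d) \<Rightarrow> real" where
  "A_stb G \<alpha>' \<nu> C\<^sub>N \<gamma> u v = A_form G \<alpha>' \<nu> C\<^sub>N \<gamma> u v + C_form G u u v"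

section \<open>The semidiscrete problem\<close>

definition has_L2_time_derivative ::
  "'a measure \<Rightarrow> (real \<Rightarrow> 'a \<Rightarrow> 'b::euclidean_space) \<Rightarrow> ('a \<Rightarrow> 'b) \<Rightarrow> real \<Rightarrow> real set \<Rightarrow> bool" where
  "has_L2_time_derivative M u w t I \<longleftrightarrow> w \<in> L2 M \<and>
     ((\<lambda>s. L2_norm M (\<lambda>x. (1 / (s - t)) *\<^sub>R (u s x - u t x) - w x)) \<longlongrightarrow> 0) (at t within I)"

text \<open>
  \<open>u\<close> solves the problem on \<open>(0, T]\<close> with source term \<open>f\<close> and initial datum \<open>u0\<close>; the initial datum is
  attained in $L^2(\Omega)$.
\<close>

definition semidiscrete_solution ::
  "('d::finite) patch \<Rightarrow> nat \<Rightarrow> nat \<Rightarrow> real \<Rightarrow> real \<Rightarrow> real \<Rightarrow> real \<Rightarrow>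
   (real \<Rightarrow> real^'d \<Rightarrow> real^'d) \<Rightarrow> (real^'d \<Rightarrow> real^'d) \<Rightarrow> (real \<Rightarrow> real^'d \<Rightarrow> real^'d) \<Rightarrow> bool" where
  "semidiscrete_solution G k' \<alpha>' \<nu> C\<^sub>N \<gamma> T f u0 u \<longleftrightarrow>
     (let M = lebesgue_on (domain G); V = divfree_velocity_space G k' \<alpha>' in
      (\<forall>t\<in>{0..T}. u t \<in> V) \<and>
      (AE x in M. u 0 x = u0 x) \<and>
      ((\<lambda>t. L2_norm M (\<lambda>x. u t x - u 0 x)) \<longlongrightarrow> 0) (at 0 within {0..T}) \<and>
      (\<forall>t\<in>{0<..T}. \<exists>u'. has_L2_time_derivative M u u' t {0..T} \<and>
         (\<forall>v\<in>V. L2_inner M u' v + A_stb G \<alpha>' \<nu> C\<^sub>N \<gamma> (u t) v = L2_inner M (f t) v)))"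

end

theory Submission
  imports Defs
begin

text \<open>
  Replacing $f$ by $f + \nabla\Phi$ changes the semidiscrete problem only by the term $(\nabla\Phi, v)$,
  so everything rests on one statement: a divergence-free discrete velocity $v$ is $L^2$-orthogonal to
  the weak gradient of every $\Phi \in H^1(\Omega)$ (\<open>weak_gradient_orthogonal_divfree_velocity\<close>).
  For smooth data this is integration by parts, with $\nabla\cdot v = 0$ and $v\cdot n = 0$. Here the
  weak gradient may be tested only with smooth functions of compact support in $\Omega$, the domain is
  only a piecewise smooth image of a box, and both conditions on $v$ are weak ones. The proof uses that
  discrete velocities are explicit: $v$ is the Piola transform of a field \<open>S\<close> on the reference box
  whose components are continuous piecewise polynomials.

  \<^item> All regularities that occur in the velocity space are at least $0$, so that \<open>S\<close> can be chosen
    continuous, and each of its components is Lipschitz along the axes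
    (\<open>tensor_spline_piecewise_C1\<close>, \<open>velocity_Piola_coefficients\<close>).

  \<^item> Integrals $\int_\Omega v\cdot\nabla\theta$ pull back to
    $\sigma\int S\cdot\nabla(\theta\circ F)$, where \<open>\<sigma>\<close> is the sign of $\det DF$. It is the same in all
    cells: an injective parametrization cannot fold along a facet (\<open>fold_not_injective\<close>,
    \<open>det_jac_sign\<close>, \<open>push_pull\<close>).

  \<^item> The trace of $v$ in the sense of \<open>has_trace\<close> is its limit from inside
    (\<open>trace_eq_boundary_limit\<close>), so $v\cdot n = 0$ says that \<open>S x $ i = 0\<close> on the faces
    orthogonal to direction \<open>i\<close> (\<open>normal_component_0\<close>).

  \<^item> Hence the $i$-th component of the extension \<open>Z\<close> of \<open>S\<close> by zero is Lipschitz in direction \<open>i\<close> on the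
    whole space, and the integral of $\partial_i(Z_i\,(\theta\circ F))$ vanishes by translation
    invariance. This is a divergence theorem for \<open>Z\<close> without boundary terms
    (\<open>divergence_theorem_zoomed\<close>). Together with the weak equation $\nabla\cdot v = 0$ it
    shows that \<open>S\<close> is divergence free inside the cells
    (\<open>weakly_divergence_free_imp_divS_0\<close>).

  \<^item> Contracting \<open>Z\<close> by a factor \<open>\<rho> < 1\<close> towards an interior point of the box keeps it divergence free and
    moves the support of its Piola transform into a compact subset of $\Omega$. Mollifying with bump
    kernels and exchanging the order of integration moves the gradient from $\Phi$ to the
    kernel and from there to the contracted velocity, where it gives $0$
    (\<open>gradient_orthogonal_shrunk\<close>). The kernel width tends to $0$ and then \<open>\<rho>\<close> tends to $1$ by
    dominated convergence (\<open>gradient_orthogonal\<close>).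
\<close>

section \<open>Smooth bump functions\<close>

text \<open>
  The functions $t^{-n} e^{-1/t}$, extended by $0$: their derivatives are linear combinations of functions
  of the same family, so that smoothness of the bump becomes a syntactic matter.
\<close>

definition flat_exp :: "nat \<Rightarrow> real \<Rightarrow> real" where
  "flat_exp n t = (if t > 0 then exp (- inverse t) / t ^ n else 0)"

text \<open>
  The exponential $e^{1/t}$ dominates its Taylor term of degree $n + 2$. The quadratic decay gives the
  derivative $0$ at the origin.
\<close>

lemma flat_exp_quadratic_bound: "\<bar>flat_exp n t\<bar> \<le> fact (n + 2) * t\<^sup>2"
proof (cases "t > 0")
  case True
  have "(inverse t) ^ (n + 2) / fact (n + 2) \<le> exp (inverse t)"
  proof -
    have "(\<Sum>k\<in>{n + 2}. (inverse t) ^ k /\<^sub>R fact k) \<le> (\<Sum>k. (inverse t) ^ k /\<^sub>R fact k)"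
      using True by (intro sum_le_suminf summable_exp_generic) auto
    then show ?thesis by (simp add: exp_def divide_inverse mult.commute)
  qed
  then show ?thesis using True
    by (simp add: flat_exp_def exp_minus divide_simps power_add mult_ac power2_eq_square)
qed (simp add: flat_exp_def)

lemma flat_exp_has_derivative:
  "(flat_exp n has_real_derivative (flat_exp (n + 2) t - n * flat_exp (n + 1) t)) (at t)"
proof -
  consider "t > 0" | "t < 0" | "t = 0" by linarith
  then show ?thesis
  proof cases
    case 1
    have "((\<lambda>t. exp (- inverse t) / t ^ n) has_real_derivative
        (exp (- inverse t) * (inverse t)\<^sup>2 * t ^ n - exp (- inverse t) * (n * t ^ (n - 1))) / (t ^ n * t ^ n)) (at t)"
      using 1 by (auto intro!: derivative_eq_intros simp: power2_eq_square)
    moreover have "(exp (- inverse t) * (inverse t)\<^sup>2 * t ^ n - exp (- inverse t) * (n * t ^ (n - 1))) / (t ^ n * t ^ n)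
        = flat_exp (n + 2) t - n * flat_exp (n + 1) t"
      using 1 by (cases n) (simp_all add: flat_exp_def field_simps power2_eq_square)
    ultimately have "((\<lambda>t. exp (- inverse t) / t ^ n) has_real_derivative
        (flat_exp (n + 2) t - n * flat_exp (n + 1) t)) (at t)" by simp
    then show ?thesis
      by (rule DERIV_cong_ev[THEN iffD1, rotated -1, OF _ refl _ refl])
         (use 1 in \<open>auto simp: flat_exp_def intro!: eventually_mono[OF eventually_gt_at_top]
            eventually_mono[OF order_tendstoD(1)[OF tendsto_ident_at]]
            eventually_nhds_in_open[of "{0<..}", THEN eventually_mono]\<close>)
  next
    case 2
    have "((\<lambda>_. 0) has_real_derivative (flat_exp (n + 2) t - n * flat_exp (n + 1) t)) (at t)"
      using 2 by (simp add: flat_exp_def)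
    then show ?thesis
      by (rule has_field_derivative_transform_within_open[where S = "{..<0}"])
         (use 2 in \<open>auto simp: flat_exp_def\<close>)
  next
    case 3
    have "(\<lambda>y. flat_exp n y / y) \<midarrow>0\<rightarrow> 0"
    proof (rule Lim_null_comparison)
      show "\<forall>\<^sub>F y in at 0. norm (flat_exp n y / y) \<le> fact (n + 2) * \<bar>y\<bar>"
        using flat_exp_quadratic_bound[of n]
        by (auto simp: eventually_at_filter abs_divide divide_simps power2_eq_square mult.assoc)
      show "(\<lambda>y. fact (n + 2) * \<bar>y\<bar>) \<midarrow>0\<rightarrow> (0::real)"
        by (rule tendsto_eq_intros refl)+ auto
    qed
    then show ?thesis using 3 by (simp add: DERIV_def flat_exp_def[of n 0] flat_exp_def[of _ 0])
  qed
qed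

text \<open>
  A syntactic class of functions closed under partial derivatives, hence contained in \<open>Ck_on k\<close> for
  every \<open>k\<close>. It contains the bumps as well as the polynomials that make up the splines.
\<close>

inductive smooth_expr :: "(real^'d::finite \<Rightarrow> real) \<Rightarrow> bool" where
  const: "smooth_expr (\<lambda>_. a)"
| coord: "smooth_expr (\<lambda>x. x $ i)"
| add: "smooth_expr f \<Longrightarrow> smooth_expr g \<Longrightarrow> smooth_expr (\<lambda>x. f x + g x)"
| mult: "smooth_expr f \<Longrightarrow> smooth_expr g \<Longrightarrow> smooth_expr (\<lambda>x. f x * g x)"
| flat: "smooth_expr f \<Longrightarrow> smooth_expr (\<lambda>x. flat_exp n (f x))"

lemma smooth_expr_has_derivative:
  fixes f :: "real^'d::finite \<Rightarrow> real"
  assumes "smooth_expr f"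
  shows "\<exists>f'. (\<forall>x. (f has_derivative f' x) (at x)) \<and> (\<forall>i. smooth_expr (\<lambda>x. f' x (axis i 1)))"
  using assms
proof induction
  case (const a)
  show ?case by (rule exI[of _ "\<lambda>_ _. 0"]) (auto intro: smooth_expr.intros)
next
  case (coord j)
  have "smooth_expr (\<lambda>x. axis i 1 $ j)" for i :: 'd by (rule smooth_expr.const)
  then show ?case
    by (intro exI[of _ "\<lambda>_ h. h $ j"])
       (auto intro!: bounded_linear_imp_has_derivative bounded_linear_vec_nth)
next
  case (add f g)
  then obtain f' g' where "\<forall>x. (f has_derivative f' x) (at x)" "\<forall>i. smooth_expr (\<lambda>x. f' x (axis i 1))"
    "\<forall>x. (g has_derivative g' x) (at x)" "\<forall>i. smooth_expr (\<lambda>x. g' x (axis i 1))" by blast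
  then show ?case
    by (intro exI[of _ "\<lambda>x h. f' x h + g' x h"]) (auto intro!: has_derivative_add smooth_expr.intros)
next
  case (mult f g)
  then obtain f' g' where "\<forall>x. (f has_derivative f' x) (at x)" "\<forall>i. smooth_expr (\<lambda>x. f' x (axis i 1))"
    "\<forall>x. (g has_derivative g' x) (at x)" "\<forall>i. smooth_expr (\<lambda>x. g' x (axis i 1))" by blast
  then show ?case using mult(1,2)
    by (intro exI[of _ "\<lambda>x h. f x * g' x h + f' x h * g x"]) (auto intro!: has_derivative_mult smooth_expr.intros)
next
  case (flat f n)
  then obtain f' where f': "\<forall>x. (f has_derivative f' x) (at x)" "\<forall>i. smooth_expr (\<lambda>x. f' x (axis i 1))"
    by blast
  define D where "D x = flat_exp (n + 2) (f x) + (- real n) * flat_exp (n + 1) (f x)" for x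
  have "((\<lambda>x. flat_exp n (f x)) has_derivative (\<lambda>h. D x * f' x h)) (at x)" for x
  proof -
    have "(flat_exp n has_derivative (\<lambda>h. D x * h)) (at (f x))"
      using flat_exp_has_derivative[of n "f x"] by (simp add: has_field_derivative_def D_def)
    from has_derivative_compose[OF f'(1)[rule_format] this] show ?thesis .
  qed
  moreover have "smooth_expr (\<lambda>x. D x * f' x (axis i 1))" for i
    unfolding D_def by (intro smooth_expr.intros flat.hyps f'(2)[rule_format])
  ultimately show ?case by (intro exI[of _ "\<lambda>x h. D x * f' x h"]) auto
qed

lemma smooth_expr_differentiable: "smooth_expr f \<Longrightarrow> f differentiable (at x)"
  using smooth_expr_has_derivative differentiableI by blast

lemma smooth_expr_partial: 
  assumes "smooth_expr f" shows "smooth_expr (\<lambda>x. frechet_derivative f (at x) (axis i 1))"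
proof -
  obtain f' where f': "\<And>x. (f has_derivative f' x) (at x)" "\<And>i. smooth_expr (\<lambda>x. f' x (axis i 1))"
    using smooth_expr_has_derivative[OF assms] by blast
  have "frechet_derivative f (at x) = f' x" for x
    using frechet_derivative_at[OF f'(1)] by metis
  then show ?thesis using f'(2)[of i] by simp
qed

lemma smooth_expr_continuous: "smooth_expr f \<Longrightarrow> continuous_on S f"
  by (meson continuous_at_imp_continuous_on differentiable_imp_continuous_within smooth_expr_differentiable)

lemma smooth_expr_Ck_on: "smooth_expr f \<Longrightarrow> Ck_on k UNIV f"
  by (induction k arbitrary: f)
     (auto simp: smooth_expr_continuous smooth_expr_differentiable smooth_expr_partial)

lemma smooth_expr_sum:
  "(\<And>l. l \<in> A \<Longrightarrow> smooth_expr (f l)) \<Longrightarrow> smooth_expr (\<lambda>x. \<Sum>l\<in>A. f l x)"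
  by (induction A rule: infinite_finite_induct) (auto intro: smooth_expr.intros)

lemma smooth_expr_prod:
  "(\<And>l. l \<in> A \<Longrightarrow> smooth_expr (f l)) \<Longrightarrow> smooth_expr (\<lambda>x. \<Prod>l\<in>A. f l x)"
  by (induction A rule: infinite_finite_induct) (auto intro: smooth_expr.intros)

lemma smooth_expr_poly: "smooth_expr (\<lambda>x. poly p (x $ i))"
  by (induction p) (simp_all add: smooth_expr.intros)

text \<open>
  The function $x \mapsto e^{-1/(r^2 - |x - z|^2)}$ on the ball of radius \<open>r\<close> around \<open>z\<close>, written with sums and
  products of coordinates only, so that it is visibly a \<open>smooth_expr\<close>.
\<close>

definition bump :: "real \<Rightarrow> real^'d::finite \<Rightarrow> real^'d \<Rightarrow> real" where
  "bump r z x = flat_exp 0 (r\<^sup>2 + (- 1) * (\<Sum>i\<in>UNIV. (x $ i + - (z $ i)) * (x $ i + - (z $ i))))"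

lemma smooth_expr_bump: "smooth_expr (bump r z)"
  unfolding bump_def[abs_def] by (intro smooth_expr.intros smooth_expr_sum)

lemma bump_eq: "bump r z x = flat_exp 0 (r\<^sup>2 - (norm (x - z))\<^sup>2)"
  by (simp add: bump_def norm_eq_sqrt_inner inner_vec_def sum_nonneg power2_eq_square)

lemma bump_nonneg: "0 \<le> bump r z x"
  by (simp add: bump_def flat_exp_def)

lemma bump_le_1: "bump r z x \<le> 1"
  by (simp add: bump_def flat_exp_def)

lemma bump_pos_iff: "0 < r \<Longrightarrow> 0 < bump r z x \<longleftrightarrow> x \<in> ball z r"
  by (auto simp: bump_eq flat_exp_def dist_norm norm_minus_commute intro: power_strict_mono power2_less_imp_less)

lemma bump_eq_0: "0 < r \<Longrightarrow> x \<notin> ball z r \<Longrightarrow> bump r z x = 0"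
  using bump_pos_iff bump_nonneg by (metis less_eq_real_def)

lemma bump_commute: "bump r z x = bump r x z"
  by (simp add: bump_eq norm_minus_commute)

lemma bump_test_function:
  assumes "0 < r" "cball z r \<subseteq> \<Omega>"
  shows "bump r z \<in> test_functions \<Omega>"
  unfolding test_functions_def
  using assms smooth_expr_Ck_on[OF smooth_expr_bump] bump_eq_0[OF assms(1), of _ z]
  by (force intro!: exI[of _ "cball z r"])

section \<open>Integrals of directional derivatives\<close>

text \<open>
  The difference quotients of \<open>P\<close> in direction \<open>e\<close> have integral $0$ by translation invariance, they
  are bounded by \<open>L\<close> on a fixed ball, and they converge to \<open>D\<close> almost everywhere. The function \<open>P\<close> may jump
  across hyperplanes parallel to \<open>e\<close>, as the components of the zero extensions below do.
\<close>

lemma integral_directional_derivative_eq_0: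
  fixes P D :: "'a::euclidean_space \<Rightarrow> real"
  assumes meas: "P \<in> borel_measurable borel"
    and supp: "\<And>x. P x \<noteq> 0 \<Longrightarrow> norm x \<le> R"
    and bdd: "\<And>x. \<bar>P x\<bar> \<le> B"
    and lip: "\<And>x h. \<bar>P (x + h *\<^sub>R e) - P x\<bar> \<le> L * \<bar>h\<bar>"
    and der: "AE x in lebesgue. ((\<lambda>h. P (x + h *\<^sub>R e)) has_real_derivative D x) (at 0)"
  shows "integrable lebesgue D" "integral\<^sup>L lebesgue D = 0"
proof -
  define Q where "Q n x = (P (x + (1 / Suc n) *\<^sub>R e) - P x) * Suc n" for n :: nat and x
  have [measurable]: "P \<in> borel_measurable borel" by fact
  have Pint: "integrable lborel P"
  proof (rule Bochner_Integration.integrable_bound)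
    show "integrable lborel (\<lambda>x. indicator (cball 0 R) x *\<^sub>R B)"
      by (rule borel_integrable_compact) auto
    show "AE x in lborel. norm (P x) \<le> norm (indicator (cball 0 R) x *\<^sub>R B)"
    proof (rule AE_I2)
      fix x show "norm (P x) \<le> norm (indicator (cball 0 R) x *\<^sub>R B)"
        using bdd[of x] supp[of x] by (cases "P x = 0") auto
    qed
  qed simp
  have shift: "integrable lborel (\<lambda>x. P (x + c))" "(LINT x|lborel. P (x + c)) = integral\<^sup>L lborel P" for c
  proof -
    have eq: "lborel = distr lborel borel ((+) c)" by (rule lborel_distr_plus[symmetric])
    have "integrable (distr lborel borel ((+) c)) P" using Pint by (simp add: lborel_distr_plus)
    then show "integrable lborel (\<lambda>x. P (x + c))"
      by (subst (asm) integrable_distr_eq) (auto simp: add.commute)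
    have "integral\<^sup>L (distr lborel borel ((+) c)) P = (LINT x|lborel. P (c + x))"
      by (rule integral_distr) auto
    then show "(LINT x|lborel. P (x + c)) = integral\<^sup>L lborel P"
      by (simp add: lborel_distr_plus add.commute)
  qed
  have [measurable]: "Q n \<in> borel_measurable borel" for n
    unfolding Q_def by measurable
  have Qint: "integral\<^sup>L lebesgue (Q n) = 0" for n
  proof -
    have "integral\<^sup>L lborel (Q n) = 0"
      unfolding Q_def using shift Pint by (simp add: integral_mult_left_zero)
    then show ?thesis by (simp add: integral_completion)
  qed
  have conv: "AE x in lebesgue. (\<lambda>n. Q n x) \<longlonglongrightarrow> D x"
    using der
  proof eventually_elim
    case (elim x)
    have "((\<lambda>h. (P (x + h *\<^sub>R e) - P x) / h) \<longlongrightarrow> D x) (at 0)"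
      using elim by (simp add: DERIV_def)
    moreover have "filterlim (\<lambda>n. 1 / real (Suc n)) (at 0) sequentially"
      by (intro filterlim_atI LIMSEQ_Suc lim_1_over_n) auto
    ultimately have "(\<lambda>n. (P (x + (1 / real (Suc n)) *\<^sub>R e) - P x) / (1 / real (Suc n))) \<longlonglongrightarrow> D x"
      by (rule filterlim_compose)
    then show ?case by (simp add: Q_def)
  qed
  have Qbd: "norm (Q n x) \<le> indicator (cball 0 (R + norm e)) x *\<^sub>R \<bar>L\<bar>" for n x
  proof (cases "norm x \<le> R + norm e")
    case True
    have "\<bar>P (x + (1 / Suc n) *\<^sub>R e) - P x\<bar> * Suc n \<le> (L * \<bar>1 / Suc n\<bar>) * Suc n"
      by (intro mult_right_mono lip) auto
    then show ?thesis using True by (simp add: Q_def abs_mult)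
  next
    case False
    have "norm ((1 / Suc n) *\<^sub>R e) \<le> norm e"
      by (simp add: divide_simps mult_le_cancel_left1)
    then have "norm (x + (1 / Suc n) *\<^sub>R e) > R"
      using False norm_triangle_ineq4[of "x + (1 / Suc n) *\<^sub>R e" "(1 / Suc n) *\<^sub>R e"] by auto
    moreover have "norm x > R" using False norm_ge_zero[of e] by linarith
    ultimately have "P (x + (1 / Suc n) *\<^sub>R e) = 0" "P x = 0"
      using supp by (meson not_le)+
    then show ?thesis by (simp add: Q_def)
  qed
  have ib: "integrable lebesgue (\<lambda>x. indicator (cball 0 (R + norm e)) x *\<^sub>R \<bar>L\<bar> :: real)"
  proof -
    have *: "integrable lborel (\<lambda>x. indicator (cball 0 (R + norm e)) x *\<^sub>R \<bar>L\<bar> :: real)"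
      by (rule borel_integrable_compact) auto
    show ?thesis using * by (simp only: integrable_completion[OF borel_measurable_integrable[OF *]])
  qed
  have Qm: "Q n \<in> borel_measurable lebesgue" for n
    by (simp add: measurable_completion)
  \<comment> \<open>\<open>D\<close> is known only up to a null set; Lebesgue measure is complete.\<close>
  have Dm: "D \<in> borel_measurable lebesgue"
  proof (rule borel_measurable_AE)
    show "(\<lambda>x. lim (\<lambda>n. Q n x)) \<in> borel_measurable lebesgue"
      by (intro borel_measurable_lim_metric Qm)
    show "AE x in lebesgue. lim (\<lambda>n. Q n x) = D x"
      using conv by eventually_elim (rule limI)
  qed
  show "integrable lebesgue D"
    by (rule integrable_dominated_convergence[OF Dm Qm ib conv AE_I2[OF Qbd]])
  have "(\<lambda>n. integral\<^sup>L lebesgue (Q n)) \<longlonglongrightarrow> integral\<^sup>L lebesgue D"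
    by (rule integral_dominated_convergence[OF Dm Qm ib conv AE_I2[OF Qbd]])
  then show "integral\<^sup>L lebesgue D = 0"
    by (simp add: Qint LIMSEQ_const_iff)
qed

section \<open>Injective maps do not fold along a hyperplane\<close>

lemma matrix_inv_mult:
  fixes A :: "real^'d::finite^'d"
  assumes "det A \<noteq> 0"
  shows "A ** matrix_inv A = mat 1" "matrix_inv A ** A = mat 1"
proof -
  have "\<exists>A'. A ** A' = mat 1 \<and> A' ** A = mat 1"
    using assms by (simp flip: invertible_det_nz add: invertible_def)
  then have "A ** matrix_inv A = mat 1 \<and> matrix_inv A ** A = mat 1"
    unfolding matrix_inv_def by (rule someI_ex)
  then show "A ** matrix_inv A = mat 1" "matrix_inv A ** A = mat 1" by auto
qed

text \<open>
  To first order the last hypothesis puts the image of a point $z = x_0 + s e_i$ of \<open>K2\<close> on the side of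
  the hyperplane that is covered by \<open>K1\<close>. The image is attained there exactly: a fixed point of
  $x \mapsto x - A^{-1}(F x - F z)$ on a small ball inside \<open>K1\<close>, which Brouwer's theorem provides,
  satisfies $F x = F z$.
\<close>

lemma fold_not_injective:
  fixes F :: "real^'d::finite \<Rightarrow> real^'d"
  assumes cont: "continuous_on K F"
    and cells: "K1 \<subseteq> K" "K2 \<subseteq> K"
    and x0: "x0 \<in> K1" "x0 \<in> K2"
    and D1: "(F has_derivative (*v) A) (at x0 within K1)"
    and D2: "(F has_derivative (*v) B) (at x0 within K2)"
    and A: "det A \<noteq> 0" and r: "r > 0"
    and K1: "\<And>x. dist x x0 < r \<Longrightarrow> x $ i < x0 $ i \<Longrightarrow> x \<in> K1"
    and K2: "\<And>x. dist x x0 < r \<Longrightarrow> x $ i > x0 $ i \<Longrightarrow> x \<in> K2"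
    and neg: "(matrix_inv A *v (B *v axis i 1)) $ i < 0"
  shows "\<not> inj_on F K"
proof
  assume inj: "inj_on F K"
  define w where "w = matrix_inv A *v (B *v axis i 1)"
  define b where "b = - (w $ i)"
  have b: "b > 0" using neg by (simp add: b_def w_def)
  have Aw: "A *v w = B *v axis i 1"
    by (simp add: w_def matrix_vector_mul_assoc matrix_mul_assoc matrix_inv_mult[OF A])
  define Ai where "Ai = matrix_inv A"
  have AiA: "Ai *v (A *v x) = x" for x
    by (simp add: Ai_def matrix_vector_mul_assoc matrix_inv_mult[OF A])
  obtain N where N: "N > 0" "\<And>x. norm (Ai *v x) \<le> norm x * N"
    using bounded_linear.pos_bounded[OF matrix_vector_mul_bounded_linear] by blast
  define m where "m = norm w + b + 1"
  have m: "m \<ge> 1" "m > 0" using b norm_ge_zero[of w] unfolding m_def by linarith+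
  \<comment> \<open>The linearization errors of both sides within distance \<open>s * m\<close> of \<open>x0\<close>, multiplied by $A^{-1}$, then add up to less than the radius \<open>s * b / 2\<close> of \<open>Q\<close>.\<close>
  define \<epsilon> where "\<epsilon> = b / (8 * N * m)"
  have eps: "\<epsilon> > 0" using b N m by (simp add: \<epsilon>_def)
  obtain d1 where d1: "d1 > 0" "\<And>x. x \<in> K1 \<Longrightarrow> norm (x - x0) < d1 \<Longrightarrow>
      norm (F x - F x0 - A *v (x - x0)) \<le> \<epsilon> * norm (x - x0)"
    using D1 eps unfolding has_derivative_within_alt by blast
  obtain d2 where d2: "d2 > 0" "\<And>x. x \<in> K2 \<Longrightarrow> norm (x - x0) < d2 \<Longrightarrow>
      norm (F x - F x0 - B *v (x - x0)) \<le> \<epsilon> * norm (x - x0)"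
    using D2 eps unfolding has_derivative_within_alt by blast
  define s where "s = min (min d1 d2) r / (2 * m)"
  have s: "s > 0" "s * m < d1" "s * m < d2" "s * m < r"
    using d1(1) d2(1) r m by (auto simp: s_def field_simps min_def)
  define z where "z = x0 + s *\<^sub>R axis i 1"
  have sm: "s \<le> s * m" using s m by simp
  have sr: "s < r" using sm s by linarith
  have nz: "norm (z - x0) = s" using s by (simp add: z_def)
  have zK: "z \<in> K2" using s sr nz by (intro K2) (auto simp: dist_norm z_def)
  have Fz: "norm (F z - F x0 - s *\<^sub>R (A *v w)) \<le> \<epsilon> * s"
    using d2(2)[OF zK] nz s sm by (simp add: z_def matrix_vector_mult_scaleR Aw)
  \<comment> \<open>\<open>q\<close> solves the linearized equation $A (x - x_0) = s B e_i$, and the ball \<open>Q\<close> around it lies in \<open>K1\<close>.\<close>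
  define q where "q = x0 + s *\<^sub>R w"
  define Q where "Q = cball q (s * b / 2)"
  have Qp: "x \<in> K1 \<and> norm (x - x0) \<le> s * m \<and> x $ i < x0 $ i" if "x \<in> Q" for x
  proof -
    have n: "norm (x - q) \<le> s * b / 2" using that by (simp add: Q_def dist_norm norm_minus_commute)
    have "norm (x - x0) \<le> norm (x - q) + norm (s *\<^sub>R w)"
      using norm_triangle_ineq[of "x - q" "s *\<^sub>R w"] by (simp add: q_def algebra_simps)
    also have "\<dots> \<le> s * m" using n s(1) mult_pos_pos[OF s(1) b] by (simp add: m_def algebra_simps)
    finally have 1: "norm (x - x0) \<le> s * m" .
    have "\<bar>(x - q) $ i\<bar> \<le> s * b / 2" using component_le_norm_cart[of "x - q" i] n by linarith
    moreover have "(x - q) $ i = x $ i - x0 $ i + s * b" by (simp add: q_def b_def)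
    ultimately have 2: "x $ i < x0 $ i" using mult_pos_pos[OF s(1) b] by linarith
    show ?thesis using 1 2 s K1[of x] by (auto simp: dist_norm)
  qed
  define \<Psi> where "\<Psi> x = x - Ai *v (F x - F z)" for x
  have "\<Psi> x \<in> Q" if "x \<in> Q" for x
  proof -
    have x: "x \<in> K1" "norm (x - x0) \<le> s * m" using Qp[OF that] by auto
    have "norm (x - x0) < d1" using x s by linarith
    then have "norm (F x - F x0 - A *v (x - x0)) \<le> \<epsilon> * norm (x - x0)"
      using d1(2) x by blast
    also have "\<dots> \<le> \<epsilon> * (s * m)" using x eps by (intro mult_left_mono) auto
    finally have Fx: "norm (F x - F x0 - A *v (x - x0)) \<le> \<epsilon> * (s * m)" .
    have "\<Psi> x - q = Ai *v (A *v (x - x0)) - s *\<^sub>R (Ai *v (A *v w)) - Ai *v (F x - F z)"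
      unfolding AiA by (simp add: \<Psi>_def q_def)
    also have "\<dots> = Ai *v ((F z - F x0 - s *\<^sub>R (A *v w)) - (F x - F x0 - A *v (x - x0)))"
      by (simp only: matrix_vector_mult_diff_distrib matrix_vector_mult_scaleR) simp
    finally have "norm (\<Psi> x - q) \<le> norm ((F z - F x0 - s *\<^sub>R (A *v w)) - (F x - F x0 - A *v (x - x0))) * N"
      using N by simp
    also have "\<dots> \<le> (\<epsilon> * s + \<epsilon> * (s * m)) * N"
      using norm_triangle_ineq4[of "F z - F x0 - s *\<^sub>R (A *v w)" "F x - F x0 - A *v (x - x0)"] Fz Fx N
      by (intro mult_right_mono) auto
    also have "\<dots> \<le> (2 * (\<epsilon> * (s * m))) * N"
      using mult_left_mono[OF sm, of \<epsilon>] eps N by (intro mult_right_mono) linarith+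
    also have "\<dots> = s * b / 4" using N m by (simp add: \<epsilon>_def field_simps)
    also have "\<dots> \<le> s * b / 2" using s b by simp
    finally show ?thesis by (simp add: Q_def dist_norm norm_minus_commute)
  qed
  moreover have "Q \<subseteq> K" using Qp cells by blast
  then have "continuous_on Q \<Psi>" unfolding \<Psi>_def
    by (intro continuous_intros continuous_on_subset[OF cont]
        linear_continuous_on_compose[OF _ matrix_vector_mul_linear])
  moreover have "Q \<noteq> {}" using mult_pos_pos[OF s(1) b] by (simp add: Q_def)
  ultimately obtain x where x: "x \<in> Q" "\<Psi> x = x"
    using brouwer[of Q \<Psi>] by (auto simp: Q_def)
  have "A *v (Ai *v (F x - F z)) = 0" using x by (simp add: \<Psi>_def)
  then have "F x = F z" by (simp add: Ai_def matrix_vector_mul_assoc matrix_inv_mult[OF A])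
  moreover have "x \<in> K" "z \<in> K" using Qp[OF x(1)] zK cells by auto
  ultimately have "x = z" using inj by (auto dest: inj_onD)
  then show False using Qp[OF x(1)] s by (simp add: z_def)
qed

section \<open>Change of variables in two and three dimensions\<close>

text \<open>
  A permutation of the coordinates maps boxes to boxes with the same side lengths.
\<close>

lemma lborel_distr_isometry:
  fixes T :: "'a::euclidean_space \<Rightarrow> 'b::euclidean_space"
  assumes bij: "bij_betw \<pi> (Basis :: 'b set) (Basis :: 'a set)"
    and T: "\<And>x b. b \<in> Basis \<Longrightarrow> T x \<bullet> b = x \<bullet> \<pi> b"
  shows "lborel = distr lborel borel T"
proof (rule lborel_eqI)
  have Tc: "T = (\<lambda>x. \<Sum>b\<in>Basis. (x \<bullet> \<pi> b) *\<^sub>R b)"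
    by (rule ext, rule euclidean_eqI) (simp add: T)
  have [measurable]: "T \<in> borel_measurable borel" unfolding Tc by measurable
  fix l u :: 'b assume le: "\<And>b. b \<in> Basis \<Longrightarrow> l \<bullet> b \<le> u \<bullet> b"
  define \<rho> where "\<rho> = inv_into Basis \<pi>"
  have \<rho>: "\<And>a. a \<in> Basis \<Longrightarrow> \<rho> a \<in> Basis \<and> \<pi> (\<rho> a) = a" "\<And>b. b \<in> Basis \<Longrightarrow> \<rho> (\<pi> b) = b" "\<And>b. b \<in> Basis \<Longrightarrow> \<pi> b \<in> Basis"
    using bij unfolding \<rho>_def bij_betw_def by (auto simp: inv_into_into f_inv_into_f inv_into_f_f)
  define S where "S v = (\<Sum>a\<in>Basis. (v \<bullet> \<rho> a) *\<^sub>R a)" for v :: 'b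
  have S: "S v \<bullet> a = v \<bullet> \<rho> a" if "a \<in> Basis" for v a using that by (simp add: S_def)
  have "T -` box l u = box (S l) (S u)"
  proof (rule set_eqI)
    fix x
    have "(\<forall>b\<in>Basis. l \<bullet> b < x \<bullet> \<pi> b \<and> x \<bullet> \<pi> b < u \<bullet> b) \<longleftrightarrow> (\<forall>a\<in>Basis. l \<bullet> \<rho> a < x \<bullet> a \<and> x \<bullet> a < u \<bullet> \<rho> a)"
      using \<rho> by metis
    then show "x \<in> T -` box l u \<longleftrightarrow> x \<in> box (S l) (S u)" by (simp add: mem_box T S)
  qed
  then have "emeasure (distr lborel borel T) (box l u) = emeasure lborel (box (S l) (S u))"
    by (simp add: emeasure_distr)
  also have "\<dots> = (\<Prod>a\<in>Basis. (S u - S l) \<bullet> a)"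
    by (rule emeasure_lborel_box) (simp add: S le \<rho>(1))
  also have "(\<Prod>a\<in>Basis. (S u - S l) \<bullet> a) = (\<Prod>b\<in>Basis. (S u - S l) \<bullet> \<pi> b)"
    by (rule prod.reindex_bij_betw[OF bij, symmetric])
  also have "\<dots> = (\<Prod>b\<in>Basis. (u - l) \<bullet> b)"
    by (rule prod.cong) (simp_all add: inner_diff_left S \<rho>(2,3))
  finally show "emeasure (distr lborel borel T) (box l u) = (\<Prod>b\<in>Basis. (u - l) \<bullet> b)" .
qed simp

lemma lebesgue_distr_of_lborel:
  fixes T :: "'a::euclidean_space \<Rightarrow> 'b::euclidean_space"
  assumes [measurable]: "T \<in> borel_measurable borel" and eq: "lborel = distr lborel borel T"
  shows "T \<in> lebesgue \<rightarrow>\<^sub>M lebesgue" "lebesgue = distr lebesgue lebesgue T"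
proof -
  have d: "distr lebesgue lborel T = distr lborel borel T"
    by (simp add: distr_completion cong: distr_cong)
  then have ns: "null_sets lborel = null_sets (distr lebesgue lborel T)" using eq by simp
  show "T \<in> lebesgue \<rightarrow>\<^sub>M lebesgue"
    by (simp add: completion.measurable_completion2 ns measurable_completion)
  have "lebesgue = completion (distr lebesgue lborel T)" using d eq by simp
  also have "\<dots> = distr lebesgue lebesgue T"
    by (subst completion.completion_distr_eq) (auto simp: ns measurable_completion)
  finally show "lebesgue = distr lebesgue lebesgue T" .
qed

text \<open>
  Relabelling the coordinates is linear, preserves Lebesgue measure and does not change determinants. It
  carries the change of variables formula from well-ordered coordinate types such as \<open>2\<close> and \<open>3\<close>
  over to any coordinate type of the same size.
\<close>

definition reindex :: "('m::finite \<Rightarrow> 'd::finite) \<Rightarrow> real^'d \<Rightarrow> real^'m" where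
  "reindex \<pi> x = (\<chi> i. x $ \<pi> i)"

lemma reindex_lebesgue:
  fixes \<pi> :: "'m::finite \<Rightarrow> 'd::finite"
  assumes "bij \<pi>"
  shows "reindex \<pi> \<in> lebesgue \<rightarrow>\<^sub>M lebesgue" "distr lebesgue lebesgue (reindex \<pi>) = lebesgue"
proof -
  define \<pi>' where "\<pi>' b = axis (\<pi> (axis_index b)) (1::real)" for b :: "real^'m"
  have Bm: "(Basis :: (real^'m) set) = (\<lambda>i. axis i 1) ` UNIV" and Bd: "(Basis :: (real^'d) set) = (\<lambda>i. axis i 1) ` UNIV"
    by (auto simp: Basis_vec_def)
  have 1: "\<pi>' (axis i 1) = axis (\<pi> i) 1" for i
    by (simp add: \<pi>'_def axis_index_axis)
  have "bij_betw \<pi>' Basis Basis"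
    unfolding bij_betw_def
  proof
    show "inj_on \<pi>' Basis"
      using bij_is_inj[OF assms] by (auto simp: inj_on_def Bm 1 axis_eq_axis)
    show "\<pi>' ` Basis = Basis"
      using bij_is_surj[OF assms] by (force simp: Bm Bd 1 image_image)
  qed
  moreover have "reindex \<pi> x \<bullet> b = x \<bullet> \<pi>' b" if "b \<in> Basis" for x b
    using that by (auto simp: Bm 1 inner_axis reindex_def)
  ultimately have eq: "lborel = distr lborel borel (reindex \<pi>)" by (rule lborel_distr_isometry)
  have m: "reindex \<pi> \<in> borel_measurable borel"
    unfolding reindex_def[abs_def] by (intro borel_measurable_continuous_onI continuous_intros)
  show "reindex \<pi> \<in> lebesgue \<rightarrow>\<^sub>M lebesgue" "distr lebesgue lebesgue (reindex \<pi>) = lebesgue"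
    using lebesgue_distr_of_lborel[OF m eq] by auto
qed

text \<open>
  Conjugation with \<open>\<pi>\<close> is a sign-preserving bijection between the permutations of the two index types.
\<close>

lemma det_reindex:
  fixes A :: "real^'d::finite^'d" and \<pi> :: "'m::finite \<Rightarrow> 'd"
  assumes "bij \<pi>"
  shows "det (\<chi> i j. A $ \<pi> i $ \<pi> j) = det A"
proof -
  define c where "c p = \<pi> \<circ> p \<circ> inv \<pi>" for p
  have ip: "inv \<pi> (\<pi> x) = x" "\<pi> (inv \<pi> y) = y" for x y
    using assms by (simp_all add: bij_is_inj bij_is_surj surj_f_inv_f)
  have bij: "bij_betw c {p. p permutes (UNIV :: 'm set)} {p. p permutes (UNIV :: 'd set)}"
  proof (rule bij_betwI[where g = "\<lambda>q. inv \<pi> \<circ> q \<circ> \<pi>"])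
    show "c \<in> {p. p permutes UNIV} \<rightarrow> {p. p permutes UNIV}"
      using assms by (auto simp: c_def intro!: bij_imp_permutes bij_comp bij_imp_bij_inv dest: permutes_bij)
    show "(\<lambda>q. inv \<pi> \<circ> q \<circ> \<pi>) \<in> {p. p permutes UNIV} \<rightarrow> {p. p permutes UNIV}"
      using assms by (auto intro!: bij_imp_permutes bij_comp bij_imp_bij_inv dest: permutes_bij)
  qed (auto simp: c_def fun_eq_iff ip)
  have sgn: "sign (c p) = sign p" if "p permutes UNIV" for p :: "'m \<Rightarrow> 'm"
  proof -
    have "c p = map_permutation UNIV \<pi> p"
      using assms by (simp add: c_def map_permutation_def restrict_id_def fun_eq_iff bij_is_surj)
    then show ?thesis using that assms by (simp add: sign_map_permutation bij_is_inj)
  qed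
  have "det A = (\<Sum>p | p permutes (UNIV::'m set). of_int (sign (c p)) * (\<Prod>i\<in>UNIV. A $ i $ c p i))"
    unfolding det_def by (rule sum.reindex_bij_betw[OF bij, symmetric])
  also have "\<dots> = (\<Sum>p | p permutes (UNIV::'m set). of_int (sign p) * (\<Prod>i\<in>UNIV. A $ \<pi> i $ \<pi> (p i)))"
  proof (rule sum.cong[OF refl])
    fix p :: "'m \<Rightarrow> 'm" assume "p \<in> {p. p permutes UNIV}"
    moreover have "(\<Prod>i\<in>UNIV. A $ i $ c p i) = (\<Prod>i\<in>UNIV. A $ \<pi> i $ c p (\<pi> i))"
      by (rule prod.reindex_bij_betw[OF assms, symmetric])
    ultimately show "of_int (sign (c p)) * (\<Prod>i\<in>UNIV. A $ i $ c p i) = of_int (sign p) * (\<Prod>i\<in>UNIV. A $ \<pi> i $ \<pi> (p i))"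
      using sgn by (simp add: c_def ip)
  qed
  finally show ?thesis by (simp add: det_def)
qed

lemma reindex_inverse:
  assumes "bij \<pi>"
  shows "reindex (inv \<pi>) (reindex \<pi> x) = x" "reindex \<pi> (reindex (inv \<pi>) y) = y"
  using assms by (auto simp: reindex_def vec_eq_iff bij_is_inj bij_is_surj surj_f_inv_f)

lemma integral_reindex:
  fixes H :: "real^'m::finite \<Rightarrow> real" and \<pi> :: "'m \<Rightarrow> 'd::finite"
  assumes "bij \<pi>"
  shows "integrable lebesgue (\<lambda>x. H (reindex \<pi> x)) \<longleftrightarrow> integrable lebesgue H"
    and "(LINT x|lebesgue. H (reindex \<pi> x)) = integral\<^sup>L lebesgue H"
proof -
  note [measurable] = reindex_lebesgue(1)[OF assms] reindex_lebesgue(1)[OF bij_imp_bij_inv[OF assms]]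
  have meas: "H \<in> borel_measurable lebesgue" if m: "(\<lambda>x. H (reindex \<pi> x)) \<in> borel_measurable lebesgue"
  proof -
    have "(\<lambda>y. H (reindex \<pi> (reindex (inv \<pi>) y))) \<in> borel_measurable lebesgue"
      by (rule measurable_compose[OF _ m]) measurable
    then show ?thesis by (simp add: reindex_inverse[OF assms])
  qed
  have 1: "integrable lebesgue (\<lambda>x. H (reindex \<pi> x)) \<longleftrightarrow> integrable lebesgue H"
    if "H \<in> borel_measurable lebesgue"
    using that reindex_lebesgue[OF assms] integrable_distr_eq[of "reindex \<pi>" lebesgue lebesgue H] by simp
  show *: "integrable lebesgue (\<lambda>x. H (reindex \<pi> x)) \<longleftrightarrow> integrable lebesgue H"
    using 1 meas borel_measurable_integrable by blast
  show "(LINT x|lebesgue. H (reindex \<pi> x)) = integral\<^sup>L lebesgue H"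
  proof (cases "H \<in> borel_measurable lebesgue")
    case True
    then show ?thesis
      using reindex_lebesgue[OF assms] integral_distr[of "reindex \<pi>" lebesgue lebesgue H] by simp
  next
    case False
    then show ?thesis using * borel_measurable_integrable not_integrable_integral_eq by metis
  qed
qed

text \<open>
  A scalar function is treated as a vector-valued one with a single component.
\<close>

lemma change_of_variables_wellorder:
  fixes g :: "real^'m::{finite,wellorder} \<Rightarrow> real^'m::_" and f :: "real^'m::_ \<Rightarrow> real"
  assumes S: "S \<in> sets lebesgue" "g ` S \<in> sets lebesgue"
    and der: "\<And>x. x \<in> S \<Longrightarrow> (g has_derivative g' x) (at x within S)"
    and inj: "inj_on g S"
  shows "integrable (lebesgue_on (g ` S)) f \<longleftrightarrow>
          integrable (lebesgue_on S) (\<lambda>x. \<bar>det (matrix (g' x))\<bar> * f (g x))" (is ?thesis1)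
    and "integral\<^sup>L (lebesgue_on (g ` S)) f =
          (LINT x|lebesgue_on S. \<bar>det (matrix (g' x))\<bar> * f (g x))" (is ?thesis2)
proof -
  let ?D = "\<lambda>x. \<bar>det (matrix (g' x))\<bar>"
  have vec1: "(\<lambda>x. vec (h x) :: real^1) absolutely_integrable_on A \<longleftrightarrow> h absolutely_integrable_on A"
    for h :: "real^'m::_ \<Rightarrow> real" and A
    by (subst absolutely_integrable_componentwise_iff) (simp add: Basis_vec_def inner_axis)
  have vec2: "integral A (\<lambda>x. vec (h x) :: real^1) $ 1 = integral A h" if "h absolutely_integrable_on A"
    for h :: "real^'m::_ \<Rightarrow> real" and A
  proof -
    have "(\<lambda>x. vec (h x) :: real^1) integrable_on A"
      using that vec1[where h = h and A = A] set_lebesgue_integral_eq_integral(1) by blast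
    from integral_linear[OF this bounded_linear_vec_nth[of 1]] show ?thesis by (simp add: o_def)
  qed
  have leb: "integrable (lebesgue_on A) h \<longleftrightarrow> h absolutely_integrable_on A"
    "h absolutely_integrable_on A \<Longrightarrow> integral\<^sup>L (lebesgue_on A) h = integral A h"
    if "A \<in> sets lebesgue" for h :: "real^'m::_ \<Rightarrow> real" and A
    using that integrable_restrict_space[of A lebesgue h]
    by (auto simp: set_integrable_def lebesgue_integral_eq_integral)
  have eq: "(\<lambda>x. ?D x *\<^sub>R vec (f (g x))) = (\<lambda>x. vec (?D x * f (g x)) :: real^1)"
    by (auto simp: vec_eq_iff)
  let ?v = "\<lambda>x. vec (f x) :: real^1" and ?w = "\<lambda>x. vec (?D x * f (g x)) :: real^1"
  have cv: "?w absolutely_integrable_on S \<and> integral S ?w = b \<longleftrightarrow>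
      ?v absolutely_integrable_on (g ` S) \<and> integral (g ` S) ?v = b" for b
    using has_absolute_integral_change_of_variables[OF S(1) der inj, of ?v b] unfolding eq .
  have cv1: "?w absolutely_integrable_on S \<longleftrightarrow> ?v absolutely_integrable_on (g ` S)"
    using cv[of "integral S ?w"] cv[of "integral (g ` S) ?v"] by blast
  have cv2: "integral S ?w = integral (g ` S) ?v" if "?v absolutely_integrable_on (g ` S)"
    using cv[of "integral (g ` S) ?v"] that by blast
  have ai: "f absolutely_integrable_on (g ` S) \<longleftrightarrow> (\<lambda>x. ?D x * f (g x)) absolutely_integrable_on S"
    using cv1 unfolding vec1 by blast
  then show ?thesis1 by (simp only: leb(1)[OF S(1)] leb(1)[OF S(2)])
  show ?thesis2
  proof (cases "f absolutely_integrable_on (g ` S)")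
    case True
    then have T2: "(\<lambda>x. ?D x * f (g x)) absolutely_integrable_on S" using ai by blast
    have "integral\<^sup>L (lebesgue_on (g ` S)) f = integral (g ` S) ?v $ 1"
      using leb(2)[OF S(2) True] vec2[OF True] by (rule trans[OF _ sym])
    also have "\<dots> = integral S ?w $ 1" using cv2 True by (simp only: vec1)
    also have "\<dots> = (LINT x|lebesgue_on S. ?D x * f (g x))"
      using vec2[OF T2] leb(2)[OF S(1) T2] by (rule trans[OF _ sym])
    finally show ?thesis .
  next
    case False
    then have "\<not> integrable (lebesgue_on (g ` S)) f" "\<not> integrable (lebesgue_on S) (\<lambda>x. ?D x * f (g x))"
      using ai by (simp_all only: leb(1)[OF S(1)] leb(1)[OF S(2)] not_False_eq_True)
    then have "integral\<^sup>L (lebesgue_on (g ` S)) f = 0" "(LINT x|lebesgue_on S. ?D x * f (g x)) = 0"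
      by (simp_all only: Bochner_Integration.not_integrable_integral_eq not_False_eq_True)
    then show ?thesis by (rule trans[OF _ sym])
  qed
qed

lemma change_of_variables_reindex:
  fixes g :: "real^'d::finite \<Rightarrow> real^'d" and f :: "real^'d \<Rightarrow> real" and \<pi> :: "'m::{finite,wellorder} \<Rightarrow> 'd"
  assumes \<pi>: "bij \<pi>"
    and S: "S \<in> sets lebesgue" "g ` S \<in> sets lebesgue"
    and der: "\<And>x. x \<in> S \<Longrightarrow> (g has_derivative g' x) (at x within S)"
    and inj: "inj_on g S"
  shows "integrable (lebesgue_on (g ` S)) f \<longleftrightarrow>
          integrable (lebesgue_on S) (\<lambda>x. \<bar>det (matrix (g' x))\<bar> * f (g x))" (is ?thesis1)
    and "integral\<^sup>L (lebesgue_on (g ` S)) f =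
          (LINT x|lebesgue_on S. \<bar>det (matrix (g' x))\<bar> * f (g x))" (is ?thesis2)
proof -
  define T where "T = (reindex \<pi> :: real^'d \<Rightarrow> real^'m::_)"
  define U where "U = (reindex (inv \<pi>) :: real^'m::_ \<Rightarrow> real^'d)"
  have UT[simp]: "U (T x) = x" "T (U y) = y" for x y
    using reindex_inverse[OF \<pi>] by (auto simp: T_def U_def)
  have lin: "bounded_linear T" "bounded_linear U"
    unfolding T_def U_def reindex_def
    by (auto intro!: linear_conv_bounded_linear[THEN iffD1] linearI simp: vec_eq_iff)
  have mT[measurable]: "T \<in> lebesgue \<rightarrow>\<^sub>M lebesgue" and mU[measurable]: "U \<in> lebesgue \<rightarrow>\<^sub>M lebesgue"
    using reindex_lebesgue(1)[OF \<pi>] reindex_lebesgue(1)[OF bij_imp_bij_inv[OF \<pi>]] by (auto simp: T_def U_def)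
  have img: "T ` A = U -` A \<inter> space lebesgue" for A by (force simp: image_iff)
  have TS: "T ` A \<in> sets lebesgue" if "A \<in> sets lebesgue" for A
    unfolding img using that by measurable
  have tr: "integrable (lebesgue_on (T ` A)) h \<longleftrightarrow> integrable (lebesgue_on A) (\<lambda>x. h (T x))"
    "integral\<^sup>L (lebesgue_on (T ` A)) h = (LINT x|lebesgue_on A. h (T x))"
    if A: "A \<in> sets lebesgue" for A and h :: "real^'m::_ \<Rightarrow> real"
  proof -
    have ind: "(if T x \<in> T ` A then h (T x) else 0) = (if x \<in> A then h (T x) else 0)" for x
      by (metis UT(1) image_iff)
    note r = integral_reindex[OF \<pi>, of "\<lambda>y. if y \<in> T ` A then h y else 0", folded T_def, unfolded ind]
    show "integrable (lebesgue_on (T ` A)) h \<longleftrightarrow> integrable (lebesgue_on A) (\<lambda>x. h (T x))"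
      by (rule r(1)[symmetric, unfolded Lebesgue_Measure.integrable_restrict_UNIV[OF A] Lebesgue_Measure.integrable_restrict_UNIV[OF TS[OF A]]])
    show "integral\<^sup>L (lebesgue_on (T ` A)) h = (LINT x|lebesgue_on A. h (T x))"
      by (rule r(2)[symmetric, unfolded Lebesgue_Measure.integral_restrict_UNIV[OF A] Lebesgue_Measure.integral_restrict_UNIV[OF TS[OF A]]])
  qed
  define k where "k = (\<lambda>y. T (g (U y)))"
  define k' where "k' = (\<lambda>y h. T (g' (U y) (U h)))"
  have kS: "k ` T ` S = T ` g ` S" by (auto simp: k_def image_image)
  have kd: "(k has_derivative k' y) (at y within T ` S)" if "y \<in> T ` S" for y
  proof -
    have "(g has_derivative g' (U y)) (at (U y) within U ` T ` S)"
      using der[of "U y"] that by (auto simp: image_image)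
    then have "((\<lambda>y. g (U y)) has_derivative (\<lambda>h. g' (U y) (U h))) (at y within T ` S)"
      using has_derivative_in_compose[OF bounded_linear_imp_has_derivative[OF lin(2)], of g "g' (U y)" y "T ` S"] by simp
    then show ?thesis unfolding k_def k'_def by (rule bounded_linear.has_derivative[OF lin(1)])
  qed
  have ki: "inj_on k (T ` S)"
    using inj unfolding k_def inj_on_def by (auto) (metis UT(1))
  have dk: "det (matrix (k' (T x))) = det (matrix (g' x))" for x
  proof -
    have "U (axis j 1) = axis (\<pi> j) 1" for j
      using \<pi> by (auto simp: U_def reindex_def axis_def vec_eq_iff bij_is_inj bij_is_surj surj_f_inv_f)
    then have "matrix (k' (T x)) = (\<chi> i j. matrix (g' x) $ \<pi> i $ \<pi> j)"
      by (simp add: matrix_def k'_def) (simp add: T_def reindex_def vec_eq_iff)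
    then show ?thesis by (simp add: det_reindex[OF \<pi>])
  qed
  note cv = change_of_variables_wellorder[where S = "T ` S" and g = k and g' = k' and f = "\<lambda>y. f (U y)",
    OF TS[OF S(1)] _ kd ki, unfolded kS, OF TS[OF S(2)]]
  have e: "f (U (k (T x))) = f (g x)" for x by (simp add: k_def)
  show ?thesis1 using cv(1) by (simp add: tr S dk e)
  show ?thesis2 using cv(2) by (simp add: tr S dk e)
qed

text \<open>
  The dimension hypothesis provides a well-ordered coordinate type, \<open>2\<close> or \<open>3\<close>, to relabel with.
\<close>

theorem change_of_variables:
  fixes g :: "real^'d::finite \<Rightarrow> real^'d" and f :: "real^'d \<Rightarrow> real"
  assumes "CARD('d) = 2 \<or> CARD('d) = 3"
    and "S \<in> sets lebesgue" "g ` S \<in> sets lebesgue"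
    and "\<And>x. x \<in> S \<Longrightarrow> (g has_derivative g' x) (at x within S)"
    and "inj_on g S"
  shows "integrable (lebesgue_on (g ` S)) f \<longleftrightarrow>
          integrable (lebesgue_on S) (\<lambda>x. \<bar>det (matrix (g' x))\<bar> * f (g x))" (is ?thesis1)
    and "integral\<^sup>L (lebesgue_on (g ` S)) f =
          (LINT x|lebesgue_on S. \<bar>det (matrix (g' x))\<bar> * f (g x))" (is ?thesis2)
proof -
  consider \<pi> :: "2 \<Rightarrow> 'd" where "bij \<pi>" | \<pi> :: "3 \<Rightarrow> 'd" where "bij \<pi>"
  proof -
    have "\<exists>h. bij_betw h (UNIV :: 2 set) (UNIV :: 'd set)" if "CARD('d) = 2"
      by (rule finite_same_card_bij) (simp_all add: that)
    moreover have "\<exists>h. bij_betw h (UNIV :: 3 set) (UNIV :: 'd set)" if "CARD('d) = 3"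
      by (rule finite_same_card_bij) (simp_all add: that)
    ultimately show thesis using assms(1) that by blast
  qed
  then have "?thesis1 \<and> ?thesis2"
  proof cases
    case 1
    show ?thesis
      by (rule conjI; rule change_of_variables_reindex[OF 1 assms(2-5)])
  next
    case 2
    show ?thesis
      by (rule conjI; rule change_of_variables_reindex[OF 2 assms(2-5)])
  qed
  then show ?thesis1 ?thesis2 by blast+
qed

section \<open>The reference mesh\<close>

text \<open>
  \<open>K\<close> is the closed reference box and \<open>U\<close> the union of the open cells. On \<open>U\<close> the parametrization has
  a derivative in the ordinary sense, and \<open>K - U\<close> is a null set, so most pointwise statements concern \<open>U\<close>.
\<close>

locale mesh =
  fixes G :: "('d::finite) patch" and m :: nat
  assumes regular: "regular_patch m G" and order: "1 \<le> m"
begin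

abbreviation "F \<equiv> param G"
abbreviation "K \<equiv> cbox (first_corner G) (last_corner G)"
abbreviation "K\<^sub>o \<equiv> box (first_corner G) (last_corner G)"
abbreviation "U \<equiv> (\<Union>c\<in>cells G. ref_cell G c)"

lemma num_knots_ge_2: "2 \<le> num_knots G i"
  using regular by (simp add: regular_patch_def)

lemma knot_less: "1 \<le> j \<Longrightarrow> j < k \<Longrightarrow> k \<le> num_knots G i \<Longrightarrow> knot G i j < knot G i k"
  using regular by (simp add: regular_patch_def strict_mono_on_def)

lemma knot_le: "1 \<le> j \<Longrightarrow> j \<le> k \<Longrightarrow> k \<le> num_knots G i \<Longrightarrow> knot G i j \<le> knot G i k"
  using knot_less[of j k i] by (cases "j = k") auto

lemma continuous_param: "continuous_on K F"
  using regular by (simp add: regular_patch_def)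

lemma inj_param: "inj_on F K"
  using regular by (simp add: regular_patch_def)

lemma det_jac_nonzero: "c \<in> cells G \<Longrightarrow> x \<in> closed_ref_cell G c \<Longrightarrow> det (jac G c x) \<noteq> 0"
  using regular by (simp add: regular_patch_def)

lemma cell_knots:
  assumes "c \<in> cells G"
  shows "1 \<le> c i" "Suc (c i) \<le> num_knots G i" "knot G i (c i) < knot G i (Suc (c i))"
    "knot G i 1 \<le> knot G i (c i)" "knot G i (Suc (c i)) \<le> knot G i (num_knots G i)"
  using assms knot_less[of "c i" "Suc (c i)" i] knot_le[of 1 "c i" i] knot_le[of "Suc (c i)" "num_knots G i" i]
  by (auto simp: cells_def Suc_le_eq less_imp_le)

lemma mem_closed_ref_cell:
  "x \<in> closed_ref_cell G c \<longleftrightarrow> (\<forall>i. knot G i (c i) \<le> x $ i \<and> x $ i \<le> knot G i (Suc (c i)))"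
  by (simp add: closed_ref_cell_def mem_box_cart)

lemma mem_ref_cell:
  "x \<in> ref_cell G c \<longleftrightarrow> (\<forall>i. knot G i (c i) < x $ i \<and> x $ i < knot G i (Suc (c i)))"
  by (simp add: ref_cell_def mem_box_cart)

lemma mem_K: "x \<in> K \<longleftrightarrow> (\<forall>i. knot G i 1 \<le> x $ i \<and> x $ i \<le> knot G i (num_knots G i))"
  by (simp add: first_corner_def last_corner_def mem_box_cart)

lemma mem_box_K: "x \<in> K\<^sub>o \<longleftrightarrow>
    (\<forall>i. knot G i 1 < x $ i \<and> x $ i < knot G i (num_knots G i))"
  by (simp add: first_corner_def last_corner_def mem_box_cart)

lemma ref_cell_subset_closed: "ref_cell G c \<subseteq> closed_ref_cell G c"
  unfolding ref_cell_def closed_ref_cell_def by (rule box_subset_cbox)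

lemma open_ref_cell: "open (ref_cell G c)"
  unfolding ref_cell_def by (rule open_box)

lemma closed_ref_cell_subset_K: "c \<in> cells G \<Longrightarrow> closed_ref_cell G c \<subseteq> K"
  unfolding mem_K mem_closed_ref_cell subset_iff by (meson cell_knots(4,5) order.trans)

lemma ref_cell_subset_box: "c \<in> cells G \<Longrightarrow> ref_cell G c \<subseteq> K\<^sub>o"
  unfolding mem_box_K mem_ref_cell subset_iff by (meson cell_knots(4,5) le_less_trans less_le_trans)

lemma U_subset_box: "U \<subseteq> K\<^sub>o"
  using ref_cell_subset_box by blast

lemma U_subset_K: "U \<subseteq> K"
  using U_subset_box box_subset_cbox by blast

lemma open_U: "open U"
  using open_ref_cell by blast

lemma finite_cells: "finite (cells G)"
proof (rule finite_subset)
  show "cells G \<subseteq> (\<Pi>\<^sub>E i\<in>UNIV. {..num_knots G i})" by (auto simp: cells_def less_imp_le)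
qed (auto intro: finite_PiE)

lemma knot_interval:
  assumes "knot G i 1 \<le> t" "t \<le> knot G i (num_knots G i)"
  obtains j where "1 \<le> j" "j < num_knots G i" "knot G i j \<le> t" "t \<le> knot G i (Suc j)"
proof -
  define P where "P j \<longleftrightarrow> j < num_knots G i \<and> 1 \<le> j \<and> knot G i j \<le> t" for j
  have P1: "P 1" using num_knots_ge_2[of i] assms by (simp add: P_def)
  define j where "j = (GREATEST j. P j)"
  have j: "P j" unfolding j_def by (rule GreatestI_nat[where P = P, OF P1, of "num_knots G i"]) (auto simp: P_def)
  have "t \<le> knot G i (Suc j)"
  proof (rule ccontr)
    assume *: "\<not> ?thesis"
    then have "Suc j < num_knots G i" using j assms by (cases "Suc j = num_knots G i") (auto simp: P_def)
    then have "P (Suc j)" using * by (simp add: P_def)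
    then have "Suc j \<le> j" unfolding j_def by (rule Greatest_le_nat[where P = P, of _ "num_knots G i"]) (auto simp: P_def)
    then show False by simp
  qed
  then show ?thesis using that j by (auto simp: P_def)
qed

lemma K_cell:
  assumes "x \<in> K"
  obtains c where "c \<in> cells G" "x \<in> closed_ref_cell G c"
proof -
  have "\<forall>i. \<exists>j. 1 \<le> j \<and> j < num_knots G i \<and> knot G i j \<le> x $ i \<and> x $ i \<le> knot G i (Suc j)"
    using assms knot_interval unfolding mem_K by metis
  then obtain c where "\<forall>i. 1 \<le> c i \<and> c i < num_knots G i \<and> knot G i (c i) \<le> x $ i \<and> x $ i \<le> knot G i (Suc (c i))"
    by metis
  then show ?thesis using that[of c] by (auto simp: cells_def mem_closed_ref_cell)
qed

definition skeleton :: "(real^'d) set" where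
  "skeleton = (\<Union>i. \<Union>j\<in>{1..num_knots G i}. {x. x $ i = knot G i j})"

lemma negligible_coordinate_plane: "negligible {x :: real^'d. x $ i = t}"
proof -
  have "negligible {x :: real^'d. x \<bullet> axis i 1 = t}" by (rule negligible_standard_hyperplane) (simp add: axis_in_Basis_iff)
  then show ?thesis by (simp add: inner_axis)
qed

lemma negligible_skeleton: "negligible skeleton"
  unfolding skeleton_def
  by (auto intro!: negligible_Union negligible_coordinate_plane)

lemma K_minus_skeleton: "x \<in> K \<Longrightarrow> x \<notin> skeleton \<Longrightarrow> x \<in> U"
proof -
  assume x: "x \<in> K" "x \<notin> skeleton"
  obtain c where c: "c \<in> cells G" "x \<in> closed_ref_cell G c" using K_cell[OF x(1)] .
  have "x $ i \<noteq> knot G i j" if "j \<in> {1..num_knots G i}" for i j using x(2) that by (auto simp: skeleton_def)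
  then have "x \<in> ref_cell G c"
    using c(2) cell_knots(1,2)[OF c(1)] unfolding mem_ref_cell mem_closed_ref_cell
    by (metis (no_types) atLeastAtMost_iff less_eq_real_def Suc_leD le_SucI)
  then show ?thesis using c(1) by blast
qed

lemma negligible_K_minus_U: "negligible (K - U)"
  by (rule negligible_subset[OF negligible_skeleton]) (use K_minus_skeleton in blast)

section \<open>Piecewise continuously differentiable functions\<close>

text \<open>
  Continuity on the whole box and continuous derivatives on each closed cell, with possibly different values from
  the two sides of a facet. Both the parametrization and the continuous splines have this regularity.
\<close>

definition piecewise_C1 :: "(real^'d \<Rightarrow> 'b::real_normed_vector) \<Rightarrow> bool" where
  "piecewise_C1 f \<longleftrightarrow> continuous_on K f \<and> (\<forall>c\<in>cells G. \<exists>f'.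
     (\<forall>x\<in>closed_ref_cell G c. (f has_derivative f' x) (at x within closed_ref_cell G c)) \<and>
     (\<forall>i. continuous_on (closed_ref_cell G c) (\<lambda>x. f' x (axis i 1))))"

lemma param_has_derivative:
  assumes "c \<in> cells G" "x \<in> closed_ref_cell G c"
  shows "(F has_derivative (*v) (jac G c x)) (at x within closed_ref_cell G c)"
proof -
  obtain k where k: "m = Suc k" using order by (cases m) auto
  have "F differentiable (at x within closed_ref_cell G c)"
    using regular assms by (auto simp: regular_patch_def k)
  then have "(F has_derivative frechet_derivative F (at x within closed_ref_cell G c)) (at x within closed_ref_cell G c)"
    by (simp add: frechet_derivative_works)
  moreover have "(*v) (jac G c x) = frechet_derivative F (at x within closed_ref_cell G c)"
    unfolding jac_def using calculation by (simp add: matrix_works has_derivative_linear fun_eq_iff)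
  ultimately show ?thesis by simp
qed

lemma continuous_jac:
  assumes "c \<in> cells G"
  shows "continuous_on (closed_ref_cell G c) (jac G c)"
proof -
  obtain k where k: "m = Suc k" using order by (cases m) auto
  have Ck0: "Ck_on k S f \<Longrightarrow> continuous_on S f" for S and f :: "real^'d \<Rightarrow> real^'d"
    by (cases k) (auto intro!: differentiable_imp_continuous_on simp: differentiable_on_def)
  have "continuous_on (closed_ref_cell G c) (\<lambda>x. frechet_derivative F (at x within closed_ref_cell G c) (axis i 1))" for i
    using regular assms by (intro Ck0) (auto simp: regular_patch_def k)
  then show ?thesis
    unfolding jac_def matrix_def by (intro continuous_intros)
qed

lemma piecewise_C1_param: "piecewise_C1 F"
  unfolding piecewise_C1_def
proof (intro conjI ballI continuous_param)
  fix c assume c: "c \<in> cells G"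
  show "\<exists>f'. (\<forall>x\<in>closed_ref_cell G c. (F has_derivative f' x) (at x within closed_ref_cell G c)) \<and>
     (\<forall>i. continuous_on (closed_ref_cell G c) (\<lambda>x. f' x (axis i 1)))"
    using param_has_derivative[OF c] continuous_jac[OF c]
    by (intro exI[of _ "\<lambda>x. (*v) (jac G c x)"]) (auto simp: matrix_vector_mult_basis column_def intro!: continuous_intros)
qed

lemma compact_closed_ref_cell: "compact (closed_ref_cell G c)"
  by (simp add: closed_ref_cell_def)

lemma convex_closed_ref_cell: "convex (closed_ref_cell G c)"
  by (simp add: closed_ref_cell_def)

lemma piecewise_C1_Lipschitz_cell:
  fixes f :: "real^'d \<Rightarrow> 'b::real_normed_vector"
  assumes f: "piecewise_C1 f" and c: "c \<in> cells G"
  obtains L where "0 \<le> L" "\<And>x y. x \<in> closed_ref_cell G c \<Longrightarrow> y \<in> closed_ref_cell G c \<Longrightarrow> norm (f x - f y) \<le> L * norm (x - y)"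
proof -
  let ?C = "closed_ref_cell G c"
  obtain f' where f': "\<And>x. x \<in> ?C \<Longrightarrow> (f has_derivative f' x) (at x within ?C)"
      "\<And>i. continuous_on ?C (\<lambda>x. f' x (axis i 1))"
    using f c unfolding piecewise_C1_def by blast
  have "\<exists>B. \<forall>x\<in>?C. norm (f' x (axis i 1)) \<le> B" for i
  proof -
    have "bounded ((\<lambda>x. f' x (axis i 1)) ` ?C)"
      using compact_imp_bounded compact_continuous_image[OF f'(2) compact_closed_ref_cell] by blast
    then show ?thesis by (auto simp: bounded_iff)
  qed
  then obtain B where B: "\<And>i x. x \<in> ?C \<Longrightarrow> norm (f' x (axis i 1)) \<le> B i" by metis
  define L where "L = (\<Sum>i\<in>UNIV. \<bar>B i\<bar>)"
  have "onorm (f' x) \<le> L" if x: "x \<in> ?C" for x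
  proof (rule onorm_bound)
    fix h :: "real^'d"
    have lin: "linear (f' x)" using f'(1)[OF x] by (rule has_derivative_linear)
    have "f' x h = f' x (\<Sum>i\<in>UNIV. (h $ i) *\<^sub>R axis i 1)"
      by (simp add: basis_expansion flip: scalar_mult_eq_scaleR)
    also have "\<dots> = (\<Sum>i\<in>UNIV. (h $ i) *\<^sub>R f' x (axis i 1))"
      using lin by (simp add: linear_sum linear_scale)
    also have "norm \<dots> \<le> (\<Sum>i\<in>UNIV. norm h * \<bar>B i\<bar>)"
      using B[OF x] by (intro sum_norm_le) (auto intro!: mult_mono component_le_norm_cart order.trans[OF _ abs_ge_self])
    finally show "norm (f' x h) \<le> L * norm h" by (simp add: L_def sum_distrib_left mult.commute)
  qed (simp add: L_def sum_nonneg)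
  then have "norm (f x - f y) \<le> L * norm (x - y)" if "x \<in> ?C" "y \<in> ?C" for x y
    using differentiable_bound[OF convex_closed_ref_cell f'(1), of L y x] that by (simp add: norm_minus_commute)
  then show ?thesis using that[of L] by (simp add: L_def sum_nonneg)
qed

text \<open>
  Lipschitz bounds on neighbouring knot intervals add up at the knots between them.
\<close>

lemma piecewise_Lipschitz_interval:
  fixes f :: "real \<Rightarrow> 'b::real_normed_vector"
  assumes piece: "\<And>j s t. 1 \<le> j \<Longrightarrow> j < num_knots G i \<Longrightarrow> s \<in> {knot G i j..knot G i (Suc j)} \<Longrightarrow>
      t \<in> {knot G i j..knot G i (Suc j)} \<Longrightarrow> norm (f s - f t) \<le> L * \<bar>s - t\<bar>"
    and st: "s \<in> {knot G i 1..knot G i (num_knots G i)}" "t \<in> {knot G i 1..knot G i (num_knots G i)}"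
  shows "norm (f s - f t) \<le> L * \<bar>s - t\<bar>"
proof -
  have *: "norm (f s - f t) \<le> L * (t - s)"
    if "1 \<le> k" "k \<le> num_knots G i" "knot G i 1 \<le> s" "s \<le> t" "t \<le> knot G i k" for k s t
    using that
  proof (induction k arbitrary: s t rule: nat_induct_at_least)
    case base
    then have "s = t" by simp
    then show ?case by simp
  next
    case (Suc k)
    let ?z = "knot G i k"
    have z: "?z \<le> knot G i (Suc k)" "knot G i 1 \<le> ?z" using Suc.hyps Suc.prems knot_le by auto
    consider "t \<le> ?z" | "?z \<le> s" | "s \<le> ?z" "?z \<le> t" by linarith
    then show ?case
    proof cases
      case 1
      then show ?thesis using Suc by simp
    next
      case 2
      then show ?thesis using piece[of k s t] Suc.prems Suc.hyps by auto
    next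
      case 3
      have "norm (f s - f t) \<le> norm (f s - f ?z) + norm (f ?z - f t)"
        using norm_triangle_ineq[of "f s - f ?z" "f ?z - f t"] by simp
      also have "\<dots> \<le> L * (?z - s) + L * (t - ?z)"
        using Suc.IH[of s ?z] piece[of k ?z t] Suc.prems Suc.hyps 3 z by (intro add_mono) auto
      finally show ?thesis by (simp add: algebra_simps)
    qed
  qed
  show ?thesis
  proof (cases "s \<le> t")
    case True
    then show ?thesis using *[of "num_knots G i" s t] st num_knots_ge_2[of i] by auto
  next
    case False
    then show ?thesis using *[of "num_knots G i" t s] st num_knots_ge_2[of i] by (auto simp: norm_minus_commute)
  qed
qed

text \<open>
  On each closed cell this is the mean value inequality. A line parallel to an axis passes through
  cells that differ only in one index, so that the bounds glue along the knots of one direction.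
\<close>

lemma piecewise_C1_Lipschitz_axis:
  fixes f :: "real^'d \<Rightarrow> 'b::real_normed_vector"
  assumes f: "piecewise_C1 f"
  obtains L where "0 \<le> L" "\<And>x h i. x \<in> K \<Longrightarrow> x + h *\<^sub>R axis i 1 \<in> K \<Longrightarrow> norm (f (x + h *\<^sub>R axis i 1) - f x) \<le> L * \<bar>h\<bar>"
proof -
  have "\<exists>L. \<forall>c\<in>cells G. 0 \<le> L c \<and> (\<forall>x\<in>closed_ref_cell G c. \<forall>y\<in>closed_ref_cell G c. norm (f x - f y) \<le> L c * norm (x - y))"
    by (rule bchoice) (metis piecewise_C1_Lipschitz_cell[OF f])
  then obtain L where L: "\<And>c. c \<in> cells G \<Longrightarrow> 0 \<le> L c"
    "\<And>c x y. c \<in> cells G \<Longrightarrow> x \<in> closed_ref_cell G c \<Longrightarrow> y \<in> closed_ref_cell G c \<Longrightarrow> norm (f x - f y) \<le> L c * norm (x - y)"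
    by blast
  define M where "M = (\<Sum>c\<in>cells G. L c)"
  have LM: "L c \<le> M" if "c \<in> cells G" for c
    unfolding M_def using that L(1) finite_cells by (intro member_le_sum) auto
  have M0: "0 \<le> M" unfolding M_def using L(1) by (simp add: sum_nonneg)
  have "norm (f (x + h *\<^sub>R axis i 1) - f x) \<le> M * \<bar>h\<bar>" if x: "x \<in> K" "x + h *\<^sub>R axis i 1 \<in> K" for x h i
  proof -
    define e where "e t = x + (t - x $ i) *\<^sub>R axis i 1" for t
    have e: "e t $ j = (if j = i then t else x $ j)" for t j by (simp add: e_def axis_def)
    have ed: "e s - e t = (s - t) *\<^sub>R axis i 1" for s t by (simp add: e_def algebra_simps)
    obtain c where c: "c \<in> cells G" "x \<in> closed_ref_cell G c" using K_cell[OF x(1)] .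
    have "norm (f (e s) - f (e t)) \<le> M * \<bar>s - t\<bar>"
      if j: "1 \<le> j" "j < num_knots G i" "s \<in> {knot G i j..knot G i (Suc j)}" "t \<in> {knot G i j..knot G i (Suc j)}" for j s t
    proof -
      define c' where "c' = c(i := j)"
      have c': "c' \<in> cells G" using c(1) j by (auto simp: cells_def c'_def)
      have "e s \<in> closed_ref_cell G c'" "e t \<in> closed_ref_cell G c'"
        using c(2) j by (auto simp: mem_closed_ref_cell e c'_def)
      then have "norm (f (e s) - f (e t)) \<le> L c' * norm (e s - e t)" using L(2)[OF c'] by blast
      also have "\<dots> \<le> M * norm (e s - e t)" using LM[OF c'] by (rule mult_right_mono) simp
      finally show ?thesis by (simp add: ed)
    qed
    then have "norm (f (e (x $ i + h)) - f (e (x $ i))) \<le> M * \<bar>x $ i + h - x $ i\<bar>"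
    proof (rule piecewise_Lipschitz_interval)
      show "x $ i + h \<in> {knot G i 1..knot G i (num_knots G i)}"
        using x(2)[unfolded mem_K, rule_format, of i] by (simp add: axis_def)
      show "x $ i \<in> {knot G i 1..knot G i (num_knots G i)}"
        using x(1)[unfolded mem_K, rule_format, of i] by simp
    qed
    then show ?thesis by (simp add: e_def)
  qed
  then show ?thesis using that M0 by blast
qed

lemma at_within_closed_ref_cell:
  "x \<in> ref_cell G c \<Longrightarrow> at x within closed_ref_cell G c = at x"
  by (meson at_within_interior interior_maximal open_ref_cell ref_cell_subset_closed subsetD)

lemma piecewise_C1_has_derivative:
  assumes "piecewise_C1 f" "x \<in> U"
  shows "(f has_derivative frechet_derivative f (at x)) (at x)"
proof -
  obtain c where c: "c \<in> cells G" "x \<in> ref_cell G c" using assms(2) by blast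
  obtain f' where f': "\<And>x. x \<in> closed_ref_cell G c \<Longrightarrow> (f has_derivative f' x) (at x within closed_ref_cell G c)"
    using assms(1) c unfolding piecewise_C1_def by blast
  have "(f has_derivative f' x) (at x)"
    using f'[of x] c at_within_closed_ref_cell ref_cell_subset_closed by fastforce
  then show ?thesis using frechet_derivative_at by metis
qed

lemma piecewise_C1_continuous_partial:
  assumes "piecewise_C1 f"
  shows "continuous_on U (\<lambda>x. frechet_derivative f (at x) (axis i 1))"
proof (rule continuous_on_open_UN)
  show "open (ref_cell G c)" for c by (rule open_ref_cell)
  fix c assume c: "c \<in> cells G"
  obtain f' where f': "\<And>x. x \<in> closed_ref_cell G c \<Longrightarrow> (f has_derivative f' x) (at x within closed_ref_cell G c)"
     "\<And>i. continuous_on (closed_ref_cell G c) (\<lambda>x. f' x (axis i 1))"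
    using assms c unfolding piecewise_C1_def by blast
  have "frechet_derivative f (at x) = f' x" if "x \<in> ref_cell G c" for x
  proof -
    have "(f has_derivative f' x) (at x)"
      using f'(1)[of x] that at_within_closed_ref_cell ref_cell_subset_closed by fastforce
    then show ?thesis using frechet_derivative_at by metis
  qed
  moreover have "continuous_on (ref_cell G c) (\<lambda>x. f' x (axis i 1))"
    using f'(2) ref_cell_subset_closed by (rule continuous_on_subset)
  ultimately show "continuous_on (ref_cell G c) (\<lambda>x. frechet_derivative f (at x) (axis i 1))"
    by (simp cong: continuous_on_cong)
qed

text \<open>
  The Jacobian at interior points of cells; there it is the Jacobian \<open>jac G c\<close> of the cell.
\<close>

definition J :: "real^'d \<Rightarrow> real^'d^'d" where
  "J x = matrix (frechet_derivative F (at x))"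

lemma jac_eq_J: "c \<in> cells G \<Longrightarrow> x \<in> ref_cell G c \<Longrightarrow> jac G c x = J x"
  by (simp add: jac_def J_def at_within_closed_ref_cell)

lemma param_has_derivative_J: "x \<in> U \<Longrightarrow> (F has_derivative (*v) (J x)) (at x)"
  using piecewise_C1_has_derivative[OF piecewise_C1_param, of x]
  by (simp add: J_def matrix_works has_derivative_linear)

lemma det_J_nonzero: "x \<in> U \<Longrightarrow> det (J x) \<noteq> 0"
  using det_jac_nonzero jac_eq_J ref_cell_subset_closed by (metis UN_E subsetD)

lemma continuous_J: "continuous_on U J"
  unfolding J_def matrix_def
  by (intro continuous_intros piecewise_C1_continuous_partial piecewise_C1_param)

end

section \<open>Continuous splines and the orientation of the parametrization\<close>

context mesh begin

definition piece_index :: "'d \<Rightarrow> real \<Rightarrow> nat" where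
  "piece_index i t = (SOME j. 1 \<le> j \<and> j < num_knots G i \<and> knot G i j \<le> t \<and> t \<le> knot G i (Suc j))"

text \<open>
  Continuity at the interior knots (the matching condition with $m = 0$) allows the polynomial pieces to be
  glued. The values of \<open>s\<close> at the knots are arbitrary, so that \<open>s\<close> itself must be corrected there.
\<close>

lemma glue_spline:
  assumes s: "s \<in> spline_space (knot G i) (num_knots G i) k \<alpha>"
    and \<alpha>: "\<And>j. 2 \<le> j \<Longrightarrow> j < num_knots G i \<Longrightarrow> 0 \<le> \<alpha> j"
  obtains p B where "\<And>j x. 1 \<le> j \<Longrightarrow> j < num_knots G i \<Longrightarrow> knot G i j < x \<Longrightarrow> x < knot G i (Suc j) \<Longrightarrow> s x = B x"
    and "\<And>j x. 1 \<le> j \<Longrightarrow> j < num_knots G i \<Longrightarrow> knot G i j \<le> x \<Longrightarrow> x \<le> knot G i (Suc j) \<Longrightarrow> B x = poly (p j) x"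
proof -
  obtain p where p1: "\<And>j x. j \<in> {1..<num_knots G i} \<Longrightarrow> x \<in> {knot G i j<..<knot G i (Suc j)} \<Longrightarrow> s x = poly (p j) x"
    and p2: "\<And>j m. j \<in> {2..<num_knots G i} \<Longrightarrow> int m \<le> \<alpha> j \<Longrightarrow>
        poly ((pderiv ^^ m) (p (j - 1))) (knot G i j) = poly ((pderiv ^^ m) (p j)) (knot G i j)"
    using s unfolding spline_space_def by blast
  have match: "poly (p j) (knot G i (Suc j)) = poly (p (Suc j)) (knot G i (Suc j))"
    if "1 \<le> j" "Suc j < num_knots G i" for j
    using p2[of "Suc j" 0] \<alpha>[of "Suc j"] that by simp
  define B where "B x = poly (p (piece_index i x)) x" for x
  have B: "B x = poly (p j) x" if j: "1 \<le> j" "j < num_knots G i" "knot G i j \<le> x" "x \<le> knot G i (Suc j)" for j x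
  proof -
    define l where "l = piece_index i x"
    have l: "1 \<le> l" "l < num_knots G i" "knot G i l \<le> x" "x \<le> knot G i (Suc l)"
      using someI[of "\<lambda>j. 1 \<le> j \<and> j < num_knots G i \<and> knot G i j \<le> x \<and> x \<le> knot G i (Suc j)" j] j
      by (auto simp: l_def piece_index_def)
    consider "l = j" | "l < j" | "j < l" by linarith
    then have "poly (p l) x = poly (p j) x"
    proof cases
      case 2
      have jl: "j = Suc l"
      proof (rule ccontr)
        assume "j \<noteq> Suc l"
        then have "knot G i (Suc l) < knot G i j" using knot_less[of "Suc l" j i] 2 j(2) by linarith
        then show False using l j by linarith
      qed
      then have "x = knot G i j" using l j by simp
      then show ?thesis using match[of l] l j jl by simp
    next
      case 3
      have lj: "l = Suc j"
      proof (rule ccontr)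
        assume "l \<noteq> Suc j"
        then have "knot G i (Suc j) < knot G i l" using knot_less[of "Suc j" l i] 3 l(2) by linarith
        then show False using l j by linarith
      qed
      then have "x = knot G i l" using l j by simp
      then show ?thesis using match[of j] l j lj by simp
    qed simp
    then show ?thesis by (simp add: B_def l_def)
  qed
  have "s x = B x" if j: "1 \<le> j" "j < num_knots G i" "knot G i j < x" "x < knot G i (Suc j)" for j x
    using p1[of j x] B[of j x] j by auto
  then show ?thesis using that B by blast
qed

text \<open>
  Pieces that agree on closed cells agree on common facets, which gives continuity on the box.
\<close>

lemma piecewise_smooth_imp_piecewise_C1:
  assumes "\<And>c. c \<in> cells G \<Longrightarrow> smooth_expr (E c)"
    and eq: "\<And>c x. c \<in> cells G \<Longrightarrow> x \<in> closed_ref_cell G c \<Longrightarrow> S x = E c x"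
  shows "piecewise_C1 S"
proof -
  have cont: "continuous_on (closed_ref_cell G c) S" if "c \<in> cells G" for c
    by (rule continuous_on_cong[OF refl eq[OF that], THEN iffD2, OF _ smooth_expr_continuous[OF assms(1)[OF that]]])
  have KU: "K = (\<Union>c\<in>cells G. closed_ref_cell G c)"
  proof (rule equalityI)
    show "K \<subseteq> (\<Union>c\<in>cells G. closed_ref_cell G c)" by (meson K_cell UN_I subsetI)
    show "(\<Union>c\<in>cells G. closed_ref_cell G c) \<subseteq> K" by (rule UN_least) (rule closed_ref_cell_subset_K)
  qed
  have "continuous_on K S"
    unfolding KU using finite_cells cont compact_closed_ref_cell
    by (intro continuous_on_closed_Union) (auto intro: compact_imp_closed)
  moreover have "\<exists>f'. (\<forall>x\<in>closed_ref_cell G c. (S has_derivative f' x) (at x within closed_ref_cell G c)) \<and>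
     (\<forall>i. continuous_on (closed_ref_cell G c) (\<lambda>x. f' x (axis i 1)))" if c: "c \<in> cells G" for c
  proof (intro exI[of _ "\<lambda>x. frechet_derivative (E c) (at x)"] conjI ballI allI)
    fix x assume x: "x \<in> closed_ref_cell G c"
    have "(E c has_derivative frechet_derivative (E c) (at x)) (at x)"
      using smooth_expr_differentiable[OF assms(1)[OF c]] frechet_derivative_works by blast
    then have "(E c has_derivative frechet_derivative (E c) (at x)) (at x within closed_ref_cell G c)"
      by (rule has_derivative_at_withinI)
    then show "(S has_derivative frechet_derivative (E c) (at x)) (at x within closed_ref_cell G c)"
      by (rule has_derivative_transform_within[OF _ zero_less_one x]) (simp add: eq[OF c])
  next
    show "continuous_on (closed_ref_cell G c) (\<lambda>x. frechet_derivative (E c) (at x) (axis i 1))" for i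
      by (rule smooth_expr_continuous[OF smooth_expr_partial[OF assms(1)[OF c]]])
  qed
  ultimately show ?thesis unfolding piecewise_C1_def by blast
qed

lemma tensor_spline_piecewise_C1:
  assumes s: "s \<in> tensor_spline_space G k \<alpha>"
    and \<alpha>: "\<And>i j. 2 \<le> j \<Longrightarrow> j < num_knots G i \<Longrightarrow> 0 \<le> \<alpha> i j"
  obtains S where "piecewise_C1 S" "\<And>x. x \<in> U \<Longrightarrow> S x = s x"
proof -
  obtain r :: nat and b where b: "\<And>l j. l < r \<Longrightarrow> b l j \<in> spline_space (knot G j) (num_knots G j) (k j) (\<alpha> j)"
    and s_eq: "s = (\<lambda>x. \<Sum>l<r. \<Prod>j\<in>UNIV. b l j (x $ j))"
    using s unfolding tensor_spline_space_def by blast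
  have "\<exists>p B. (\<forall>j' x. 1 \<le> j' \<and> j' < num_knots G j \<and> knot G j j' < x \<and> x < knot G j (Suc j') \<longrightarrow> b l j x = B x) \<and>
     (\<forall>j' x. 1 \<le> j' \<and> j' < num_knots G j \<and> knot G j j' \<le> x \<and> x \<le> knot G j (Suc j') \<longrightarrow> B x = poly (p j') x)"
    if "l < r" for l j
    using glue_spline[OF b[OF that, of j]] \<alpha> by (metis (no_types, lifting))
  then obtain p B where
    B1: "\<And>l j j' x. l < r \<Longrightarrow> 1 \<le> j' \<Longrightarrow> j' < num_knots G j \<Longrightarrow> knot G j j' < x \<Longrightarrow> x < knot G j (Suc j') \<Longrightarrow> b l j x = B l j x"
    and B2: "\<And>l j j' x. l < r \<Longrightarrow> 1 \<le> j' \<Longrightarrow> j' < num_knots G j \<Longrightarrow> knot G j j' \<le> x \<Longrightarrow> x \<le> knot G j (Suc j') \<Longrightarrow>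
        B l j x = poly (p l j j' :: real poly) x"
    by metis
  define S where "S x = (\<Sum>l<r. \<Prod>j\<in>UNIV. B l j (x $ j))" for x :: "real^'d"
  define E where "E c x = (\<Sum>l<r. \<Prod>j\<in>UNIV. poly (p l j (c j)) (x $ j))" for c and x :: "real^'d"
  have "piecewise_C1 S"
  proof (rule piecewise_smooth_imp_piecewise_C1)
    show "smooth_expr (E c)" for c
      unfolding E_def[abs_def] by (intro smooth_expr_sum smooth_expr_prod smooth_expr_poly)
    show "S x = E c x" if "c \<in> cells G" "x \<in> closed_ref_cell G c" for c x
      unfolding S_def E_def using that B2 cell_knots(1)[OF that(1)]
      by (intro sum.cong prod.cong refl) (auto simp: cells_def mem_closed_ref_cell)
  qed
  moreover have "S x = s x" if x: "x \<in> U" for x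
  proof -
    obtain c where c: "c \<in> cells G" "x \<in> ref_cell G c" using x by blast
    have cj: "1 \<le> c j" "c j < num_knots G j" "knot G j (c j) < x $ j" "x $ j < knot G j (Suc (c j))" for j
      using c by (simp_all add: cells_def mem_ref_cell)
    show ?thesis unfolding S_def s_eq
      by (intro sum.cong prod.cong refl) (rule B1[OF _ cj, symmetric], simp)
  qed
  ultimately show ?thesis using that by blast
qed

lemma continuous_det_jac: "c \<in> cells G \<Longrightarrow> continuous_on (closed_ref_cell G c) (\<lambda>x. det (jac G c x))"
  unfolding det_def by (intro continuous_intros continuous_jac)

lemma cell_center:
  assumes "c \<in> cells G"
  shows "(\<chi> i. (knot G i (c i) + knot G i (Suc (c i))) / 2) \<in> ref_cell G c"
  using cell_knots(3)[OF assms] by (simp add: mem_ref_cell)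

lemma det_jac_same_sign_in_cell:
  assumes c: "c \<in> cells G" and x: "x \<in> closed_ref_cell G c" and y: "y \<in> closed_ref_cell G c"
  shows "sgn (det (jac G c x)) = sgn (det (jac G c y))"
proof (rule ccontr)
  let ?f = "\<lambda>x. det (jac G c x)"
  assume "sgn (?f x) \<noteq> sgn (?f y)"
  then have "?f x < 0 \<and> 0 < ?f y \<or> ?f y < 0 \<and> 0 < ?f x"
    using det_jac_nonzero[OF c x] det_jac_nonzero[OF c y] by (auto simp: sgn_if split: if_splits)
  moreover have "connected (?f ` closed_ref_cell G c)"
    using connected_continuous_image[OF continuous_det_jac[OF c]] convex_connected[OF convex_closed_ref_cell] by blast
  ultimately have "0 \<in> ?f ` closed_ref_cell G c"
    using x y unfolding connected_iff_interval by (metis imageI less_imp_le)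
  then show False using det_jac_nonzero[OF c] by auto
qed

text \<open>
  Linearity of the determinant in column \<open>i\<close>, the only one that may differ from the identity matrix.
\<close>

lemma det_replace_column:
  fixes A :: "real^'d^'d"
  assumes "\<And>j. j \<noteq> i \<Longrightarrow> A *v axis j 1 = axis j 1"
  shows "det A = (A *v axis i 1) $ i"
proof -
  have A: "A $ k $ j = (if j = i then A $ k $ i else if k = j then 1 else 0)" for k j
  proof -
    have "A $ k $ j = (A *v axis j 1) $ k" by (simp add: matrix_vector_mult_basis column_def)
    then show ?thesis using assms[of j] by (cases "j = i") (simp_all add: axis_def)
  qed
  have "transpose A = (\<chi> k. if k = i then column i A else axis k 1)"
    unfolding vec_eq_iff
  proof (intro allI)
    fix k l show "transpose A $ k $ l = (\<chi> k. if k = i then column i A else axis k 1) $ k $ l"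
      using A[of l k] by (simp add: transpose_def column_def axis_def)
  qed
  then have "det A = det (\<chi> k. if k = i then column i A else axis k 1)" by (metis det_transpose)
  also have "column i A = (\<Sum>j\<in>UNIV. A $ j $ i *s axis j 1)"
    by (simp add: vec_eq_iff column_def axis_def if_distrib sum.delta cong: if_cong)
  also have "det (\<chi> k. if k = i then (\<Sum>j\<in>UNIV. A $ j $ i *s axis j 1) else axis k 1)
      = (\<Sum>j\<in>UNIV. A $ j $ i * det (\<chi> k. if k = i then axis j 1 else (axis k 1 :: real^'d)))"
    by (simp add: det_linear_row_sum det_row_mul)
  also have "\<dots> = (\<Sum>j\<in>UNIV. if j = i then A $ j $ i else 0)"
  proof (rule sum.cong[OF refl])
    fix j
    have "det (\<chi> k. if k = i then axis j 1 else (axis k 1 :: real^'d)) = (if j = i then 1 else 0)"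
    proof (cases "j = i")
      case True
      then have "(\<chi> k. if k = i then axis j 1 else axis k 1) = (mat 1 :: real^'d^'d)"
        by (auto simp: vec_eq_iff mat_def axis_def)
      then show ?thesis using True by simp
    next
      case False
      then show ?thesis by (intro det_identical_rows[where i = i and j = j, THEN trans]) (auto simp: row_def vec_eq_iff)
    qed
    then show "A $ j $ i * det (\<chi> k. if k = i then axis j 1 else (axis k 1 :: real^'d)) = (if j = i then A $ j $ i else 0)" by simp
  qed
  finally show ?thesis by (simp add: matrix_vector_mult_basis column_def)
qed

text \<open>
  On the common facet the derivatives of \<open>F\<close> in the tangential directions $e_j$, $j \neq i$, agree. Hence
  $A^{-1} B$, with the Jacobians $A$ and $B$ of the two cells, fixes these vectors, and its
  determinant is its entry with indices $i, i$. Opposite orientations would make this entry negative and so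
  fold the parametrization along the facet.
\<close>

lemma det_jac_sign_adjacent:
  assumes c: "c \<in> cells G" and c': "c(i := Suc (c i)) \<in> cells G" (is "?c' \<in> _")
    and x: "x \<in> ref_facet G (c, i, True)"
  shows "sgn (det (jac G c x)) = sgn (det (jac G ?c' x))"
proof (rule ccontr)
  assume neq: "sgn (det (jac G c x)) \<noteq> sgn (det (jac G ?c' x))"
  let ?A = "jac G c x" and ?B = "jac G ?c' x"
  have xi: "x $ i = knot G i (Suc (c i))" and xj: "\<And>j. j \<noteq> i \<Longrightarrow> knot G j (c j) < x $ j \<and> x $ j < knot G j (Suc (c j))"
    using x by auto
  note xj1 = xj[THEN conjunct1] and xj2 = xj[THEN conjunct2]
  have k1: "knot G i (c i) < knot G i (Suc (c i))" "knot G i (Suc (c i)) < knot G i (Suc (Suc (c i)))"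
    using cell_knots(3)[OF c, of i] cell_knots(3)[OF c', of i] by auto
  have x1: "x \<in> closed_ref_cell G c" unfolding mem_closed_ref_cell
    using xi xj k1 by (metis less_imp_le order_refl)
  have x2: "x \<in> closed_ref_cell G ?c'" unfolding mem_closed_ref_cell
    using xi xj k1 by (auto simp: less_imp_le)
  note D1 = param_has_derivative[OF c x1] and D2 = param_has_derivative[OF c' x2]
  have A: "det ?A \<noteq> 0" "det ?B \<noteq> 0" using det_jac_nonzero c c' x1 x2 by auto
  \<comment> \<open>The distances of \<open>x\<close> to the other faces of the two cells.\<close>
  define R where "R = insert (knot G i (Suc (c i)) - knot G i (c i)) (insert (knot G i (Suc (Suc (c i))) - knot G i (Suc (c i)))
     ((\<lambda>j. x $ j - knot G j (c j)) ` (UNIV - {i}) \<union> (\<lambda>j. knot G j (Suc (c j)) - x $ j) ` (UNIV - {i})))"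
  define r where "r = Min R"
  have finR: "finite R" by (simp add: R_def)
  have r: "r > 0" unfolding r_def using k1 finR by (subst Min_gr_iff) (auto simp: R_def not_less dest: xj1 xj2, use xj1 xj2 in \<open>meson not_le\<close>, use xj1 xj2 in \<open>meson not_le\<close>)
  have rR: "r \<le> y" if "y \<in> R" for y unfolding r_def using finR that by (rule Min_le)
  have rle: "r \<le> knot G i (Suc (c i)) - knot G i (c i)" "r \<le> knot G i (Suc (Suc (c i))) - knot G i (Suc (c i))"
    "\<And>j. j \<noteq> i \<Longrightarrow> r \<le> x $ j - knot G j (c j)" "\<And>j. j \<noteq> i \<Longrightarrow> r \<le> knot G j (Suc (c j)) - x $ j"
    by (rule rR, simp add: R_def)+
  have cl: "\<bar>y $ j - x $ j\<bar> < r" if "dist y x < r" for y j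
    using component_le_norm_cart[of "y - x" j] that by (simp add: dist_norm)
  have K1: "y \<in> closed_ref_cell G c" if "dist y x < r" "y $ i < x $ i" for y
    unfolding mem_closed_ref_cell
  proof
    fix j show "knot G j (c j) \<le> y $ j \<and> y $ j \<le> knot G j (Suc (c j))"
      using cl[OF that(1), of j] that(2) rle xi by (cases "j = i") (force simp: abs_less_iff)+
  qed
  have K2: "y \<in> closed_ref_cell G ?c'" if "dist y x < r" "x $ i < y $ i" for y
    unfolding mem_closed_ref_cell
  proof
    fix j show "knot G j (?c' j) \<le> y $ j \<and> y $ j \<le> knot G j (Suc (?c' j))"
      using cl[OF that(1), of j] that(2) rle xi by (cases "j = i") (force simp: abs_less_iff)+
  qed
  have tang: "?A *v axis j 1 = ?B *v axis j 1" if j: "j \<noteq> i" for j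
  proof -
    let ?L = "closed_ref_cell G c \<inter> closed_ref_cell G ?c'"
    define l where "l t = x + t *\<^sub>R axis j 1" for t :: real
    have lL: "l t \<in> ?L" if "t \<in> {-r<..<r}" for t
    proof -
      have "\<bar>(l t - x) $ j\<bar> < r" using that by (auto simp: l_def)
      then have "knot G k (c k) \<le> l t $ k \<and> l t $ k \<le> knot G k (Suc (c k))" if "k \<noteq> i" for k
        using rle(3,4)[of k] xj[OF that] that j by (cases "k = j") (auto simp: l_def axis_def abs_less_iff)
      moreover have "l t $ i = x $ i" using j by (simp add: l_def axis_def)
      ultimately show ?thesis using xi k1 unfolding Int_iff mem_closed_ref_cell
        by (metis (no_types, lifting) fun_upd_apply less_imp_le order_refl)
    qed
    have dl: "(l has_derivative (\<lambda>t. t *\<^sub>R axis j 1)) (at 0 within {-r<..<r})"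
      unfolding l_def by (auto intro!: derivative_eq_intros)
    have l0: "l 0 = x" by (simp add: l_def)
    have img: "l ` {-r<..<r} \<subseteq> ?L" using lL by auto
    have "((F \<circ> l) has_derivative ((*v) ?A \<circ> (\<lambda>t. t *\<^sub>R axis j 1))) (at 0 within {-r<..<r})"
      using D1 img by (intro diff_chain_within[OF dl]) (auto simp: l0 intro: has_derivative_subset)
    moreover have "((F \<circ> l) has_derivative ((*v) ?B \<circ> (\<lambda>t. t *\<^sub>R axis j 1))) (at 0 within {-r<..<r})"
      using D2 img by (intro diff_chain_within[OF dl]) (auto simp: l0 intro: has_derivative_subset)
    moreover have "at (0::real) within {-r<..<r} = at 0" using r by (intro at_within_open) auto
    ultimately have "(*v) ?A \<circ> (\<lambda>t. t *\<^sub>R axis j 1) = (*v) ?B \<circ> (\<lambda>t. t *\<^sub>R axis j 1)"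
      using has_derivative_unique by metis
    from fun_cong[OF this, of 1] show ?thesis by simp
  qed
  define W where "W = matrix_inv ?A ** ?B"
  have "W *v axis j 1 = axis j 1" if "j \<noteq> i" for j
  proof -
    have "W *v axis j 1 = matrix_inv ?A *v (?A *v axis j 1)"
      using tang[OF that] by (simp add: W_def flip: matrix_vector_mul_assoc)
    then show ?thesis by (simp add: matrix_vector_mul_assoc matrix_inv_mult[OF A(1)])
  qed
  then have detW: "det W = (W *v axis i 1) $ i" by (rule det_replace_column)
  have "?A ** W = ?B" by (simp add: W_def matrix_mul_assoc matrix_inv_mult[OF A(1)])
  then have "det ?A * det W = det ?B" by (metis det_mul)
  then have sg: "sgn (det ?A) * sgn (det W) = sgn (det ?B)" by (simp flip: sgn_mult)
  have "det W < 0"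
  proof (rule ccontr)
    assume "\<not> det W < 0"
    then have "det W = 0 \<or> sgn (det W) = 1" by (auto simp: sgn_if)
    then show False using sg neq A by (auto simp: sgn_zero_iff)
  qed
  then have "(matrix_inv ?A *v (?B *v axis i 1)) $ i < 0"
    using detW by (simp add: W_def matrix_vector_mul_assoc)
  from fold_not_injective[OF continuous_param closed_ref_cell_subset_K[OF c] closed_ref_cell_subset_K[OF c'] x1 x2 D1 D2 A(1) r K1 K2 this]
  show False using inj_param by blast
qed

text \<open>
  Every cell is connected with the corner cell $(1, \dots, 1)$ by a chain of cells in which one index drops
  by one at each step.
\<close>

lemma det_jac_sign:
  obtains \<sigma> where "\<sigma> = 1 \<or> \<sigma> = - 1"
    "\<And>c x. c \<in> cells G \<Longrightarrow> x \<in> closed_ref_cell G c \<Longrightarrow> sgn (det (jac G c x)) = \<sigma>"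
proof -
  define mid where "mid c = (\<chi> i. (knot G i (c i) + knot G i (Suc (c i))) / 2)" for c
  have mid: "c \<in> cells G \<Longrightarrow> mid c \<in> closed_ref_cell G c" for c
    using cell_center ref_cell_subset_closed by (force simp: mid_def)
  define o1 where "o1 = (\<lambda>i::'d. 1::nat)"
  have o1: "o1 \<in> cells G" using num_knots_ge_2 by (auto simp: o1_def cells_def Suc_le_eq numeral_2_eq_2)
  define \<sigma> where "\<sigma> = sgn (det (jac G o1 (mid o1)))"
  have "sgn (det (jac G c x)) = \<sigma>" if "c \<in> cells G" "x \<in> closed_ref_cell G c" for c x
    using that
  proof (induction "\<Sum>i\<in>UNIV. c i" arbitrary: c x rule: less_induct)
    case less
    show ?case
    proof (cases "c = o1")
      case True
      then show ?thesis unfolding \<sigma>_def using det_jac_same_sign_in_cell[OF o1 _ mid[OF o1]] less.prems by blast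
    next
      case False
      then obtain i where i: "c i \<noteq> 1" by (auto simp: o1_def fun_eq_iff)
      then have ci: "c i \<ge> 2" using cell_knots(1)[OF less.prems(1), of i] by linarith
      define c' where "c' = c(i := c i - 1)"
      have c': "c' \<in> cells G" using less.prems(1) ci by (auto simp: cells_def c'_def intro: le_less_trans[OF diff_le_self])
      have c'c: "c'(i := Suc (c' i)) = c" using ci by (auto simp: c'_def)
      have lt: "(\<Sum>i\<in>UNIV. c' i) < (\<Sum>i\<in>UNIV. c i)"
        using ci by (intro sum_strict_mono_ex1) (auto simp: c'_def intro!: bexI[of _ i])
      define z where "z = (\<chi> j. if j = i then knot G i (c i) else mid c $ j)"
      have z: "z \<in> ref_facet G (c', i, True)"
        using ci cell_center[OF less.prems(1)] by (auto simp: z_def c'_def mid_def mem_ref_cell)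
      have kk: "knot G i (c i) < knot G i (Suc (c i))" "knot G i (c i - 1) < knot G i (c i)"
        using cell_knots(3)[OF less.prems(1), of i] cell_knots(3)[OF c', of i] ci by (auto simp: c'_def)
      have z1: "z \<in> closed_ref_cell G c" "z \<in> closed_ref_cell G c'"
        using kk cell_center[OF less.prems(1)] ci by (auto simp: z_def c'_def mem_closed_ref_cell mem_ref_cell mid_def less_imp_le)
      have "sgn (det (jac G c x)) = sgn (det (jac G c z))"
        using det_jac_same_sign_in_cell less.prems z1 by blast
      also have "\<dots> = sgn (det (jac G c' z))"
        using det_jac_sign_adjacent[OF c', of i z] z less.prems(1) by (simp add: c'c)
      also have "\<dots> = \<sigma>" using less.hyps[OF lt c' z1(2)] .
      finally show ?thesis .
    qed
  qed
  moreover have "\<sigma> = 1 \<or> \<sigma> = - 1"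
    using det_jac_nonzero[OF o1 mid[OF o1]] by (simp add: \<sigma>_def sgn_if)
  ultimately show ?thesis using that by blast
qed

lemma det_J_lower_bound:
  obtains \<delta> where "0 < \<delta>" "\<And>c x. c \<in> cells G \<Longrightarrow> x \<in> closed_ref_cell G c \<Longrightarrow> \<delta> \<le> \<bar>det (jac G c x)\<bar>"
proof -
  have "\<exists>d>0. \<forall>x\<in>closed_ref_cell G c. d \<le> \<bar>det (jac G c x)\<bar>" if c: "c \<in> cells G" for c
  proof -
    have ne: "closed_ref_cell G c \<noteq> {}" using cell_center[OF c] ref_cell_subset_closed by blast
    have "continuous_on (closed_ref_cell G c) (\<lambda>x. \<bar>det (jac G c x)\<bar>)"
      by (intro continuous_intros continuous_det_jac c)
    from continuous_attains_inf[OF compact_closed_ref_cell ne this] obtain x where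
      "x \<in> closed_ref_cell G c" "\<forall>y\<in>closed_ref_cell G c. \<bar>det (jac G c x)\<bar> \<le> \<bar>det (jac G c y)\<bar>" by blast
    then show ?thesis using det_jac_nonzero[OF c] by (intro exI[of _ "\<bar>det (jac G c x)\<bar>"]) auto
  qed
  then obtain d where d: "\<And>c. c \<in> cells G \<Longrightarrow> d c > 0"
     "\<And>c x. c \<in> cells G \<Longrightarrow> x \<in> closed_ref_cell G c \<Longrightarrow> d c \<le> \<bar>det (jac G c x)\<bar>" by metis
  define \<delta> where "\<delta> = Min (insert 1 (d ` cells G))"
  have "0 < \<delta>" unfolding \<delta>_def using d(1) finite_cells by (subst Min_gr_iff) auto
  moreover have "\<delta> \<le> d c" if "c \<in> cells G" for c
    unfolding \<delta>_def using that finite_cells by (intro Min_le) auto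
  ultimately show ?thesis using that d(2) by (meson order_trans)
qed

end

section \<open>Facets and slices of the reference box\<close>

definition slide :: "'d::finite \<Rightarrow> real \<Rightarrow> real^'d \<Rightarrow> real^'d" where
  "slide i t x = (\<chi> j. if j = i then t else x $ j)"

lemma slide_nth: "slide i t x $ j = (if j = i then t else x $ j)"
  by (simp add: slide_def)

interpretation lborel_product: product_sigma_finite "\<lambda>_. lborel :: real measure"
  by standard

lemma vec_lambda_measurable: "(\<lambda>f. \<chi> j. f j) \<in> (\<Pi>\<^sub>M (j::'d::finite)\<in>UNIV. lborel :: real measure) \<rightarrow>\<^sub>M borel"
  by (subst borel_measurable_euclidean_space) (auto simp: Basis_vec_def inner_axis)

lemma lborel_eq_PiM:
  "(lborel :: (real^'d::finite) measure) = distr (\<Pi>\<^sub>M (j::'d)\<in>UNIV. lborel) borel (\<lambda>f. \<chi> j. f j)"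
proof (rule lborel_eqI)
  fix l u :: "real^'d" assume le: "\<And>b. b \<in> Basis \<Longrightarrow> l \<bullet> b \<le> u \<bullet> b"
  have le': "l $ j \<le> u $ j" for j using le[of "axis j 1"] by (simp add: inner_axis axis_in_Basis_iff)
  have "(\<lambda>f. \<chi> j. f j) -` box l u \<inter> space (\<Pi>\<^sub>M (j::'d)\<in>UNIV. lborel) = Pi\<^sub>E UNIV (\<lambda>j. {l $ j<..<u $ j})"
    by (auto simp: mem_box_cart space_PiM PiE_iff)
  then have "emeasure (distr (\<Pi>\<^sub>M (j::'d)\<in>UNIV. lborel) borel (\<lambda>f. \<chi> j. f j)) (box l u)
      = emeasure (\<Pi>\<^sub>M (j::'d)\<in>UNIV. lborel) (Pi\<^sub>E UNIV (\<lambda>j. {l $ j<..<u $ j}))"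
    using vec_lambda_measurable by (subst emeasure_distr) auto
  also have "\<dots> = (\<Prod>j\<in>UNIV. ennreal (u $ j - l $ j))"
    using le' by (subst lborel_product.emeasure_PiM) auto
  also have "\<dots> = ennreal (\<Prod>j\<in>UNIV. (u - l) \<bullet> axis j 1)"
    using le' by (simp add: prod_ennreal inner_axis)
  also have "(\<Prod>j\<in>UNIV. (u - l) \<bullet> axis j 1) = (\<Prod>b\<in>(\<lambda>j. axis j 1) ` UNIV. (u - l) \<bullet> b)"
    by (subst prod.reindex) (auto simp: inj_on_def axis_eq_axis)
  also have "(\<lambda>j. axis j 1) ` UNIV = (Basis :: (real^'d) set)" by (auto simp: Basis_vec_def)
  finally show "emeasure (distr (\<Pi>\<^sub>M (j::'d)\<in>UNIV. lborel) borel (\<lambda>f. \<chi> j. f j)) (box l u) = (\<Prod>b\<in>Basis. (u - l) \<bullet> b)" .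
qed simp

abbreviation hyperplane_point :: "'d::finite \<Rightarrow> real \<Rightarrow> ('d \<Rightarrow> real) \<Rightarrow> real^'d" where
  "hyperplane_point i t y \<equiv> (\<chi> j. if j = i then t else y j)"

lemma hyperplane_point_measurable:
  "(hyperplane_point (i :: 'd::finite) t) \<in> (\<Pi>\<^sub>M j\<in>UNIV - {i}. lborel) \<rightarrow>\<^sub>M borel"
proof (subst borel_measurable_euclidean_space, rule ballI)
  fix b :: "real^'d" assume "b \<in> Basis"
  then obtain k where b: "b = axis k 1" by (auto simp: Basis_vec_def)
  show "(\<lambda>y. hyperplane_point i t y \<bullet> b) \<in> borel_measurable (\<Pi>\<^sub>M j\<in>UNIV - {i}. lborel)"
  proof (cases "k = i")
    case False
    then have "(\<lambda>y. y k) \<in> (\<Pi>\<^sub>M j\<in>UNIV - {i}. lborel) \<rightarrow>\<^sub>M (lborel :: real measure)"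
      by (intro measurable_component_singleton) simp
    then show ?thesis using False by (simp add: b inner_axis)
  qed (simp add: b inner_axis)
qed

text \<open>
  Tonelli's theorem for lines in direction \<open>i\<close>, in the coordinates in which facet measures are defined.
\<close>

lemma nn_integral_lborel_slices:
  fixes H :: "real^'d::finite \<Rightarrow> ennreal"
  assumes [measurable]: "H \<in> borel_measurable borel"
  shows "(\<integral>\<^sup>+x. H x \<partial>lborel) =
    (\<integral>\<^sup>+y. (\<integral>\<^sup>+t. H (hyperplane_point i t y) \<partial>lborel) \<partial>(\<Pi>\<^sub>M j\<in>UNIV - {i}. lborel))"
proof -
  note [measurable] = vec_lambda_measurable
  have "(\<integral>\<^sup>+x. H x \<partial>lborel) = (\<integral>\<^sup>+f. H (\<chi> j. f j) \<partial>(\<Pi>\<^sub>M j\<in>UNIV. lborel))"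
    by (subst lborel_eq_PiM, subst nn_integral_distr) auto
  also have "\<dots> = (\<integral>\<^sup>+f. H (\<chi> j. f j) \<partial>(\<Pi>\<^sub>M j\<in>insert i (UNIV - {i}). lborel))"
    by (simp add: insert_absorb)
  also have "\<dots> = (\<integral>\<^sup>+y. (\<integral>\<^sup>+t. H (\<chi> j. (y(i := t)) j) \<partial>lborel) \<partial>(\<Pi>\<^sub>M j\<in>UNIV - {i}. lborel))"
    by (rule lborel_product.product_nn_integral_insert) (auto simp: insert_absorb)
  finally show ?thesis by (simp add: fun_upd_def)
qed

lemma slide_hyperplane_point: "slide i t (hyperplane_point i s y) = hyperplane_point i t y"
  by (simp add: slide_def vec_eq_iff)

lemma slide_nn_integral_measurable:
  fixes H :: "real^'d::finite \<Rightarrow> ennreal"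
  assumes H: "H \<in> borel_measurable borel"
  shows "(\<lambda>x. \<integral>\<^sup>+t. H (slide i t x) \<partial>lborel) \<in> borel_measurable borel"
proof -
  have "(\<lambda>(x, t). slide i t x) \<in> borel_measurable (borel \<Otimes>\<^sub>M borel)"
    unfolding borel_prod case_prod_unfold slide_def
  proof (intro borel_measurable_continuous_onI continuous_on_vec_lambda)
    fix j show "continuous_on UNIV (\<lambda>x :: (real^'d) \<times> real. if j = i then snd x else fst x $ j)"
      by (cases "j = i") (auto intro!: continuous_intros)
  qed
  then have "(\<lambda>(x, t). H (slide i t x)) \<in> borel_measurable (borel \<Otimes>\<^sub>M lborel)"
    using measurable_compose[OF _ H] by (simp add: case_prod_unfold cong: measurable_cong_sets sets_pair_measure_cong)
  then show ?thesis by (rule lborel.borel_measurable_nn_integral)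
qed

context mesh begin

lemma mem_ref_facet:
  "x \<in> ref_facet G (c, i, up) \<longleftrightarrow> x $ i = facet_coord G (c, i, up) \<and>
     (\<forall>j. j \<noteq> i \<longrightarrow> knot G j (c j) < x $ j \<and> x $ j < knot G j (Suc (c j)))"
  by simp

lemma slide_ref_facet:
  assumes "x \<in> ref_facet G (c, i, up)" "knot G i (c i) \<le> t" "t \<le> knot G i (Suc (c i))"
  shows "slide i t x \<in> closed_ref_cell G c"
  using assms unfolding mem_ref_facet mem_closed_ref_cell by (simp add: slide_nth less_imp_le)

lemma slide_self: "x \<in> ref_facet G (c, i, up) \<Longrightarrow> slide i (facet_coord G (c, i, up)) x = x"
  by (simp add: slide_def vec_eq_iff)

lemma facet_coord_mem:
  assumes "c \<in> cells G"
  shows "facet_coord G (c, i, up) \<in> {knot G i (c i)..knot G i (Suc (c i))}"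
  using cell_knots(3)[OF assms, of i] by simp

lemma ref_facet_subset_closed: "c \<in> cells G \<Longrightarrow> ref_facet G (c, i, up) \<subseteq> closed_ref_cell G c"
  using slide_ref_facet facet_coord_mem slide_self by (metis atLeastAtMost_iff subsetI)

lemma borel_ref_facet: "ref_facet G (c, i, up) \<in> sets borel"
proof -
  have eq: "ref_facet G (c, i, up) = {x. x $ i = facet_coord G (c, i, up)} \<inter>
      (\<Inter>j\<in>UNIV - {i}. {x. knot G j (c j) < x $ j} \<inter> {x. x $ j < knot G j (Suc (c j))})"
    by auto
  have "closed {x :: real^'d. x $ i = facet_coord G (c, i, up)}"
    by (intro closed_Collect_eq continuous_intros)
  moreover have "open (\<Inter>j\<in>UNIV - {i}. {x :: real^'d. knot G j (c j) < x $ j} \<inter> {x. x $ j < knot G j (Suc (c j))})"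
    by (intro open_INT ballI open_Int open_Collect_less continuous_intros) simp
  ultimately show ?thesis unfolding eq by (intro sets.Int borel_closed borel_open)
qed

text \<open>
  If column \<open>i\<close> of \<open>A\<close> is replaced by a unit vector orthogonal to the other columns, the result \<open>B\<close> is invertible
  and the matrix in question is $B^T B$.
\<close>

lemma gram_matrix_det_pos:
  fixes A :: "real^'d^'d"
  assumes "det A \<noteq> 0"
  shows "0 < det (\<chi> a b. if a = i \<or> b = i then (if a = b then 1 else 0) else column a A \<bullet> column b A)"
proof -
  \<comment> \<open>Row \<open>i\<close> of $A^{-1}$ is orthogonal to every column of $A$ except column \<open>i\<close>.\<close>
  define n where "n = sgn (transpose (matrix_inv A) *v axis i (1::real))"
  have orth: "(transpose (matrix_inv A) *v axis i (1::real)) \<bullet> column a A = (if a = i then 1 else 0)" for a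
  proof -
    have "(transpose (matrix_inv A) *v axis i (1::real)) \<bullet> column a A = (axis i 1 v* matrix_inv A) \<bullet> (A *v axis a 1)"
      by (subst transpose_matrix_vector) (simp only: matrix_vector_mult_basis)
    also have "\<dots> = axis i 1 \<bullet> (matrix_inv A *v (A *v axis a 1))"
      by (rule dot_lmul_matrix)
    also have "\<dots> = (if a = i then 1 else 0)"
      by (simp add: matrix_vector_mul_assoc matrix_inv_mult[OF assms] inner_axis_axis)
    finally show ?thesis .
  qed
  have "transpose (matrix_inv A) *v axis i (1::real) \<noteq> 0" using orth[of i] by auto
  then have nn: "n \<bullet> n = 1" by (simp add: n_def norm_sgn flip: power2_norm_eq_inner)
  have no: "n \<bullet> column a A = 0" if "a \<noteq> i" for a
    using orth[of a] that by (simp add: n_def sgn_div_norm)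
  define B :: "real^'d^'d" where "B = (\<chi> k l. if l = i then n $ k else A $ k $ l)"
  have cB: "column l B = (if l = i then n else column l A)" for l
    by (simp add: B_def column_def vec_eq_iff)
  have M: "(\<chi> a b. if a = i \<or> b = i then (if a = b then 1 else 0) else column a A \<bullet> column b A) = transpose B ** B"
    by (auto simp: vec_eq_iff matrix_mult_transpose_dot_column cB nn no inner_commute)
  have "det B \<noteq> 0"
  proof
    assume "det B = 0"
    then obtain z where z: "z \<noteq> 0" "B *v z = 0"
      using invertible_det_nz[of B] invertible_left_inverse[of B] matrix_left_invertible_ker[of B] by blast
    have Bz: "B *v z = (\<Sum>l\<in>UNIV. z $ l *\<^sub>R column l B)"
      by (simp add: matrix_mult_sum scalar_mult_eq_scaleR)
    have "0 = n \<bullet> (B *v z)" using z by simp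
    also have "\<dots> = (\<Sum>l\<in>UNIV. if l = i then z $ l else 0)"
      unfolding Bz inner_sum_right by (rule sum.cong) (auto simp: cB nn no)
    finally have zi: "z $ i = 0" by simp
    have "A *v z = (\<Sum>l\<in>UNIV. z $ l *\<^sub>R column l A)"
      by (simp add: matrix_mult_sum scalar_mult_eq_scaleR)
    also have "\<dots> = (\<Sum>l\<in>UNIV. z $ l *\<^sub>R column l B)"
      by (rule sum.cong) (auto simp: cB zi)
    finally have "A *v z = 0" using Bz z by simp
    then have "matrix_inv A *v (A *v z) = 0" by simp
    then show False using z by (simp add: matrix_vector_mul_assoc matrix_inv_mult[OF assms])
  qed
  then have "0 < det B * det B" by (simp flip: power2_eq_square)
  then show ?thesis unfolding M by (simp add: det_mul det_transpose)
qed

lemma area_element_pos: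
  "c \<in> cells G \<Longrightarrow> x \<in> closed_ref_cell G c \<Longrightarrow> 0 < area_element G (c, i, up) x"
  using gram_matrix_det_pos[OF det_jac_nonzero] by simp

lemma continuous_area_element:
  assumes "c \<in> cells G"
  shows "continuous_on (closed_ref_cell G c) (area_element G (c, i, up))"
proof -
  have "continuous_on (closed_ref_cell G c) (\<lambda>x. if a = i \<or> b = i then (if a = b then 1 else 0)
     else column a (jac G c x) \<bullet> column b (jac G c x))" for a b
    unfolding column_def by (cases "a = i \<or> b = i") (auto intro!: continuous_intros continuous_jac assms)
  then have "continuous_on (closed_ref_cell G c) (\<lambda>x. sqrt (det (\<chi> a b. if a = i \<or> b = i then (if a = b then 1 else 0)
     else column a (jac G c x) \<bullet> column b (jac G c x))))"
    unfolding det_def by (intro continuous_intros) simp_all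
  then show ?thesis by simp
qed

lemma area_element_measurable:
  assumes "c \<in> cells G"
  shows "(\<lambda>x. ennreal (area_element G (c, i, up) x)) \<in> borel_measurable
     (restrict_space (distr (\<Pi>\<^sub>M j\<in>UNIV - {i}. lborel) borel (hyperplane_point i t)) (ref_facet G (c, i, up)))"
proof -
  have "area_element G (c, i, up) \<in> borel_measurable (restrict_space borel (ref_facet G (c, i, up)))"
    by (rule borel_measurable_continuous_on_restrict)
       (rule continuous_on_subset[OF continuous_area_element[OF assms] ref_facet_subset_closed[OF assms]])
  then have "(\<lambda>x. ennreal (area_element G (c, i, up) x)) \<in> borel_measurable (restrict_space borel (ref_facet G (c, i, up)))"
    by (rule measurable_compose) simp
  then show ?thesis
    by (rule measurable_cong_sets[THEN equalityD1, THEN subsetD, rotated 2]) (simp_all add: sets_restrict_space)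
qed

lemma space_facet_measure: "space (facet_measure G (c, i, up)) = ref_facet G (c, i, up)"
  by (simp add: space_restrict_space del: ref_facet.simps)

lemma sets_facet_measure: "sets (facet_measure G (c, i, up)) = sets (restrict_space borel (ref_facet G (c, i, up)))"
  by (simp add: sets_restrict_space del: ref_facet.simps)

lemma continuous_facet_measurable:
  fixes f :: "real^'d \<Rightarrow> 'b::{second_countable_topology, real_normed_vector}"
  assumes "continuous_on (ref_facet G (c, i, up)) f"
  shows "f \<in> borel_measurable (facet_measure G (c, i, up))"
  using borel_measurable_continuous_on_restrict[OF assms]
  by (rule measurable_cong_sets[THEN equalityD1, THEN subsetD, rotated 2]) (simp_all only: sets_facet_measure)

text \<open>
  The facet measure is Lebesgue measure on the facet times a bounded area element, so that integrating over the
  facet and along the lines orthogonal to it is controlled by the volume integral. This is the link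
  between $L^2(\Omega)$ and $L^2(\partial\Omega)$ used for traces.
\<close>

lemma nn_integral_facet_slices:
  assumes c: "c \<in> cells G"
  obtains A where "0 \<le> A" "\<And>H :: real^'d \<Rightarrow> ennreal. H \<in> borel_measurable borel \<Longrightarrow>
    (\<integral>\<^sup>+x. (\<integral>\<^sup>+t. H (slide i t x) \<partial>lborel) \<partial>facet_measure G (c, i, up)) \<le> ennreal A * (\<integral>\<^sup>+x. H x \<partial>lborel)"
proof -
  let ?R = "ref_facet G (c, i, up)" and ?area = "area_element G (c, i, up)" and ?b = "facet_coord G (c, i, up)"
  let ?\<mu> = "\<Pi>\<^sub>M j\<in>UNIV - {i}. lborel :: real measure"
  have "bounded (?area ` closed_ref_cell G c)"
    using compact_imp_bounded compact_continuous_image[OF continuous_area_element[OF c] compact_closed_ref_cell] by blast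
  then obtain A where A: "A > 0" "\<And>x. x \<in> closed_ref_cell G c \<Longrightarrow> \<bar>?area x\<bar> \<le> A" by (auto simp: bounded_pos)
  have "(\<integral>\<^sup>+x. (\<integral>\<^sup>+t. H (slide i t x) \<partial>lborel) \<partial>facet_measure G (c, i, up)) \<le> ennreal A * (\<integral>\<^sup>+x. H x \<partial>lborel)"
    if H: "H \<in> borel_measurable borel" for H :: "real^'d \<Rightarrow> ennreal"
  proof -
    define W where "W x = (\<integral>\<^sup>+t. H (slide i t x) \<partial>lborel)" for x
    have Wm: "W \<in> borel_measurable borel" unfolding W_def[abs_def] by (rule slide_nn_integral_measurable[OF H])
    have Wm': "W \<in> borel_measurable (restrict_space (distr ?\<mu> borel (hyperplane_point i ?b)) ?R)"
      using measurable_restrict_space1[OF Wm] by (rule measurable_cong_sets[THEN equalityD1, THEN subsetD, rotated 2]) (simp_all add: sets_restrict_space)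
    have "(\<integral>\<^sup>+x. W x \<partial>facet_measure G (c, i, up)) =
        (\<integral>\<^sup>+x. ennreal (?area x) * W x \<partial>restrict_space (distr ?\<mu> borel (hyperplane_point i ?b)) ?R)"
      unfolding facet_measure.simps by (rule nn_integral_density[OF area_element_measurable[OF c] Wm'])
    also have "\<dots> \<le> (\<integral>\<^sup>+x. ennreal A * W x \<partial>restrict_space (distr ?\<mu> borel (hyperplane_point i ?b)) ?R)"
    proof (rule nn_integral_mono)
      fix x assume "x \<in> space (restrict_space (distr ?\<mu> borel (hyperplane_point i ?b)) ?R)"
      then have "x \<in> ?R" by (simp add: space_restrict_space del: ref_facet.simps)
      then have "?area x \<le> A" using A(2) ref_facet_subset_closed[OF c] abs_le_D1 by blast
      then show "ennreal (?area x) * W x \<le> ennreal A * W x" by (intro mult_right_mono ennreal_leI) auto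
    qed
    also have "\<dots> = (\<integral>\<^sup>+x. ennreal A * W x * indicator ?R x \<partial>distr ?\<mu> borel (hyperplane_point i ?b))"
      using borel_ref_facet by (intro nn_integral_restrict_space) (simp del: ref_facet.simps)
    also have "\<dots> \<le> (\<integral>\<^sup>+x. ennreal A * W x \<partial>distr ?\<mu> borel (hyperplane_point i ?b))"
      by (intro nn_integral_mono) (auto simp: indicator_def)
    also have "\<dots> = ennreal A * (\<integral>\<^sup>+x. W x \<partial>distr ?\<mu> borel (hyperplane_point i ?b))"
      using Wm by (intro nn_integral_cmult) simp
    also have "(\<integral>\<^sup>+x. W x \<partial>distr ?\<mu> borel (hyperplane_point i ?b)) = (\<integral>\<^sup>+y. W (hyperplane_point i ?b y) \<partial>?\<mu>)"
      using Wm by (intro nn_integral_distr hyperplane_point_measurable) simp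
    also have "\<dots> = (\<integral>\<^sup>+x. H x \<partial>lborel)"
      unfolding W_def slide_hyperplane_point by (rule nn_integral_lborel_slices[OF H, symmetric])
    finally show ?thesis unfolding W_def .
  qed
  then show ?thesis using that[of A] A(1) by auto
qed

text \<open>
  The area element is positive, and so is the measure of every nonempty relatively open part of the facet.
\<close>

lemma AE_facet_measure_continuous_0:
  fixes f :: "real^'d \<Rightarrow> real"
  assumes c: "c \<in> cells G" and cont: "continuous_on (ref_facet G (c, i, up)) f"
    and ae: "AE x in facet_measure G (c, i, up). f x = 0" and x0: "x0 \<in> ref_facet G (c, i, up)"
  shows "f x0 = 0"
proof (rule ccontr)
  let ?R = "ref_facet G (c, i, up)" and ?b = "facet_coord G (c, i, up)"
  let ?\<mu> = "\<Pi>\<^sub>M j\<in>UNIV - {i}. lborel :: real measure"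
  assume "f x0 \<noteq> 0"
  then obtain d where d: "d > 0" "\<And>x. x \<in> ?R \<Longrightarrow> dist x x0 < d \<Longrightarrow> dist (f x) (f x0) < \<bar>f x0\<bar>"
    using cont x0 unfolding continuous_on_iff by (metis zero_less_abs_iff)
  have fne: "f x \<noteq> 0" if "x \<in> ?R" "dist x x0 < d" for x using d(2)[OF that] by (auto simp: dist_real_def)
  have AE1: "AE x in restrict_space (distr ?\<mu> borel (hyperplane_point i ?b)) ?R. f x = 0"
  proof -
    have "AE x in restrict_space (distr ?\<mu> borel (hyperplane_point i ?b)) ?R. 0 < ennreal (area_element G (c, i, up) x) \<longrightarrow> f x = 0"
      using ae unfolding facet_measure.simps by (subst (asm) AE_density[OF area_element_measurable[OF c]])
    then show ?thesis
    proof (rule AE_mp, intro AE_I2 impI)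
      fix x assume "x \<in> space (restrict_space (distr ?\<mu> borel (hyperplane_point i ?b)) ?R)"
        and *: "0 < ennreal (area_element G (c, i, up) x) \<longrightarrow> f x = 0"
      then have "x \<in> closed_ref_cell G c" using ref_facet_subset_closed[OF c] by (auto simp: space_restrict_space simp del: ref_facet.simps)
      then show "f x = 0" using * area_element_pos[OF c] ennreal_less_zero_iff by blast
    qed
  qed
  then have "AE x in distr ?\<mu> borel (hyperplane_point i ?b). x \<in> ?R \<longrightarrow> f x = 0"
    using borel_ref_facet by (subst (asm) AE_restrict_space_iff) (simp_all del: ref_facet.simps)
  then obtain N where N: "N \<in> sets borel" "emeasure (distr ?\<mu> borel (hyperplane_point i ?b)) N = 0"
     "{x. \<not> (x \<in> ?R \<longrightarrow> f x = 0)} \<subseteq> N" by (auto elim!: AE_E simp del: ref_facet.simps)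
  define \<epsilon> where "\<epsilon> = d / (CARD('d) + 1)"
  have \<epsilon>: "0 < \<epsilon>" using d by (simp add: \<epsilon>_def)
  define lo where "lo j = max (knot G j (c j)) (x0 $ j - \<epsilon>)" for j
  define hi where "hi j = min (knot G j (Suc (c j))) (x0 $ j + \<epsilon>)" for j
  have lohi: "lo j < hi j" if "j \<noteq> i" for j
  proof -
    have "knot G j (c j) < x0 $ j" "x0 $ j < knot G j (Suc (c j))" using x0 that by auto
    then show ?thesis using \<epsilon> by (auto simp: lo_def hi_def)
  qed
  have inN: "hyperplane_point i ?b y \<in> N" if y: "y \<in> Pi\<^sub>E (UNIV - {i}) (\<lambda>j. {lo j<..<hi j})" for y
  proof -
    let ?x = "hyperplane_point i ?b y"
    have yj: "lo j < y j" "y j < hi j" if "j \<noteq> i" for j using y that by (auto simp: PiE_iff)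
    have xR: "?x \<in> ?R" using yj by (auto simp: lo_def hi_def)
    have "\<bar>?x $ j - x0 $ j\<bar> \<le> \<epsilon>" for j
      using yj[of j] x0 \<epsilon> by (cases "j = i") (auto simp: lo_def hi_def abs_le_iff)
    then have "norm (?x - x0) \<le> (\<Sum>j\<in>(UNIV::'d set). \<epsilon>)"
      by (intro order.trans[OF norm_le_l1_cart] sum_mono) simp
    also have "\<dots> < d" using d by (simp add: \<epsilon>_def field_simps)
    finally have "f ?x \<noteq> 0" using fne[OF xR] by (simp add: dist_norm)
    then show ?thesis using N(3) xR by blast
  qed
  have "emeasure ?\<mu> (Pi\<^sub>E (UNIV - {i}) (\<lambda>j. {lo j<..<hi j})) \<le> emeasure ?\<mu> (hyperplane_point i ?b -` N \<inter> space ?\<mu>)"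
    using inN measurable_sets[OF hyperplane_point_measurable N(1), of i ?b]
    by (intro emeasure_mono) (auto simp: space_PiM PiE_iff)
  also have "\<dots> = 0" using N by (subst emeasure_distr[symmetric]) (auto intro: hyperplane_point_measurable)
  finally have "emeasure ?\<mu> (Pi\<^sub>E (UNIV - {i}) (\<lambda>j. {lo j<..<hi j})) = 0" by simp
  moreover have "emeasure ?\<mu> (Pi\<^sub>E (UNIV - {i}) (\<lambda>j. {lo j<..<hi j})) = (\<Prod>j\<in>UNIV - {i}. ennreal (hi j - lo j))"
    using lohi by (subst lborel_product.emeasure_PiM) (auto intro!: prod.cong simp: less_imp_le)
  moreover have "\<dots> = ennreal (\<Prod>j\<in>UNIV - {i}. hi j - lo j)"
    using lohi by (intro prod_ennreal) (simp add: less_imp_le)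
  moreover have "0 < (\<Prod>j\<in>UNIV - {i}. hi j - lo j)" using lohi by (intro prod_pos) simp
  ultimately show False by (metis ennreal_eq_0_iff not_less)
qed

end

section \<open>Square-integrable functions and integrals over the physical domain\<close>

lemma L2_imp_integrable_inner:
  assumes "f \<in> L2 M" "g \<in> L2 M"
  shows "integrable M (\<lambda>x. f x \<bullet> g x)"
proof (rule Bochner_Integration.integrable_bound)
  show "integrable M (\<lambda>x. (norm (f x))\<^sup>2 + (norm (g x))\<^sup>2)"
    using assms by (simp add: L2_def)
  show "(\<lambda>x. f x \<bullet> g x) \<in> borel_measurable M"
    using assms by (auto simp: L2_def intro!: borel_measurable_inner)
  show "AE x in M. norm (f x \<bullet> g x) \<le> norm ((norm (f x))\<^sup>2 + (norm (g x))\<^sup>2)"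
  proof (rule AE_I2)
    fix x
    have "2 * (norm (f x) * norm (g x)) \<le> (norm (f x))\<^sup>2 + (norm (g x))\<^sup>2"
      using sum_squares_bound[of "norm (f x)" "norm (g x)"] by (simp add: mult.assoc)
    moreover have "\<bar>f x \<bullet> g x\<bar> \<le> norm (f x) * norm (g x)" by (rule Cauchy_Schwarz_ineq2)
    moreover have "0 \<le> norm (f x) * norm (g x)" by simp
    ultimately show "norm (f x \<bullet> g x) \<le> norm ((norm (f x))\<^sup>2 + (norm (g x))\<^sup>2)"
      unfolding real_norm_def by linarith
  qed
qed

lemma norm_diff_squared_le: "(norm (a - b))\<^sup>2 \<le> 2 * (norm a)\<^sup>2 + 2 * (norm (b :: 'a::real_inner))\<^sup>2"
proof -
  have "(norm (a - b))\<^sup>2 \<le> (norm a + norm b)\<^sup>2" by (intro power_mono norm_triangle_ineq4) simp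
  also have "\<dots> \<le> 2 * (norm a)\<^sup>2 + 2 * (norm b)\<^sup>2"
    using sum_squares_bound[of "norm a" "norm b"] by (simp add: power2_sum)
  finally show ?thesis .
qed

lemma L2_diff:
  assumes "f \<in> L2 M" "g \<in> L2 M"
  shows "(\<lambda>x. f x - g x) \<in> L2 M"
proof -
  have m: "(\<lambda>x. f x - g x) \<in> borel_measurable M" using assms by (auto simp: L2_def)
  have "integrable M (\<lambda>x. (norm (f x - g x))\<^sup>2)"
  proof (rule Bochner_Integration.integrable_bound)
    show "integrable M (\<lambda>x. 2 * (norm (f x))\<^sup>2 + 2 * (norm (g x))\<^sup>2)"
      using assms by (simp add: L2_def)
    show "(\<lambda>x. (norm (f x - g x))\<^sup>2) \<in> borel_measurable M" using m by measurable
    show "AE x in M. norm ((norm (f x - g x))\<^sup>2) \<le> norm (2 * (norm (f x))\<^sup>2 + 2 * (norm (g x))\<^sup>2)"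
      using norm_diff_squared_le by (intro AE_I2) simp
  qed
  then show ?thesis using m by (simp add: L2_def)
qed

lemma L2_norm_squared: "(L2_norm M f)\<^sup>2 = (LINT x|M. (norm (f x))\<^sup>2)"
  by (simp add: L2_norm_def L2_inner_def power2_norm_eq_inner)

lemma L2_norm_tendsto_0:
  assumes "(\<lambda>n. L2_norm M (f n)) \<longlonglongrightarrow> 0"
  shows "(\<lambda>n. LINT x|M. (norm (f n x))\<^sup>2) \<longlonglongrightarrow> 0"
  using tendsto_power[OF assms, of 2] by (simp add: L2_norm_squared)

lemma bounded_imp_L2:
  assumes "finite_measure M" "f \<in> borel_measurable M" "\<And>x. x \<in> space M \<Longrightarrow> norm (f x) \<le> B"
  shows "f \<in> L2 M"
proof -
  interpret finite_measure M by fact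
  have "integrable M (\<lambda>x. (norm (f x))\<^sup>2)"
  proof (rule integrable_const_bound)
    show "AE x in M. norm ((norm (f x))\<^sup>2) \<le> B\<^sup>2"
      using assms(3) by (intro AE_I2) (simp add: power_mono)
    show "(\<lambda>x. (norm (f x))\<^sup>2) \<in> borel_measurable M" using assms(2) by simp
  qed
  then show ?thesis using assms(2) by (simp add: L2_def)
qed

lemma Ck_on_1_gradient:
  assumes "Ck_on (Suc 0) UNIV \<phi>"
  shows "(\<phi> has_derivative (\<lambda>h. gradient \<phi> x \<bullet> h)) (at x)" "continuous_on UNIV (gradient \<phi>)"
proof -
  have d: "(\<phi> has_derivative frechet_derivative \<phi> (at x)) (at x)" for x
    using assms by (simp flip: frechet_derivative_works)
  have "frechet_derivative \<phi> (at x) h = gradient \<phi> x \<bullet> h" for x h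
  proof -
    have "frechet_derivative \<phi> (at x) h = frechet_derivative \<phi> (at x) (\<Sum>i\<in>UNIV. (h $ i) *\<^sub>R axis i 1)"
      by (simp add: basis_expansion flip: scalar_mult_eq_scaleR)
    also have "\<dots> = (\<Sum>i\<in>UNIV. (h $ i) * frechet_derivative \<phi> (at x) (axis i 1))"
      using has_derivative_linear[OF d] by (simp add: linear_sum linear_scale)
    finally show ?thesis by (simp add: gradient_def inner_vec_def mult.commute)
  qed
  then have "frechet_derivative \<phi> (at x) = (\<lambda>h. gradient \<phi> x \<bullet> h)" for x by blast
  then show "(\<phi> has_derivative (\<lambda>h. gradient \<phi> x \<bullet> h)) (at x)" using d by metis
  show "continuous_on UNIV (gradient \<phi>)"
    unfolding gradient_def using assms by (intro continuous_on_vec_lambda) simp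
qed

lemma H1_weak_grad: "u \<in> H1 \<Omega> \<Longrightarrow> is_weak_grad \<Omega> u (weak_grad \<Omega> u)"
  using someI_ex[of "is_weak_grad \<Omega> u"] by (auto simp: H1_def weak_grad_def)

text \<open>
  Cauchy--Schwarz for $p(s) - p(t) = \int p'$, in the form $0 \le \int (p' - k)^2$ with the mean value \<open>k\<close> of \<open>p'\<close>.
\<close>

lemma increment_squared_le:
  fixes p p' :: "real \<Rightarrow> real"
  assumes cont: "continuous_on {l..u} p" "continuous_on {l..u} p'"
    and der: "\<And>s. s \<in> {l<..<u} \<Longrightarrow> (p has_real_derivative p' s) (at s)"
    and mem: "s \<in> {l..u}" "t \<in> {l..u}"
  shows "ennreal ((p s - p t)\<^sup>2) \<le> ennreal \<bar>s - t\<bar> * (\<integral>\<^sup>+x. ennreal (indicator {l..u} x * (p' x)\<^sup>2) \<partial>lborel)"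
proof -
  define I where "I = integral {l..u} (\<lambda>x. (p' x)\<^sup>2)"
  have int2: "(\<lambda>x. (p' x)\<^sup>2) integrable_on A" if "A = {a..b}" "A \<subseteq> {l..u}" for A a b
    unfolding that(1)
    by (rule integrable_continuous_interval, rule continuous_on_subset[OF continuous_on_power[OF cont(2)]])
       (use that in blast)
  have nn: "(\<integral>\<^sup>+x. ennreal (indicator {l..u} x * (p' x)\<^sup>2) \<partial>lborel) = ennreal I"
  proof (rule nn_integral_has_integral_lborel)
    have "continuous_on {l..u} (\<lambda>x. (p' x)\<^sup>2)" by (rule continuous_on_power[OF cont(2)])
    then show "(\<lambda>x. indicator {l..u} x * (p' x)\<^sup>2) \<in> borel_measurable borel"
      using borel_measurable_continuous_on_indicator[of "{l..u}" "\<lambda>x. (p' x)\<^sup>2"] by simp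
    have "((\<lambda>x. (p' x)\<^sup>2) has_integral I) {l..u}" using int2 by (simp add: I_def integrable_integral)
    then have "((\<lambda>x. if x \<in> {l..u} then (p' x)\<^sup>2 else 0) has_integral I) UNIV" by (simp only: has_integral_restrict_UNIV)
    moreover have "(\<lambda>x. if x \<in> {l..u} then (p' x)\<^sup>2 else 0) = (\<lambda>x. indicator {l..u} x * (p' x)\<^sup>2)" by (auto simp: indicator_def)
    ultimately show "((\<lambda>x. indicator {l..u} x * (p' x)\<^sup>2) has_integral I) UNIV" by simp
  qed simp
  have ordered: "(p b - p a)\<^sup>2 \<le> (b - a) * I" if ab: "a < b" "a \<in> {l..u}" "b \<in> {l..u}" for a b
  proof -
    define D where "D = p b - p a"
    have sub: "{a..b} \<subseteq> {l..u}" using ab by auto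
    have "(p' has_integral D) {a..b}" unfolding D_def
    proof (rule fundamental_theorem_of_calculus_interior)
      show "continuous_on {a..b} p" using cont(1) sub by (rule continuous_on_subset)
      show "(p has_vector_derivative p' x) (at x)" if "x \<in> {a<..<b}" for x
        using der[of x] that ab by (simp add: has_real_derivative_iff_has_vector_derivative)
    qed (use ab in simp)
    then have i1: "p' integrable_on {a..b}" "integral {a..b} p' = D" by (auto simp: has_integral_integrable integral_unique)
    have i2: "(\<lambda>x. (p' x)\<^sup>2) integrable_on {a..b}" using int2 sub by blast
    define k where "k = D / (b - a)"
    have kD: "k * (b - a) = D" using ab by (simp add: k_def)
    have "(\<lambda>x. (p' x - k)\<^sup>2) = (\<lambda>x. ((p' x)\<^sup>2 - 2 * k * p' x) + k\<^sup>2)" by (auto simp: power2_diff algebra_simps)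
    moreover have "((\<lambda>x. ((p' x)\<^sup>2 - 2 * k * p' x) + k\<^sup>2) has_integral (integral {a..b} (\<lambda>x. (p' x)\<^sup>2) - 2 * k * D) + (b - a) * k\<^sup>2) {a..b}"
      using ab has_integral_const_real[of "k\<^sup>2" a b] i1 i2
      by (intro has_integral_add has_integral_diff has_integral_mult_right) (auto simp: integrable_integral)
    ultimately have "0 \<le> (integral {a..b} (\<lambda>x. (p' x)\<^sup>2) - 2 * k * D) + (b - a) * k\<^sup>2"
      using has_integral_nonneg by (metis zero_le_power2)
    moreover have "(b - a) * k\<^sup>2 = k * D" by (simp add: kD[symmetric] power2_eq_square)
    ultimately have "k * D \<le> integral {a..b} (\<lambda>x. (p' x)\<^sup>2)" by (simp add: mult.commute)
    also have "\<dots> \<le> I" unfolding I_def using int2[of "{l..u}" l u] i2 sub by (intro integral_subset_le) auto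
    finally have "(b - a) * (k * D) \<le> (b - a) * I" using ab by (intro mult_left_mono) auto
    moreover have "(b - a) * (k * D) = D\<^sup>2" using kD by (metis mult.assoc mult.commute power2_eq_square)
    ultimately show ?thesis by (simp add: D_def)
  qed
  have "(p s - p t)\<^sup>2 \<le> \<bar>s - t\<bar> * I"
    using ordered[of s t] ordered[of t s] mem by (cases s t rule: linorder_cases) (auto simp: power2_commute)
  then have "ennreal ((p s - p t)\<^sup>2) \<le> ennreal (\<bar>s - t\<bar> * I)" by (rule ennreal_leI)
  also have "\<dots> = ennreal \<bar>s - t\<bar> * ennreal I"
    by (rule ennreal_mult) (auto simp: I_def intro!: integral_nonneg int2)
  finally show ?thesis by (simp add: nn)
qed

lemma integrable_lebesgue_on_iff:
  fixes h :: "'a::euclidean_space \<Rightarrow> real"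
  assumes "A \<in> sets lebesgue"
  shows "integrable (lebesgue_on A) h \<longleftrightarrow> h absolutely_integrable_on A"
    "h absolutely_integrable_on A \<Longrightarrow> integral\<^sup>L (lebesgue_on A) h = integral A h"
  using assms integrable_restrict_space[of A lebesgue h]
  by (auto simp: set_integrable_def lebesgue_integral_eq_integral)

context mesh begin

lemma open_domain: "open (domain G)"
  unfolding domain_def
  by (intro invariance_of_domain continuous_on_subset[OF continuous_param] inj_on_subset[OF inj_param]
      box_subset_cbox open_box)

lemma bounded_domain: "bounded (domain G)"
  unfolding domain_def
  by (rule bounded_subset[OF compact_imp_bounded[OF compact_continuous_image[OF continuous_param compact_cbox]]])
     (intro image_mono box_subset_cbox)

lemma domain_lmeasurable: "domain G \<in> lmeasurable"
  by (intro lmeasurable_open bounded_domain open_domain)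

lemma finite_measure_domain: "finite_measure (lebesgue_on (domain G))"
  by (intro finite_measure_lebesgue_on domain_lmeasurable)

lemma continuous_imp_L2_domain:
  fixes f :: "real^'d \<Rightarrow> 'b::euclidean_space"
  assumes "continuous_on UNIV f"
  shows "f \<in> L2 (lebesgue_on (domain G))"
proof -
  have "bounded (f ` closure (domain G))"
    using assms bounded_domain
    by (intro compact_imp_bounded compact_continuous_image) (auto intro: continuous_on_subset simp: compact_closure)
  then obtain B where "\<And>x. x \<in> closure (domain G) \<Longrightarrow> norm (f x) \<le> B" by (auto simp: bounded_iff)
  moreover have "f \<in> borel_measurable (lebesgue_on (domain G))"
    using borel_measurable_continuous_onI[OF assms] by (intro measurable_restrict_space1 measurable_completion) simp
  ultimately show ?thesis
    using closure_subset by (intro bounded_imp_L2[OF finite_measure_domain, of _ B]) (auto simp: space_restrict_space)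
qed

lemma image_U_subset_domain: "F ` U \<subseteq> domain G"
  unfolding domain_def using U_subset_box by blast

lemma negligible_domain_minus: "negligible (domain G - F ` U)"
proof (rule negligible_subset)
  have "negligible (F ` (closed_ref_cell G c \<inter> (K - U)))" if c: "c \<in> cells G" for c
  proof (rule negligible_differentiable_image_negligible)
    show "negligible (closed_ref_cell G c \<inter> (K - U))"
      by (rule negligible_subset[OF negligible_K_minus_U]) blast
    show "F differentiable_on closed_ref_cell G c \<inter> (K - U)"
      unfolding differentiable_on_def
    proof
      fix x assume "x \<in> closed_ref_cell G c \<inter> (K - U)"
      then have "F differentiable at x within closed_ref_cell G c"
        using param_has_derivative[OF c] by (auto intro: differentiableI)
      then show "F differentiable at x within closed_ref_cell G c \<inter> (K - U)"
        by (rule differentiable_within_subset) blast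
    qed
  qed simp
  then show "negligible (\<Union>c\<in>cells G. F ` (closed_ref_cell G c \<inter> (K - U)))"
    using finite_cells by (intro negligible_Union) auto
  show "domain G - F ` U \<subseteq> (\<Union>c\<in>cells G. F ` (closed_ref_cell G c \<inter> (K - U)))"
  proof
    fix y assume "y \<in> domain G - F ` U"
    then obtain x where x: "y = F x" "x \<in> K" "x \<notin> U" unfolding domain_def using box_subset_cbox by blast
    obtain c where "c \<in> cells G" "x \<in> closed_ref_cell G c" using K_cell[OF x(2)] .
    then show "y \<in> (\<Union>c\<in>cells G. F ` (closed_ref_cell G c \<inter> (K - U)))" using x by blast
  qed
qed

lemma open_image_U: "open (F ` U)"
  by (intro invariance_of_domain continuous_on_subset[OF continuous_param] inj_on_subset[OF inj_param]
      open_U U_subset_K)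

text \<open>
  The parametrization is differentiable on \<open>U\<close>, and it maps the rest of the box to a null set.
\<close>

lemma domain_change_of_variables:
  fixes f :: "real^'d \<Rightarrow> real"
  assumes dim: "CARD('d) = 2 \<or> CARD('d) = 3"
  shows "integrable (lebesgue_on (domain G)) f \<longleftrightarrow> integrable (lebesgue_on U) (\<lambda>x. \<bar>det (J x)\<bar> * f (F x))" (is ?A)
    and "integral\<^sup>L (lebesgue_on (domain G)) f = (LINT x|lebesgue_on U. \<bar>det (J x)\<bar> * f (F x))" (is ?B)
proof -
  have meas: "U \<in> sets lebesgue" "F ` U \<in> sets lebesgue" "domain G \<in> sets lebesgue"
    using open_U open_image_U open_domain by auto
  have der: "(F has_derivative (*v) (J x)) (at x within U)" if "x \<in> U" for x
    using param_has_derivative_J[OF that] by (rule has_derivative_at_withinI)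
  have inj: "inj_on F U" using inj_param U_subset_K by (rule inj_on_subset)
  note cv = change_of_variables[OF dim meas(1,2) der inj, of f, unfolded matrix_of_matrix_vector_mul]
  have n: "negligible {x \<in> domain G - F ` U. f x \<noteq> 0}" "negligible {x \<in> F ` U - domain G. f x \<noteq> 0}"
    by (rule negligible_subset[OF negligible_domain_minus], blast)
       (rule negligible_subset[OF negligible_empty], use image_U_subset_domain in blast)
  have ai: "f absolutely_integrable_on domain G \<longleftrightarrow> f absolutely_integrable_on F ` U"
    by (rule absolutely_integrable_spike_set_eq[OF n])
  have i: "integral (domain G) f = integral (F ` U) f"
    by (rule integral_spike_set[OF n])
  have 1: "integrable (lebesgue_on (domain G)) f \<longleftrightarrow> integrable (lebesgue_on (F ` U)) f"
    unfolding integrable_lebesgue_on_iff(1)[OF meas(2)] integrable_lebesgue_on_iff(1)[OF meas(3)] by (rule ai)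
  show ?A unfolding 1 by (rule cv(1))
  have "integral\<^sup>L (lebesgue_on (domain G)) f = integral\<^sup>L (lebesgue_on (F ` U)) f"
  proof (cases "f absolutely_integrable_on domain G")
    case True
    then show ?thesis using integrable_lebesgue_on_iff(2)[OF meas(2)] integrable_lebesgue_on_iff(2)[OF meas(3)] ai i by simp
  next
    case False
    then have "\<not> integrable (lebesgue_on (domain G)) f" "\<not> integrable (lebesgue_on (F ` U)) f"
      using ai integrable_lebesgue_on_iff(1)[OF meas(2)] integrable_lebesgue_on_iff(1)[OF meas(3)] by blast+
    then show ?thesis by (simp add: Bochner_Integration.not_integrable_integral_eq)
  qed
  then show ?B using cv(2) by simp
qed

lemma closed_cell_minus_skeleton:
  assumes "c \<in> cells G" "x \<in> closed_ref_cell G c" "x \<notin> skeleton"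
  shows "x \<in> ref_cell G c"
proof -
  have "knot G i (c i) < x $ i \<and> x $ i < knot G i (Suc (c i))" for i
  proof -
    have "x $ i \<noteq> knot G i j" if "j \<in> {1..num_knots G i}" for j using assms(3) that by (auto simp: skeleton_def)
    then have "x $ i \<noteq> knot G i (c i)" "x $ i \<noteq> knot G i (Suc (c i))" using cell_knots(1,2)[OF assms(1), of i] by auto
    then show ?thesis using assms(2) unfolding mem_closed_ref_cell by (metis less_eq_real_def)
  qed
  then show ?thesis by (simp add: mem_ref_cell)
qed

text \<open>
  Norms over a reference cell are controlled by norms over $\Omega$ because $|\det DF|$ is bounded below.
\<close>

lemma nn_integral_cell_le:
  fixes f k :: "real^'d \<Rightarrow> real"
  assumes dim: "CARD('d) = 2 \<or> CARD('d) = 3" and c: "c \<in> cells G"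
    and f: "integrable (lebesgue_on (domain G)) f" "\<And>y. 0 \<le> f y"
    and k: "k \<in> borel_measurable borel" "\<And>x. x \<in> ref_cell G c \<Longrightarrow> k x = f (F x)" "\<And>x. x \<notin> closed_ref_cell G c \<Longrightarrow> k x = 0"
    and \<delta>: "0 < \<delta>" "\<And>c x. c \<in> cells G \<Longrightarrow> x \<in> closed_ref_cell G c \<Longrightarrow> \<delta> \<le> \<bar>det (jac G c x)\<bar>"
  shows "(\<integral>\<^sup>+x. ennreal (k x) \<partial>lborel) \<le> ennreal ((1 / \<delta>) * integral\<^sup>L (lebesgue_on (domain G)) f)"
proof -
  let ?d = "\<lambda>x. \<bar>det (J x)\<bar> * f (F x)"
  have U: "U \<in> sets lebesgue" using open_U by auto
  have i: "integrable (lebesgue_on U) ?d" using domain_change_of_variables(1)[OF dim] f(1) by blast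
  have "(\<integral>\<^sup>+x. ennreal (k x) \<partial>lborel) = (\<integral>\<^sup>+x. ennreal (k x) \<partial>lebesgue)"
    using k(1) by (simp add: nn_integral_completion)
  also have "\<dots> \<le> (\<integral>\<^sup>+x. ennreal ((1 / \<delta>) * ?d x) * indicator U x \<partial>lebesgue)"
  proof (rule nn_integral_mono_AE, rule AE_I'[of skeleton])
    show "skeleton \<in> null_sets lebesgue" using negligible_skeleton negligible_iff_null_sets by blast
    have "ennreal (k x) \<le> ennreal ((1 / \<delta>) * ?d x) * indicator U x" if "x \<notin> skeleton" for x
    proof (cases "x \<in> closed_ref_cell G c")
      case True
      then have xc: "x \<in> ref_cell G c" using closed_cell_minus_skeleton c that by blast
      have "\<delta> \<le> \<bar>det (J x)\<bar>" using \<delta>(2)[OF c True] jac_eq_J[OF c xc] by simp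
      then have "1 \<le> (1 / \<delta>) * \<bar>det (J x)\<bar>" using \<delta>(1) by (simp add: field_simps)
      then have "1 * f (F x) \<le> (1 / \<delta>) * \<bar>det (J x)\<bar> * f (F x)" by (rule mult_right_mono) (rule f(2))
      moreover have "x \<in> U" using xc c by blast
      ultimately show ?thesis using k(2)[OF xc] by (simp add: mult.assoc ennreal_leI del: times_divide_eq_left)
    qed (simp add: k(3))
    then show "{x \<in> space lebesgue. \<not> ennreal (k x) \<le> ennreal ((1 / \<delta>) * ?d x) * indicator U x} \<subseteq> skeleton" by blast
  qed
  also have "\<dots> = (\<integral>\<^sup>+x. ennreal ((1 / \<delta>) * ?d x) \<partial>lebesgue_on U)"
    using U by (simp add: nn_integral_restrict_space)
  also have "\<dots> = ennreal (LINT x|lebesgue_on U. (1 / \<delta>) * ?d x)"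
    using i f(2) \<delta>(1) by (intro nn_integral_eq_integral) auto
  also have "(LINT x|lebesgue_on U. (1 / \<delta>) * ?d x) = (1 / \<delta>) * integral\<^sup>L (lebesgue_on (domain G)) f"
    unfolding domain_change_of_variables(2)[OF dim] by (rule integral_mult_right_zero)
  finally show ?thesis .
qed

end

section \<open>Traces and boundary limits\<close>

lemma Ck_on_UNIV_imp_continuous: "Ck_on k UNIV f \<Longrightarrow> continuous_on UNIV f"
  by (cases k) (auto intro!: differentiable_imp_continuous_on simp: differentiable_on_def)

lemma four_squares_le:
  fixes a b c d :: real
  shows "(a + b + c + d)\<^sup>2 \<le> 4 * (a\<^sup>2 + b\<^sup>2 + c\<^sup>2 + d\<^sup>2)"
proof -
  have "0 \<le> (a - b)\<^sup>2 + (a - c)\<^sup>2 + (a - d)\<^sup>2 + (b - c)\<^sup>2 + (b - d)\<^sup>2 + (c - d)\<^sup>2" by simp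
  then show ?thesis by (simp add: power2_eq_square algebra_simps)
qed

context mesh begin

lemma slide_ref_cell:
  assumes "x \<in> ref_facet G (c, i, up)" "knot G i (c i) < t" "t < knot G i (Suc (c i))"
  shows "slide i t x \<in> ref_cell G c"
  using assms unfolding mem_ref_facet mem_ref_cell by (simp add: slide_nth)

text \<open>
  At depth \<open>t\<close> below the facet, $g - V$ is split into the error of the boundary values, the increment of
  $\phi\circ F$ along the line to depth \<open>t\<close>, the error $\phi\circ F - V$ at depth \<open>t\<close>, and the oscillation of
  \<open>V\<close>. Integration over all depths up to \<open>d\<close> and over the facet gives the claim. What matters is the factor $d^2$
  in front of the gradient term: after division by \<open>d\<close> this term tends to $0$ with \<open>d\<close> although the gradients of
  an approximating sequence are merely bounded in $L^2$.
\<close>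

lemma trace_estimate:
  fixes \<phi> V :: "real^'d \<Rightarrow> real" and gg :: "real^'d \<Rightarrow> real"
  assumes c: "c \<in> cells G" and smooth: "\<And>k. Ck_on k UNIV \<phi>"
    and V: "continuous_on (closed_ref_cell G c) V"
    and A: "\<And>H :: real^'d \<Rightarrow> ennreal. H \<in> borel_measurable borel \<Longrightarrow>
      (\<integral>\<^sup>+x. (\<integral>\<^sup>+t. H (slide i t x) \<partial>lborel) \<partial>facet_measure G (c, i, up)) \<le> ennreal A * (\<integral>\<^sup>+x. H x \<partial>lborel)"
    and A0: "0 \<le> A"
    and gm: "gg \<in> borel_measurable (facet_measure G (c, i, up))"
    and d: "0 < d" "d \<le> knot G i (Suc (c i)) - knot G i (c i)"
    and w: "0 \<le> w" "\<And>x y. x \<in> closed_ref_cell G c \<Longrightarrow> y \<in> closed_ref_cell G c \<Longrightarrow> norm (x - y) \<le> d \<Longrightarrow> \<bar>V x - V y\<bar> \<le> w"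
    and a: "(\<integral>\<^sup>+x. ennreal ((gg x - \<phi> (F x))\<^sup>2) \<partial>facet_measure G (c, i, up)) \<le> ennreal a" "0 \<le> a"
    and n: "(\<integral>\<^sup>+x. ennreal (if x \<in> closed_ref_cell G c then (\<phi> (F x) - V x)\<^sup>2 else 0) \<partial>lborel) \<le> ennreal n" "0 \<le> n"
    and h: "(\<integral>\<^sup>+x. ennreal (if x \<in> closed_ref_cell G c then (gradient \<phi> (F x) \<bullet> (jac G c x *v axis i 1))\<^sup>2 else 0) \<partial>lborel) \<le> ennreal h" "0 \<le> h"
    and \<mu>: "emeasure (facet_measure G (c, i, up)) (ref_facet G (c, i, up)) \<le> ennreal \<mu>" "0 \<le> \<mu>"
  shows "ennreal d * (\<integral>\<^sup>+x. ennreal ((gg x - V x)\<^sup>2) \<partial>facet_measure G (c, i, up))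
     \<le> ennreal (4 * (d * a + d * (d * (A * h)) + A * n + d * (w\<^sup>2 * \<mu>)))"
proof -
  let ?M = "facet_measure G (c, i, up)" and ?C = "closed_ref_cell G c" and ?R = "ref_facet G (c, i, up)"
  let ?lo = "knot G i (c i)" and ?hi = "knot G i (Suc (c i))" and ?b = "facet_coord G (c, i, up)"
  define fe where "fe x = ennreal (if x \<in> ?C then (\<phi> (F x) - V x)\<^sup>2 else 0)" for x
  define he where "he x = ennreal (if x \<in> ?C then (gradient \<phi> (F x) \<bullet> (jac G c x *v axis i 1))\<^sup>2 else 0)" for x
  have g1: "\<And>x. (\<phi> has_derivative (\<lambda>h. gradient \<phi> x \<bullet> h)) (at x)" "continuous_on UNIV (gradient \<phi>)"
    using Ck_on_1_gradient[OF smooth] by auto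
  have FC: "continuous_on ?C F" by (rule continuous_on_subset[OF continuous_param closed_ref_cell_subset_K[OF c]])
  have \<phi>C: "continuous_on ?C (\<lambda>x. \<phi> (F x))"
    by (rule continuous_on_compose2[OF Ck_on_UNIV_imp_continuous[OF smooth] FC]) simp
  have gC: "continuous_on ?C (\<lambda>x. gradient \<phi> (F x) \<bullet> (jac G c x *v axis i 1))"
    unfolding matrix_vector_mult_basis column_def
    by (intro continuous_intros continuous_on_compose2[OF g1(2) FC] continuous_jac c) simp
  have Cb: "?C \<in> sets borel" using compact_closed_ref_cell by (intro borel_closed compact_imp_closed)
  have fem: "fe \<in> borel_measurable borel"
    unfolding fe_def[abs_def]
    by (intro measurable_compose[OF _ measurable_ennreal] borel_measurable_continuous_on_if Cb
        continuous_intros \<phi>C V) 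
  have hem: "he \<in> borel_measurable borel"
    unfolding he_def[abs_def]
    by (intro measurable_compose[OF _ measurable_ennreal] borel_measurable_continuous_on_if Cb
        continuous_on_power[OF gC] continuous_intros)
  have slm: "(\<lambda>x. \<integral>\<^sup>+t. H (slide i t x) \<partial>lborel) \<in> borel_measurable ?M"
    if H: "H \<in> borel_measurable borel" for H :: "real^'d \<Rightarrow> ennreal"
  proof -
    have "(\<lambda>x. \<integral>\<^sup>+t. H (slide i t x) \<partial>lborel) \<in> borel_measurable borel" by (rule slide_nn_integral_measurable[OF H])
    from measurable_restrict_space1[OF this, of ?R] show ?thesis
      by (rule measurable_cong_sets[THEN equalityD1, THEN subsetD, rotated 2]) (simp_all only: sets_facet_measure)
  qed
  have cm: "f \<in> borel_measurable ?M" if "continuous_on ?C f" for f :: "real^'d \<Rightarrow> real"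
    by (rule continuous_facet_measurable) (rule continuous_on_subset[OF that ref_facet_subset_closed[OF c]])
  have bC: "?lo \<le> ?b" "?b \<le> ?hi" using facet_coord_mem[OF c, of i up] by (simp_all del: facet_coord.simps)
  \<comment> \<open>The depths up to \<open>d\<close>, measured into the cell.\<close>
  define T where "T = (if up then {?b - d..?b} else {?b..?b + d})"
  have T: "T \<subseteq> {?lo..?hi}" "\<And>t. t \<in> T \<Longrightarrow> \<bar>?b - t\<bar> \<le> d" "T \<in> sets lborel" "emeasure lborel T = ennreal d"
    using d by (auto simp: T_def)
  define ge where "ge x = ennreal ((gg x - \<phi> (F x))\<^sup>2)" for x
  have gem: "ge \<in> borel_measurable ?M"
    unfolding ge_def[abs_def] by (intro measurable_compose[OF _ measurable_ennreal] borel_measurable_power borel_measurable_diff gm cm \<phi>C)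
  have pointwise: "ennreal d * ennreal ((gg x - V x)\<^sup>2) \<le>
      ennreal 4 * (ennreal d * ge x + ennreal d * (ennreal d * (\<integral>\<^sup>+t. he (slide i t x) \<partial>lborel))
        + (\<integral>\<^sup>+t. fe (slide i t x) \<partial>lborel) + ennreal d * ennreal (w\<^sup>2))" if x: "x \<in> ?R" for x
  proof -
    define p where "p t = \<phi> (F (slide i t x))" for t
    define p' where "p' t = gradient \<phi> (F (slide i t x)) \<bullet> (jac G c (slide i t x) *v axis i 1)" for t
    have slC: "slide i t x \<in> ?C" if "t \<in> {?lo..?hi}" for t using slide_ref_facet[OF x] that by auto
    have slcont: "continuous_on S (\<lambda>t. slide i t x)" for S
      unfolding slide_def
    proof (rule continuous_on_vec_lambda)
      fix j show "continuous_on S (\<lambda>t. if j = i then t else x $ j)" by (cases "j = i") (auto intro: continuous_intros)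
    qed
    have pc: "continuous_on {?lo..?hi} p" unfolding p_def
      by (rule continuous_on_compose2[OF \<phi>C slcont]) (use slC in blast)
    have p'c: "continuous_on {?lo..?hi} p'" unfolding p'_def
      by (rule continuous_on_compose2[OF gC slcont]) (use slC in blast)
    have der: "(p has_real_derivative p' s) (at s)" if s: "s \<in> {?lo<..<?hi}" for s
    proof -
      have sc: "slide i s x \<in> ref_cell G c" using slide_ref_cell[OF x] s by auto
      then have sU: "slide i s x \<in> U" using c by blast
      have ds: "((\<lambda>t. slide i t x) has_derivative (\<lambda>t. t *\<^sub>R axis i 1)) (at s)"
      proof -
        have "(\<lambda>t. slide i t x) = (\<lambda>t. slide i 0 x + t *\<^sub>R axis i 1)"
          by (simp add: fun_eq_iff vec_eq_iff slide_nth axis_def)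
        moreover have "((\<lambda>t. slide i 0 x + t *\<^sub>R axis i 1) has_derivative (\<lambda>t. t *\<^sub>R axis i 1)) (at s)"
          by (auto intro!: derivative_eq_intros)
        ultimately show ?thesis by simp
      qed
      have "((\<lambda>t. F (slide i t x)) has_derivative (\<lambda>t. J (slide i s x) *v (t *\<^sub>R axis i 1))) (at s)"
        by (rule has_derivative_compose[OF ds param_has_derivative_J[OF sU]])
      from has_derivative_compose[OF this g1(1)]
      have "(p has_derivative (\<lambda>t. gradient \<phi> (F (slide i s x)) \<bullet> (J (slide i s x) *v (t *\<^sub>R axis i 1)))) (at s)"
        unfolding p_def .
      moreover have "(\<lambda>t. gradient \<phi> (F (slide i s x)) \<bullet> (J (slide i s x) *v (t *\<^sub>R axis i 1))) = (\<lambda>t. p' s * t)"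
        using jac_eq_J[OF c sc] by (auto simp: p'_def matrix_vector_mult_scaleR)
      ultimately show ?thesis by (simp add: has_field_derivative_def)
    qed
    have he_eq: "he (slide i t x) = ennreal (indicator {?lo..?hi} t * (p' t)\<^sup>2)" for t
    proof (cases "t \<in> {?lo..?hi}")
      case False
      then have "slide i t x \<notin> ?C" by (auto simp: mem_closed_ref_cell slide_nth intro: exI[of _ i])
      then show ?thesis using False by (simp add: he_def)
    qed (use slC in \<open>simp add: he_def p'_def\<close>)
    define I where "I = (\<integral>\<^sup>+t. he (slide i t x) \<partial>lborel)"
    have line: "ennreal ((p ?b - p t)\<^sup>2) \<le> ennreal d * I" if t: "t \<in> T" for t
    proof -
      have tl: "t \<in> {?lo..?hi}" using T(1) t by blast
      have bl: "?b \<in> {?lo..?hi}" by (rule facet_coord_mem[OF c])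
      have "ennreal ((p ?b - p t)\<^sup>2) \<le> ennreal \<bar>?b - t\<bar> * I"
        using increment_squared_le[OF pc p'c der bl tl] unfolding I_def he_eq by simp
      also have "\<dots> \<le> ennreal d * I" using T(2)[OF t] by (intro mult_right_mono ennreal_leI) auto
      finally show ?thesis .
    qed
    have sb: "slide i ?b x = x" by (rule slide_self[OF x])
    have point: "ennreal ((gg x - V x)\<^sup>2) \<le> ennreal 4 * (ge x + ennreal d * I + fe (slide i t x) + ennreal (w\<^sup>2))"
      if t: "t \<in> T" for t
    proof -
      have tC: "slide i t x \<in> ?C" and xC: "x \<in> ?C" using slC T(1) t ref_facet_subset_closed[OF c] x by blast+
      have "norm (slide i t x - x) \<le> d"
      proof -
        have "slide i t x - x = (t - ?b) *\<^sub>R axis i 1"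
          using x[unfolded mem_ref_facet] by (simp add: vec_eq_iff slide_nth axis_def)
        then show ?thesis using T(2)[OF t] by (simp add: abs_minus_commute)
      qed
      then have "\<bar>V (slide i t x) - V x\<bar> \<le> w" using w(2)[OF tC xC] by blast
      then have w2: "(V (slide i t x) - V x)\<^sup>2 \<le> w\<^sup>2" using w(1) by (metis abs_le_square_iff abs_of_nonneg)
      have pb: "p ?b = \<phi> (F x)" by (simp only: p_def sb)
      have "gg x - V x = (gg x - \<phi> (F x)) + (p ?b - p t) + (\<phi> (F (slide i t x)) - V (slide i t x)) + (V (slide i t x) - V x)"
        unfolding pb by (simp add: p_def)
      then have "(gg x - V x)\<^sup>2 \<le> 4 * ((gg x - \<phi> (F x))\<^sup>2 + (p ?b - p t)\<^sup>2 + (\<phi> (F (slide i t x)) - V (slide i t x))\<^sup>2 + (V (slide i t x) - V x)\<^sup>2)"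
        using four_squares_le by metis
      also have "\<dots> \<le> 4 * ((gg x - \<phi> (F x))\<^sup>2 + (p ?b - p t)\<^sup>2 + (\<phi> (F (slide i t x)) - V (slide i t x))\<^sup>2 + w\<^sup>2)"
        using w2 by simp
      finally have "ennreal ((gg x - V x)\<^sup>2) \<le> ennreal (4 * ((gg x - \<phi> (F x))\<^sup>2 + (p ?b - p t)\<^sup>2 + (\<phi> (F (slide i t x)) - V (slide i t x))\<^sup>2 + w\<^sup>2))"
        by (rule ennreal_leI)
      also have "\<dots> = ennreal 4 * (ge x + ennreal ((p ?b - p t)\<^sup>2) + fe (slide i t x) + ennreal (w\<^sup>2))"
        using tC by (simp add: ge_def fe_def ennreal_mult distrib_left del: ennreal_numeral facet_coord.simps)
      also have "\<dots> \<le> ennreal 4 * (ge x + ennreal d * I + fe (slide i t x) + ennreal (w\<^sup>2))"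
        using line[OF t] by (intro mult_left_mono add_mono) auto
      finally show ?thesis .
    qed
    have fsm: "(\<lambda>t. fe (slide i t x)) \<in> borel_measurable lborel"
      using measurable_compose[OF borel_measurable_continuous_onI[OF slcont] fem] by simp
    have "ennreal d * ennreal ((gg x - V x)\<^sup>2) = (\<integral>\<^sup>+t. ennreal ((gg x - V x)\<^sup>2) * indicator T t \<partial>lborel)"
      unfolding nn_integral_cmult_indicator[OF T(3)] T(4) by (rule mult.commute)
    also have "\<dots> \<le> (\<integral>\<^sup>+t. ennreal 4 * ((ge x + ennreal d * I + ennreal (w\<^sup>2)) * indicator T t + fe (slide i t x)) \<partial>lborel)"
    proof (rule nn_integral_mono)
      fix t
      show "ennreal ((gg x - V x)\<^sup>2) * indicator T t \<le> ennreal 4 * ((ge x + ennreal d * I + ennreal (w\<^sup>2)) * indicator T t + fe (slide i t x))"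
      proof (cases "t \<in> T")
        case True
        then show ?thesis using point[OF True] by (simp add: add_ac del: ennreal_numeral)
      qed simp
    qed
    also have "\<dots> = ennreal 4 * ((ge x + ennreal d * I + ennreal (w\<^sup>2)) * ennreal d + (\<integral>\<^sup>+t. fe (slide i t x) \<partial>lborel))"
    proof -
      have Tm: "(\<lambda>t. (ge x + ennreal d * I + ennreal (w\<^sup>2)) * indicator T t) \<in> borel_measurable lborel"
        using T(3) by simp
      show ?thesis
        using fsm Tm T(3,4) by (simp add: nn_integral_cmult nn_integral_add nn_integral_cmult_indicator del: ennreal_numeral)
    qed
    also have "\<dots> = ennreal 4 * (ennreal d * ge x + ennreal d * (ennreal d * I) + (\<integral>\<^sup>+t. fe (slide i t x) \<partial>lborel) + ennreal d * ennreal (w\<^sup>2))"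
      by (simp add: algebra_simps del: ennreal_numeral)
    finally show ?thesis unfolding I_def .
  qed
  have gVm: "(\<lambda>x. ennreal ((gg x - V x)\<^sup>2)) \<in> borel_measurable ?M"
    by (intro measurable_compose[OF _ measurable_ennreal] borel_measurable_power borel_measurable_diff gm cm V)
  note m1 = slm[OF hem] and m2 = slm[OF fem]
  have "ennreal d * (\<integral>\<^sup>+x. ennreal ((gg x - V x)\<^sup>2) \<partial>?M) = (\<integral>\<^sup>+x. ennreal d * ennreal ((gg x - V x)\<^sup>2) \<partial>?M)"
    by (rule nn_integral_cmult[OF gVm, symmetric])
  also have "\<dots> \<le> (\<integral>\<^sup>+x. ennreal 4 * (ennreal d * ge x + ennreal d * (ennreal d * (\<integral>\<^sup>+t. he (slide i t x) \<partial>lborel))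
        + (\<integral>\<^sup>+t. fe (slide i t x) \<partial>lborel) + ennreal d * ennreal (w\<^sup>2)) \<partial>?M)"
    using pointwise by (intro nn_integral_mono) (simp only: space_facet_measure)
  also have "\<dots> = ennreal 4 * (ennreal d * (\<integral>\<^sup>+x. ge x \<partial>?M) + ennreal d * (ennreal d * (\<integral>\<^sup>+x. (\<integral>\<^sup>+t. he (slide i t x) \<partial>lborel) \<partial>?M))
        + (\<integral>\<^sup>+x. (\<integral>\<^sup>+t. fe (slide i t x) \<partial>lborel) \<partial>?M) + ennreal d * ennreal (w\<^sup>2) * emeasure ?M ?R)"
    using gem m1 m2 by (simp add: nn_integral_cmult nn_integral_add space_facet_measure[symmetric] del: ennreal_numeral facet_measure.simps ref_facet.simps)
  also have "\<dots> \<le> ennreal 4 * (ennreal d * ennreal a + ennreal d * (ennreal d * (ennreal A * ennreal h))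
        + ennreal A * ennreal n + ennreal d * ennreal (w\<^sup>2) * ennreal \<mu>)"
  proof (intro mult_left_mono add_mono order_refl zero_le)
    show "(\<integral>\<^sup>+x. ge x \<partial>?M) \<le> ennreal a" using a(1) by (simp only: ge_def)
    have "(\<integral>\<^sup>+x. (\<integral>\<^sup>+t. he (slide i t x) \<partial>lborel) \<partial>?M) \<le> ennreal A * (\<integral>\<^sup>+x. he x \<partial>lborel)" by (rule A[OF hem])
    also have "\<dots> \<le> ennreal A * ennreal h" using h(1) by (intro mult_left_mono) (simp_all only: he_def zero_le)
    finally show "(\<integral>\<^sup>+x. (\<integral>\<^sup>+t. he (slide i t x) \<partial>lborel) \<partial>?M) \<le> ennreal A * ennreal h" .
    have "(\<integral>\<^sup>+x. (\<integral>\<^sup>+t. fe (slide i t x) \<partial>lborel) \<partial>?M) \<le> ennreal A * (\<integral>\<^sup>+x. fe x \<partial>lborel)" by (rule A[OF fem])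
    also have "\<dots> \<le> ennreal A * ennreal n" using n(1) by (intro mult_left_mono) (simp_all only: fe_def zero_le)
    finally show "(\<integral>\<^sup>+x. (\<integral>\<^sup>+t. fe (slide i t x) \<partial>lborel) \<partial>?M) \<le> ennreal A * ennreal n" .
  qed (rule \<mu>(1))
  also have "\<dots> = ennreal (4 * (d * a + d * (d * (A * h)) + A * n + d * (w\<^sup>2 * \<mu>)))"
    using d a(2) n(2) h(2) \<mu>(2) A0 by (simp add: ennreal_mult mult.assoc distrib_left del: ennreal_numeral)
  finally show ?thesis .
qed

text \<open>
  For points of the facet the line in direction \<open>i\<close> stays in the cell for the width of the cell, so the indicator of
  the cell bounds the measure of the facet by the volume of the cell.
\<close>

lemma finite_facet_measure:
  assumes c: "c \<in> cells G"
  shows "finite_measure (facet_measure G (c, i, up))"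
proof
  let ?M = "facet_measure G (c, i, up)" and ?C = "closed_ref_cell G c" and ?R = "ref_facet G (c, i, up)"
  let ?lo = "knot G i (c i)" and ?hi = "knot G i (Suc (c i))"
  obtain A where A: "0 \<le> A" "\<And>H :: real^'d \<Rightarrow> ennreal. H \<in> borel_measurable borel \<Longrightarrow>
    (\<integral>\<^sup>+x. (\<integral>\<^sup>+t. H (slide i t x) \<partial>lborel) \<partial>?M) \<le> ennreal A * (\<integral>\<^sup>+x. H x \<partial>lborel)"
    using nn_integral_facet_slices[OF c] by blast
  have Cb: "?C \<in> sets borel" using compact_closed_ref_cell by (intro borel_closed compact_imp_closed)
  have in_C: "(indicator ?C (slide i t x) :: ennreal) = indicator {?lo..?hi} t" if "x \<in> ?R" for x t
  proof (cases "t \<in> {?lo..?hi}")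
    case True
    then show ?thesis using slide_ref_facet[OF that] by simp
  next
    case False
    then have "slide i t x \<notin> ?C" by (auto simp: mem_closed_ref_cell slide_nth intro: exI[of _ i])
    then show ?thesis using False by simp
  qed
  have lohi: "?lo < ?hi" by (rule cell_knots(3)[OF c])
  have "ennreal (?hi - ?lo) * emeasure ?M (space ?M) = (\<integral>\<^sup>+x. ennreal (?hi - ?lo) \<partial>?M)"
    by (simp only: nn_integral_const)
  also have "\<dots> = (\<integral>\<^sup>+x. (\<integral>\<^sup>+t. indicator ?C (slide i t x) \<partial>lborel) \<partial>?M)"
  proof (rule nn_integral_cong)
    fix x assume "x \<in> space ?M"
    then have x: "x \<in> ?R" by (simp only: space_facet_measure)
    show "ennreal (?hi - ?lo) = (\<integral>\<^sup>+t. indicator ?C (slide i t x) \<partial>lborel)"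
      unfolding in_C[OF x] using lohi by simp
  qed
  also have "\<dots> \<le> ennreal A * (\<integral>\<^sup>+x. indicator ?C x \<partial>lborel)"
    using Cb by (intro A(2)) simp
  also have "\<dots> = ennreal A * emeasure lborel ?C" using Cb by simp
  also have "\<dots> < \<infinity>"
    using emeasure_compact_finite[OF compact_closed_ref_cell, of c] by (simp add: ennreal_mult_less_top)
  finally show "emeasure ?M (space ?M) \<noteq> \<infinity>"
    using lohi by (auto simp: ennreal_mult_eq_top_iff simp del: facet_measure.simps)
qed

lemma ennreal_mult_left_cancel:
  assumes "0 < d" "ennreal d * X \<le> ennreal (d * r)" "0 \<le> r"
  shows "X \<le> ennreal r"
proof -
  have "ennreal (1 / d) * (ennreal d * X) \<le> ennreal (1 / d) * ennreal (d * r)"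
    using assms(2) by (rule mult_left_mono) simp
  then show ?thesis using assms by (simp add: mult.assoc[symmetric] ennreal_mult[symmetric] del: ennreal_mult')
qed

text \<open>
  A function that is continuous up to a boundary facet has its limit from inside as trace: the estimate above is applied
  to the smooth functions that define the trace, first with the index of the sequence and then with the depth
  \<open>d\<close> going to the limit.
\<close>

lemma trace_eq_boundary_limit:
  fixes v g V :: "real^'d \<Rightarrow> real"
  assumes dim: "CARD('d) = 2 \<or> CARD('d) = 3"
    and e: "(c, i, up) \<in> boundary_facets G"
    and v: "v \<in> H1 (domain G)" and tr: "has_trace G v g"
    and V: "continuous_on (closed_ref_cell G c) V" and Vv: "\<And>x. x \<in> ref_cell G c \<Longrightarrow> V x = v (F x)"
  shows "AE x in facet_measure G (c, i, up). g (F x) = V x"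
proof -
  let ?M = "facet_measure G (c, i, up)" and ?C = "closed_ref_cell G c" and ?R = "ref_facet G (c, i, up)"
  let ?L = "lebesgue_on (domain G)" and ?W = "weak_grad (domain G) v"
  let ?lo = "knot G i (c i)" and ?hi = "knot G i (Suc (c i))"
  have c: "c \<in> cells G" using e by (auto simp: boundary_facets_def)
  have lohi: "?lo < ?hi" by (rule cell_knots(3)[OF c])
  obtain \<phi> where smooth: "\<And>m k. Ck_on k UNIV (\<phi> m)"
    and l1: "(\<lambda>m::nat. L2_norm ?L (\<lambda>x. \<phi> m x - v x)) \<longlonglongrightarrow> 0"
    and l2: "(\<lambda>m. L2_norm ?L (\<lambda>x. gradient (\<phi> m) x - ?W x)) \<longlonglongrightarrow> 0"
    and l3: "(\<lambda>m. L2_norm ?M (\<lambda>x. \<phi> m (F x) - g (F x))) \<longlonglongrightarrow> 0"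
    using tr e unfolding has_trace_def by blast
  have gL2: "(\<lambda>x. g (F x)) \<in> L2 ?M" using tr e unfolding has_trace_def by blast
  have vL2: "v \<in> L2 ?L" using v by (simp add: H1_def)
  have WL2: "?W \<in> L2 ?L" using H1_weak_grad[OF v] by (simp add: is_weak_grad_def)
  have g1: "continuous_on UNIV (gradient (\<phi> m))" for m by (rule Ck_on_1_gradient(2)[OF smooth])
  have \<phi>c: "continuous_on UNIV (\<phi> m)" for m by (rule Ck_on_UNIV_imp_continuous[OF smooth])
  have dL2: "(\<lambda>x. \<phi> m x - v x) \<in> L2 ?L" "(\<lambda>x. gradient (\<phi> m) x - ?W x) \<in> L2 ?L" "gradient (\<phi> m) \<in> L2 ?L" for m
    using L2_diff[OF continuous_imp_L2_domain[OF \<phi>c] vL2] L2_diff[OF continuous_imp_L2_domain[OF g1] WL2]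
      continuous_imp_L2_domain[OF g1] by auto
  define N where "N m = (LINT x|?L. (norm (\<phi> m x - v x))\<^sup>2)" for m
  define Q where "Q m = (LINT x|?L. (norm (gradient (\<phi> m) x - ?W x))\<^sup>2)" for m
  define E where "E m = (LINT x|?M. (norm (\<phi> m (F x) - g (F x)))\<^sup>2)" for m
  have N0: "N \<longlonglongrightarrow> 0" unfolding N_def[abs_def] by (rule L2_norm_tendsto_0[OF l1])
  have Q0: "Q \<longlonglongrightarrow> 0" unfolding Q_def[abs_def] by (rule L2_norm_tendsto_0[OF l2])
  have E0: "E \<longlonglongrightarrow> 0" unfolding E_def[abs_def] by (rule L2_norm_tendsto_0[OF l3])
  have Nnn: "0 \<le> N m" "0 \<le> E m" for m unfolding N_def E_def by (auto intro: integral_nonneg)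
  obtain Qb where Qb: "\<And>m. Q m \<le> Qb" using convergent_imp_Bseq[OF convergentI[OF Q0]]
    by (auto simp: Bseq_def abs_le_iff)
  define Hb where "Hb = 2 * Qb + 2 * (LINT x|?L. (norm (?W x))\<^sup>2)"
  have Hb: "(LINT x|?L. (norm (gradient (\<phi> m) x))\<^sup>2) \<le> Hb" for m
  proof -
    have "(LINT x|?L. (norm (gradient (\<phi> m) x))\<^sup>2) \<le> (LINT x|?L. 2 * (norm (gradient (\<phi> m) x - ?W x))\<^sup>2 + 2 * (norm (?W x))\<^sup>2)"
    proof (rule integral_mono)
      show "integrable ?L (\<lambda>x. (norm (gradient (\<phi> m) x))\<^sup>2)" using dL2(3)[of m] by (simp add: L2_def)
      show "integrable ?L (\<lambda>x. 2 * (norm (gradient (\<phi> m) x - ?W x))\<^sup>2 + 2 * (norm (?W x))\<^sup>2)"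
        using dL2(2)[of m] WL2 by (simp add: L2_def)
      show "(norm (gradient (\<phi> m) x))\<^sup>2 \<le> 2 * (norm (gradient (\<phi> m) x - ?W x))\<^sup>2 + 2 * (norm (?W x))\<^sup>2" for x
        using norm_diff_squared_le[of "gradient (\<phi> m) x - ?W x" "- ?W x"] by simp
    qed
    also have "\<dots> = 2 * Q m + 2 * (LINT x|?L. (norm (?W x))\<^sup>2)"
      using dL2(2)[of m] WL2 by (simp add: L2_def Q_def)
    finally show ?thesis using Qb[of m] by (simp add: Hb_def)
  qed
  have Hb0: "0 \<le> Hb" by (rule order.trans[OF _ Hb[of 0]]) (simp add: integral_nonneg)
  obtain \<delta> where \<delta>: "0 < \<delta>" "\<And>c x. c \<in> cells G \<Longrightarrow> x \<in> closed_ref_cell G c \<Longrightarrow> \<delta> \<le> \<bar>det (jac G c x)\<bar>"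
    using det_J_lower_bound by blast
  obtain A where A: "0 \<le> A" "\<And>H :: real^'d \<Rightarrow> ennreal. H \<in> borel_measurable borel \<Longrightarrow>
    (\<integral>\<^sup>+x. (\<integral>\<^sup>+t. H (slide i t x) \<partial>lborel) \<partial>?M) \<le> ennreal A * (\<integral>\<^sup>+x. H x \<partial>lborel)"
    using nn_integral_facet_slices[OF c] by blast
  have jc: "continuous_on ?C (\<lambda>x. jac G c x *v axis i 1)"
    unfolding matrix_vector_mult_basis column_def by (intro continuous_intros continuous_jac c)
  have "bounded ((\<lambda>x. jac G c x *v axis i 1) ` ?C)"
    using compact_imp_bounded compact_continuous_image[OF jc compact_closed_ref_cell] by blast
  then obtain B where B: "B > 0" "\<And>x. x \<in> ?C \<Longrightarrow> norm (jac G c x *v axis i 1) \<le> B" by (auto simp: bounded_pos)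
  have FC: "continuous_on ?C F" by (rule continuous_on_subset[OF continuous_param closed_ref_cell_subset_K[OF c]])
  have Cb: "?C \<in> sets borel" using compact_closed_ref_cell by (intro borel_closed compact_imp_closed)
  define h where "h = (1 / \<delta>) * (B\<^sup>2 * Hb)"
  have h0: "0 \<le> h" using \<delta>(1) Hb0 by (simp add: h_def)
  have hm: "(\<integral>\<^sup>+x. ennreal (if x \<in> ?C then (gradient (\<phi> m) (F x) \<bullet> (jac G c x *v axis i 1))\<^sup>2 else 0) \<partial>lborel) \<le> ennreal h" for m
  proof -
    define k where "k x = (if x \<in> ?C then B\<^sup>2 * (norm (gradient (\<phi> m) (F x)))\<^sup>2 else 0)" for x
    have "(\<integral>\<^sup>+x. ennreal (if x \<in> ?C then (gradient (\<phi> m) (F x) \<bullet> (jac G c x *v axis i 1))\<^sup>2 else 0) \<partial>lborel) \<le> (\<integral>\<^sup>+x. ennreal (k x) \<partial>lborel)"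
    proof (intro nn_integral_mono ennreal_leI)
      fix x
      show "(if x \<in> ?C then (gradient (\<phi> m) (F x) \<bullet> (jac G c x *v axis i 1))\<^sup>2 else 0) \<le> k x"
      proof (cases "x \<in> ?C")
        case True
        have "\<bar>gradient (\<phi> m) (F x) \<bullet> (jac G c x *v axis i 1)\<bar> \<le> norm (gradient (\<phi> m) (F x)) * norm (jac G c x *v axis i 1)"
          by (rule Cauchy_Schwarz_ineq2)
        also have "\<dots> \<le> norm (gradient (\<phi> m) (F x)) * B" using B(2)[OF True] by (intro mult_left_mono) auto
        finally have "\<bar>gradient (\<phi> m) (F x) \<bullet> (jac G c x *v axis i 1)\<bar>\<^sup>2 \<le> (norm (gradient (\<phi> m) (F x)) * B)\<^sup>2"
          by (intro power_mono) auto
        then show ?thesis using True by (simp add: k_def power_mult_distrib mult.commute)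
      qed (simp add: k_def)
    qed
    also have "\<dots> \<le> ennreal ((1 / \<delta>) * (LINT y|?L. B\<^sup>2 * (norm (gradient (\<phi> m) y))\<^sup>2))"
    proof (rule nn_integral_cell_le[OF dim c])
      show "integrable ?L (\<lambda>y. B\<^sup>2 * (norm (gradient (\<phi> m) y))\<^sup>2)" using dL2(3)[of m] by (simp add: L2_def)
      show "k \<in> borel_measurable borel"
        unfolding k_def[abs_def]
        by (intro borel_measurable_continuous_on_if Cb continuous_intros continuous_on_compose2[OF g1 FC]) simp
      show "k x = B\<^sup>2 * (norm (gradient (\<phi> m) (F x)))\<^sup>2" if "x \<in> ref_cell G c" for x
        using that ref_cell_subset_closed by (auto simp: k_def)
    qed (auto simp: k_def intro: \<delta>)
    also have "\<dots> \<le> ennreal h"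
      unfolding h_def using Hb[of m] \<delta>(1) by (intro ennreal_leI mult_left_mono) (auto intro!: mult_left_mono)
    finally show ?thesis .
  qed
  have nm: "(\<integral>\<^sup>+x. ennreal (if x \<in> ?C then (\<phi> m (F x) - V x)\<^sup>2 else 0) \<partial>lborel) \<le> ennreal ((1 / \<delta>) * N m)" for m
    unfolding N_def
  proof (rule nn_integral_cell_le[OF dim c])
    show "integrable ?L (\<lambda>y. (norm (\<phi> m y - v y))\<^sup>2)" using dL2(1)[of m] by (simp add: L2_def)
    show "(\<lambda>x. if x \<in> ?C then (\<phi> m (F x) - V x)\<^sup>2 else 0) \<in> borel_measurable borel"
      by (intro borel_measurable_continuous_on_if Cb continuous_intros V continuous_on_compose2[OF \<phi>c FC]) simp
    show "(if x \<in> ?C then (\<phi> m (F x) - V x)\<^sup>2 else 0) = (norm (\<phi> m (F x) - v (F x)))\<^sup>2" if "x \<in> ref_cell G c" for x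
      using that ref_cell_subset_closed Vv[OF that] by auto
  qed (auto intro: \<delta>)
  have fin: "finite_measure ?M" by (rule finite_facet_measure[OF c])
  have am: "(\<integral>\<^sup>+x. ennreal ((g (F x) - \<phi> m (F x))\<^sup>2) \<partial>?M) \<le> ennreal (E m)" for m
  proof -
    have \<phi>C: "continuous_on ?C (\<lambda>x. \<phi> m (F x))" by (rule continuous_on_compose2[OF \<phi>c FC]) simp
    have "bounded ((\<lambda>x. \<phi> m (F x)) ` ?C)"
      using compact_imp_bounded compact_continuous_image[OF \<phi>C compact_closed_ref_cell] by blast
    then obtain b where b: "\<And>x. x \<in> ?C \<Longrightarrow> norm (\<phi> m (F x)) \<le> b" by (auto simp: bounded_iff)
    have "(\<lambda>x. \<phi> m (F x)) \<in> L2 ?M"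
    proof (rule bounded_imp_L2[OF fin])
      show "(\<lambda>x. \<phi> m (F x)) \<in> borel_measurable ?M"
        by (rule continuous_facet_measurable[OF continuous_on_subset[OF \<phi>C ref_facet_subset_closed[OF c]]])
      show "norm (\<phi> m (F x)) \<le> b" if "x \<in> space ?M" for x
        using that ref_facet_subset_closed[OF c] b unfolding space_facet_measure by blast
    qed
    from L2_diff[OF this gL2] have "integrable ?M (\<lambda>x. (norm (\<phi> m (F x) - g (F x)))\<^sup>2)" by (simp add: L2_def)
    then have "(\<integral>\<^sup>+x. ennreal ((norm (\<phi> m (F x) - g (F x)))\<^sup>2) \<partial>?M) = ennreal (E m)"
      unfolding E_def by (rule nn_integral_eq_integral) simp
    then show ?thesis by (simp add: power2_commute del: facet_measure.simps)
  qed
  define \<mu> where "\<mu> = measure ?M ?R"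
  have \<mu>: "emeasure ?M ?R \<le> ennreal \<mu>" "0 \<le> \<mu>"
    using finite_measure.emeasure_eq_measure[OF fin, of ?R] by (auto simp: \<mu>_def simp del: facet_measure.simps ref_facet.simps)
  have gm: "(\<lambda>x. g (F x)) \<in> borel_measurable ?M" using gL2 by (simp add: L2_def del: facet_measure.simps)
  define X where "X = (\<integral>\<^sup>+x. ennreal ((g (F x) - V x)\<^sup>2) \<partial>?M)"
  \<comment> \<open>All four terms of \<open>trace_estimate\<close> will be at most a multiple of \<open>\<epsilon>\<close>; \<open>C0\<close> collects the factors.\<close>
  define C0 where "C0 = 4 * (1 + A * h + A + \<mu>)"
  have C0: "0 < C0" using A(1) h0 \<mu>(2) by (simp add: C0_def add_pos_nonneg)
  have X\<epsilon>: "X \<le> ennreal (\<epsilon> * C0)" if \<epsilon>: "0 < \<epsilon>" for \<epsilon>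
  proof -
    have "uniformly_continuous_on ?C V" by (rule compact_uniformly_continuous[OF V compact_closed_ref_cell])
    then obtain d0 where d0: "0 < d0" "\<And>x y. x \<in> ?C \<Longrightarrow> y \<in> ?C \<Longrightarrow> dist y x < d0 \<Longrightarrow> dist (V y) (V x) < sqrt \<epsilon>"
      using \<epsilon> unfolding uniformly_continuous_on_def by (metis real_sqrt_gt_zero)
    \<comment> \<open>The oscillation of \<open>V\<close> over distances up to \<open>d\<close> is at most \<open>sqrt \<epsilon>\<close>, and \<open>d \<le> \<epsilon>\<close> makes the gradient term small.\<close>
    define d where "d = min (d0 / 2) (min \<epsilon> (?hi - ?lo))"
    have d: "0 < d" "d \<le> ?hi - ?lo" "d < d0" "d \<le> \<epsilon>" using d0(1) \<epsilon> lohi by (auto simp: d_def)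
    have w: "\<bar>V x - V y\<bar> \<le> sqrt \<epsilon>" if "x \<in> ?C" "y \<in> ?C" "norm (x - y) \<le> d" for x y
      using d0(2)[OF that(2,1)] that(3) d(3) by (simp add: dist_norm)
    have "eventually (\<lambda>m. E m < \<epsilon>) sequentially" using order_tendstoD(2)[OF E0 \<epsilon>] .
    moreover have "eventually (\<lambda>m. N m < \<delta> * (d * \<epsilon>)) sequentially"
      using order_tendstoD(2)[OF N0, of "\<delta> * (d * \<epsilon>)"] \<delta>(1) d(1) \<epsilon> by simp
    ultimately have "eventually (\<lambda>m. E m < \<epsilon> \<and> N m < \<delta> * (d * \<epsilon>)) sequentially"
      by (rule eventually_conj)
    then obtain m where m: "E m < \<epsilon>" "N m < \<delta> * (d * \<epsilon>)"
      using eventually_happens'[OF sequentially_bot] by blast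
    have nle: "(1 / \<delta>) * N m \<le> d * \<epsilon>" using m(2) \<delta>(1) by (simp add: field_simps)
    have "ennreal d * X \<le> ennreal (4 * (d * E m + d * (d * (A * h)) + A * ((1 / \<delta>) * N m) + d * ((sqrt \<epsilon>)\<^sup>2 * \<mu>)))"
      unfolding X_def
      by (rule trace_estimate[OF c smooth V A(2) A(1) gm d(1,2) _ w am Nnn(2) nm _ hm h0 \<mu>])
         (use \<epsilon> \<delta>(1) Nnn in auto)
    also have "\<dots> \<le> ennreal (d * (\<epsilon> * C0))"
    proof (rule ennreal_leI)
      have "d * E m \<le> d * \<epsilon>" using m(1) d(1) by (intro mult_left_mono) auto
      moreover have "d * (d * (A * h)) \<le> d * (\<epsilon> * (A * h))"
        using d A(1) h0 by (intro mult_left_mono mult_right_mono) auto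
      moreover have "A * ((1 / \<delta>) * N m) \<le> A * (d * \<epsilon>)" using nle A(1) by (rule mult_left_mono)
      moreover have "(sqrt \<epsilon>)\<^sup>2 = \<epsilon>" using \<epsilon> by simp
      ultimately have "4 * (d * E m + d * (d * (A * h)) + A * ((1 / \<delta>) * N m) + d * ((sqrt \<epsilon>)\<^sup>2 * \<mu>))
          \<le> 4 * (d * \<epsilon> + d * (\<epsilon> * (A * h)) + A * (d * \<epsilon>) + d * (\<epsilon> * \<mu>))" by simp
      also have "\<dots> = d * (\<epsilon> * C0)" by (simp add: C0_def algebra_simps)
      finally show "4 * (d * E m + d * (d * (A * h)) + A * ((1 / \<delta>) * N m) + d * ((sqrt \<epsilon>)\<^sup>2 * \<mu>)) \<le> d * (\<epsilon> * C0)" .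
    qed
    finally have "ennreal d * X \<le> ennreal (d * (\<epsilon> * C0))" .
    moreover have "0 \<le> \<epsilon> * C0" using \<epsilon> C0 by simp
    ultimately show ?thesis by (rule ennreal_mult_left_cancel[OF d(1)])
  qed
  have "X = 0"
  proof (rule ccontr)
    assume "X \<noteq> 0"
    moreover have "X < \<infinity>" using X\<epsilon>[of 1] by (auto intro: le_less_trans)
    ultimately obtain r where r: "X = ennreal r" "0 < r"
      by (cases X) (auto simp: less_top[symmetric])
    then have "r \<le> r / (2 * C0) * C0" using X\<epsilon>[of "r / (2 * C0)"] C0 by simp
    then show False using r C0 by simp
  qed
  moreover have "(\<lambda>x. ennreal ((g (F x) - V x)\<^sup>2)) \<in> borel_measurable ?M"
    by (intro measurable_compose[OF _ measurable_ennreal] borel_measurable_power borel_measurable_diff gm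
        continuous_facet_measurable continuous_on_subset[OF V ref_facet_subset_closed[OF c]])
  ultimately have "AE x in ?M. ennreal ((g (F x) - V x)\<^sup>2) = 0"
    unfolding X_def by (simp only: nn_integral_0_iff_AE)
  then show ?thesis by (rule AE_mp) (auto intro!: AE_I2 simp del: facet_measure.simps)
qed

end

section \<open>The divergence theorem on the reference box\<close>

text \<open>
  \<open>S\<close> stands for the coefficient field of a Piola transform, and the second condition for $v\cdot n = 0$.
\<close>

locale mesh_field = mesh G m for G :: "('d::finite) patch" and m +
  fixes S :: "real^'d \<Rightarrow> real^'d"
  assumes S_piecewise_C1: "\<And>i. piecewise_C1 (\<lambda>x. S x $ i)"
    and S_normal_0: "\<And>x i. x \<in> K \<Longrightarrow> x $ i = knot G i 1 \<or> x $ i = knot G i (num_knots G i) \<Longrightarrow> S x $ i = 0"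
begin

definition Z :: "real^'d \<Rightarrow> real^'d" where
  "Z x = (if x \<in> K then S x else 0)"

definition divS :: "real^'d \<Rightarrow> real" where
  "divS x = (if x \<in> U then (\<Sum>i\<in>UNIV. frechet_derivative (\<lambda>x. S x $ i) (at x) (axis i 1)) else 0)"

lemma continuous_S: "continuous_on K S"
proof -
  have "continuous_on K (\<lambda>x. S x $ i)" for i
    using S_piecewise_C1[of i] unfolding piecewise_C1_def by blast
  then have "continuous_on K (\<lambda>x. \<chi> i. S x $ i)" by (rule continuous_on_vec_lambda)
  then show ?thesis by simp
qed

lemma borel_measurable_Z: "Z \<in> borel_measurable borel"
  unfolding Z_def[abs_def] by (rule borel_measurable_continuous_on_if) (auto intro: continuous_S)

lemma Z_bounded:
  obtains B where "0 \<le> B" "\<And>x. norm (Z x) \<le> B"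
proof -
  have "bounded (S ` K)" using compact_imp_bounded compact_continuous_image[OF continuous_S compact_cbox] by blast
  then obtain B where B: "B > 0" "\<And>x. x \<in> K \<Longrightarrow> norm (S x) \<le> B" by (auto simp: bounded_pos)
  then show ?thesis using that[of B] by (auto simp: Z_def)
qed

text \<open>
  A segment in direction \<open>i\<close> that leaves \<open>K\<close> crosses a face orthogonal to \<open>i\<close>, where the \<open>i\<close>-th component vanishes. So
  the extension by zero creates no jump of this component in this direction.
\<close>

lemma Z_Lipschitz_axis:
  obtains L where "0 \<le> L" "\<And>x h i. \<bar>Z (x + h *\<^sub>R axis i 1) $ i - Z x $ i\<bar> \<le> L * \<bar>h\<bar>"
proof -
  have "\<exists>L. 0 \<le> L \<and> (\<forall>x h. x \<in> K \<longrightarrow> x + h *\<^sub>R axis i 1 \<in> K \<longrightarrow> \<bar>S (x + h *\<^sub>R axis i 1) $ i - S x $ i\<bar> \<le> L * \<bar>h\<bar>)" for i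
  proof -
    obtain L where "0 \<le> L" "\<And>x h j. x \<in> K \<Longrightarrow> x + h *\<^sub>R axis j 1 \<in> K \<Longrightarrow> norm (S (x + h *\<^sub>R axis j 1) $ i - S x $ i) \<le> L * \<bar>h\<bar>"
      using piecewise_C1_Lipschitz_axis[OF S_piecewise_C1[of i]] by blast
    then show ?thesis by (intro exI[of _ L]) auto
  qed
  then obtain L where L: "\<And>i. 0 \<le> L i" "\<And>i x h. x \<in> K \<Longrightarrow> x + h *\<^sub>R axis i 1 \<in> K \<Longrightarrow> \<bar>S (x + h *\<^sub>R axis i 1) $ i - S x $ i\<bar> \<le> L i * \<bar>h\<bar>"
    by metis
  define M where "M = (\<Sum>i\<in>UNIV. L i)"
  have LM: "L i \<le> M" for i unfolding M_def using L(1) by (intro member_le_sum) auto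
  have one: "\<bar>S x $ i\<bar> \<le> M * \<bar>h\<bar>" if x: "x \<in> K" and out: "x + h *\<^sub>R axis i 1 \<notin> K" for x h i
  proof -
    let ?lo = "knot G i 1" and ?hi = "knot G i (num_knots G i)"
    have xi: "?lo \<le> x $ i" "x $ i \<le> ?hi" using x[unfolded mem_K] by auto
    have "\<not> (?lo \<le> x $ i + h \<and> x $ i + h \<le> ?hi)"
    proof
      assume "?lo \<le> x $ i + h \<and> x $ i + h \<le> ?hi"
      then have "x + h *\<^sub>R axis i 1 \<in> K"
        using x unfolding mem_K by (simp add: axis_def)
      then show False using out by blast
    qed
    then have "x $ i + h < ?lo \<or> ?hi < x $ i + h" by linarith
    \<comment> \<open>The point where the segment crosses the face.\<close>
    then obtain s where s: "x $ i + s = ?lo \<or> x $ i + s = ?hi" "\<bar>s\<bar> \<le> \<bar>h\<bar>"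
    proof
      assume "x $ i + h < ?lo"
      then show ?thesis using xi by (intro that[of "?lo - x $ i"]) auto
    next
      assume "?hi < x $ i + h"
      then show ?thesis using xi by (intro that[of "?hi - x $ i"]) auto
    qed
    have "?lo \<le> ?hi" using xi by linarith
    then have zK: "x + s *\<^sub>R axis i 1 \<in> K"
      using x s(1) unfolding mem_K by (auto simp: axis_def)
    have "S (x + s *\<^sub>R axis i 1) $ i = 0"
      using s(1) by (intro S_normal_0 zK) (auto simp: axis_def)
    then have "\<bar>S x $ i\<bar> \<le> L i * \<bar>s\<bar>" using L(2)[OF x zK] by simp
    also have "\<dots> \<le> M * \<bar>h\<bar>" using s(2) LM L(1) by (intro mult_mono) (auto intro: order.trans)
    finally show ?thesis .
  qed
  have "\<bar>Z (x + h *\<^sub>R axis i 1) $ i - Z x $ i\<bar> \<le> M * \<bar>h\<bar>" for x h i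
  proof -
    have M0: "0 \<le> M * \<bar>h\<bar>" using LM[of i] L(1)[of i] by simp
    have rev: "x = (x + h *\<^sub>R axis i 1) + (- h) *\<^sub>R axis i 1" by simp
    consider "x \<in> K" "x + h *\<^sub>R axis i 1 \<in> K" | "x \<in> K" "x + h *\<^sub>R axis i 1 \<notin> K"
      | "x \<notin> K" "x + h *\<^sub>R axis i 1 \<in> K" | "x \<notin> K" "x + h *\<^sub>R axis i 1 \<notin> K" by blast
    then show ?thesis
    proof cases
      case 1
      have "L i * \<bar>h\<bar> \<le> M * \<bar>h\<bar>" using LM by (intro mult_right_mono) auto
      then show ?thesis using L(2)[OF 1] 1 by (simp add: Z_def)
    next
      case 2
      then show ?thesis using one[OF 2] by (simp add: Z_def)
    next
      case 3
      then show ?thesis using one[of "x + h *\<^sub>R axis i 1" "-h" i] rev by (simp add: Z_def)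
    next
      case 4
      then show ?thesis using M0 by (simp add: Z_def)
    qed
  qed
  moreover have "0 \<le> M" using L(1) by (simp add: M_def sum_nonneg)
  ultimately show ?thesis using that by blast
qed

definition pull :: "(real^'d \<Rightarrow> real) \<Rightarrow> real^'d \<Rightarrow> real" where
  "pull \<theta> x = (if x \<in> K then \<theta> (F x) else 0)"

text \<open>
  The gradient of $\theta\circ F$, with \<open>d\<close> the gradient of \<open>\<theta>\<close>.
\<close>

definition pull_grad :: "(real^'d \<Rightarrow> real^'d) \<Rightarrow> real^'d \<Rightarrow> real^'d" where
  "pull_grad d x = (if x \<in> U then d (F x) v* J x else 0)"

lemma C1_Lipschitz_on_bounded:
  fixes \<theta> :: "real^'d \<Rightarrow> real"
  assumes der: "\<And>x. (\<theta> has_derivative (\<lambda>h. d x \<bullet> h)) (at x)" and cont: "continuous_on UNIV d"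
  obtains L where "0 \<le> L" "\<And>x y. norm x \<le> R \<Longrightarrow> norm y \<le> R \<Longrightarrow> \<bar>\<theta> x - \<theta> y\<bar> \<le> L * norm (x - y)"
proof -
  have "bounded (d ` cball 0 R)"
    using compact_imp_bounded compact_continuous_image[OF continuous_on_subset[OF cont subset_UNIV] compact_cball] by blast
  then obtain L where L: "L > 0" "\<And>x. x \<in> cball 0 R \<Longrightarrow> norm (d x) \<le> L" by (auto simp: bounded_pos)
  have "norm (\<theta> x - \<theta> y) \<le> L * norm (x - y)" if "norm x \<le> R" "norm y \<le> R" for x y
  proof (rule differentiable_bound[of "cball 0 R" \<theta> "\<lambda>x h. d x \<bullet> h"])
    fix x :: "real^'d" assume "x \<in> cball 0 R"
    then show "onorm (\<lambda>h. d x \<bullet> h) \<le> L"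
      using L by (intro onorm_bound) (auto intro!: order.trans[OF Cauchy_Schwarz_ineq2] mult_right_mono)
  qed (use that der in \<open>auto intro: has_derivative_at_withinI\<close>)
  then show ?thesis using that[of L] L by auto
qed

lemma pull_properties:
  assumes der: "\<And>x. (\<theta> has_derivative (\<lambda>h. d x \<bullet> h)) (at x)" and cont: "continuous_on UNIV d"
  obtains B L where "0 \<le> B" "0 \<le> L" "\<And>x. \<bar>pull \<theta> x\<bar> \<le> B"
    "\<And>x h i. x \<in> K \<Longrightarrow> x + h *\<^sub>R axis i 1 \<in> K \<Longrightarrow> \<bar>pull \<theta> (x + h *\<^sub>R axis i 1) - pull \<theta> x\<bar> \<le> L * \<bar>h\<bar>"
proof -
  have c\<theta>: "continuous_on A \<theta>" for A
    using der by (meson continuous_at_imp_continuous_on has_derivative_continuous)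
  have cp: "continuous_on K (\<lambda>x. \<theta> (F x))"
    by (rule continuous_on_compose2[OF c\<theta> continuous_param subset_refl])
  have "bounded ((\<lambda>x. \<theta> (F x)) ` K)" using compact_imp_bounded compact_continuous_image[OF cp compact_cbox] by blast
  then obtain B where B: "B > 0" "\<And>x. x \<in> K \<Longrightarrow> \<bar>\<theta> (F x)\<bar> \<le> B" by (auto simp: bounded_pos)
  have "bounded (F ` K)" using compact_imp_bounded compact_continuous_image[OF continuous_param compact_cbox] by blast
  then obtain R where R: "\<And>x. x \<in> K \<Longrightarrow> norm (F x) \<le> R" by (auto simp: bounded_pos)
  obtain L1 where L1: "0 \<le> L1" "\<And>x y. norm x \<le> R \<Longrightarrow> norm y \<le> R \<Longrightarrow> \<bar>\<theta> x - \<theta> y\<bar> \<le> L1 * norm (x - y)"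
    using C1_Lipschitz_on_bounded[OF der cont] by blast
  obtain L2 where L2: "0 \<le> L2" "\<And>x h i. x \<in> K \<Longrightarrow> x + h *\<^sub>R axis i 1 \<in> K \<Longrightarrow> norm (F (x + h *\<^sub>R axis i 1) - F x) \<le> L2 * \<bar>h\<bar>"
    by (rule piecewise_C1_Lipschitz_axis[OF piecewise_C1_param]) (rule that; assumption)
  have "\<bar>pull \<theta> (x + h *\<^sub>R axis i 1) - pull \<theta> x\<bar> \<le> (L1 * L2) * \<bar>h\<bar>" if "x \<in> K" "x + h *\<^sub>R axis i 1 \<in> K" for x h i
  proof -
    have "\<bar>pull \<theta> (x + h *\<^sub>R axis i 1) - pull \<theta> x\<bar> \<le> L1 * norm (F (x + h *\<^sub>R axis i 1) - F x)"
      using that L1(2)[OF R R] by (simp add: pull_def)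
    also have "\<dots> \<le> L1 * (L2 * \<bar>h\<bar>)" using L2(2)[OF that] L1(1) by (rule mult_left_mono)
    finally show ?thesis by (simp add: mult.assoc)
  qed
  then show ?thesis using that[of B "L1 * L2"] B L1(1) L2(1) by (auto simp: pull_def)
qed

lemma borel_measurable_pull:
  assumes "continuous_on UNIV \<theta>"
  shows "pull \<theta> \<in> borel_measurable borel"
  unfolding pull_def[abs_def]
  by (rule borel_measurable_continuous_on_if)
     (auto intro!: continuous_on_compose2[OF assms continuous_param])

lemma DERIV_along_axis:
  fixes f :: "real^'d \<Rightarrow> real"
  assumes "(f has_derivative f') (at x)"
  shows "((\<lambda>h. f (x + h *\<^sub>R e)) has_real_derivative f' e) (at 0)"
proof -
  have l: "((\<lambda>h. x + h *\<^sub>R e) has_derivative (\<lambda>h. h *\<^sub>R e)) (at 0)"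
    by (auto intro!: derivative_eq_intros)
  have "((\<lambda>h. f (x + h *\<^sub>R e)) has_derivative (\<lambda>h. f' (h *\<^sub>R e))) (at 0)"
    using has_derivative_compose[OF l, of f f'] assms by simp
  moreover have "f' (h *\<^sub>R e) = f' e * h" for h
    using linear_scale[OF has_derivative_linear[OF assms]] by simp
  ultimately show ?thesis by (simp add: has_field_derivative_def)
qed

lemma has_derivative_zero_outside:
  fixes f :: "real^'d \<Rightarrow> real"
  assumes "x \<notin> K" "\<And>y. y \<notin> K \<Longrightarrow> f y = 0"
  shows "(f has_derivative (\<lambda>_. 0)) (at x)"
proof -
  have "open (- K)" by (rule open_Compl) (rule closed_cbox)
  then show ?thesis
    by (rule has_derivative_transform_within_open[OF has_derivative_const[of 0]]) (use assms in auto)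
qed

lemma pull_has_derivative:
  assumes der: "\<And>x. (\<theta> has_derivative (\<lambda>h. d x \<bullet> h)) (at x)" and x: "x \<in> U \<or> x \<notin> K"
  shows "(pull \<theta> has_derivative (\<lambda>h. pull_grad d x \<bullet> h)) (at x)"
proof (cases "x \<in> U")
  case True
  have "((\<lambda>x. \<theta> (F x)) has_derivative (\<lambda>h. d (F x) \<bullet> (J x *v h))) (at x)"
    using has_derivative_compose[OF param_has_derivative_J[OF True] der] .
  moreover have "d (F x) \<bullet> (J x *v h) = pull_grad d x \<bullet> h" for h
    using True by (simp add: pull_grad_def vector_matrix_mul_rid dot_lmul_matrix)
  ultimately have "((\<lambda>x. \<theta> (F x)) has_derivative (\<lambda>h. pull_grad d x \<bullet> h)) (at x)" by simp
  then show ?thesis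
    by (rule has_derivative_transform_within_open[OF _ open_U True]) (use U_subset_K in \<open>auto simp: pull_def\<close>)
next
  case False
  then have "x \<notin> K" using x by blast
  then show ?thesis using has_derivative_zero_outside[of x "pull \<theta>"] False
    by (simp add: pull_grad_def pull_def)
qed

definition dZ :: "'d \<Rightarrow> real^'d \<Rightarrow> real^'d \<Rightarrow> real" where
  "dZ i x = (if x \<in> U then frechet_derivative (\<lambda>x. S x $ i) (at x) else (\<lambda>_. 0))"

lemma Z_has_derivative:
  assumes "x \<in> U \<or> x \<notin> K"
  shows "((\<lambda>x. Z x $ i) has_derivative dZ i x) (at x)"
proof (cases "x \<in> U")
  case True
  have "((\<lambda>x. S x $ i) has_derivative dZ i x) (at x)"
    using piecewise_C1_has_derivative[OF S_piecewise_C1 True] True by (simp add: dZ_def)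
  then show ?thesis
    by (rule has_derivative_transform_within_open[OF _ open_U True]) (use U_subset_K in \<open>auto simp: Z_def\<close>)
next
  case False
  then have "x \<notin> K" using assms by blast
  then show ?thesis using has_derivative_zero_outside[of x "\<lambda>x. Z x $ i"] False
    by (simp add: dZ_def Z_def)
qed

lemma divS_eq: "divS x = (\<Sum>i\<in>UNIV. dZ i x (axis i 1))"
  by (simp add: divS_def dZ_def)

text \<open>
  Composition with \<open>zoom p \<rho>\<close> contracts a field towards \<open>p\<close> by the factor \<open>\<rho>\<close>.
\<close>

definition zoom :: "real^'d \<Rightarrow> real \<Rightarrow> real^'d \<Rightarrow> real^'d" where
  "zoom p \<rho> x = p + (1 / \<rho>) *\<^sub>R (x - p)"

lemma zoom_shift: "zoom p \<rho> (x + h *\<^sub>R e) = zoom p \<rho> x + (h / \<rho>) *\<^sub>R e"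
  by (simp add: zoom_def algebra_simps)

lemma negligible_zoom_skeleton:
  assumes "0 < \<rho>" shows "negligible {x. zoom p \<rho> x \<in> skeleton}"
proof -
  have "{x. zoom p \<rho> x \<in> skeleton} = (\<Union>i. \<Union>j\<in>{1..num_knots G i}. {x. x $ i = p $ i + \<rho> * (knot G i j - p $ i)})"
  proof -
    have "p $ i + (1 / \<rho>) * (x $ i - p $ i) = t \<longleftrightarrow> x $ i = p $ i + \<rho> * (t - p $ i)" for x i t
      using assms by (simp add: field_simps)
    then show ?thesis by (auto simp: skeleton_def zoom_def)
  qed
  also have "negligible \<dots>" by (auto intro!: negligible_Union negligible_coordinate_plane)
  finally show ?thesis .
qed

lemma zoom_mem_K:
  assumes "0 < \<rho>" "\<rho> \<le> 1" "p \<in> K" "zoom p \<rho> x \<in> K"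
  shows "x \<in> K"
proof -
  have "(1 - \<rho>) *\<^sub>R p + \<rho> *\<^sub>R zoom p \<rho> x \<in> K"
    using assms by (intro convexD convex_box) auto
  also have "(1 - \<rho>) *\<^sub>R p + \<rho> *\<^sub>R zoom p \<rho> x = x"
    using assms(1) by (simp add: zoom_def algebra_simps)
  finally show ?thesis .
qed

text \<open>
  The integrand is the sum of the derivatives in direction \<open>i\<close> of $Z_i\,(\theta\circ F)$, with \<open>Z\<close> contracted, and each of them has
  integral $0$. The case \<open>\<rho> = 1\<close> serves to identify the divergence of \<open>S\<close>, the case \<open>\<rho> < 1\<close> to test weak gradients.
\<close>

lemma divergence_theorem_zoomed:
  assumes \<rho>: "0 < \<rho>" "\<rho> \<le> 1" and p: "p \<in> K"
    and der: "\<And>x. (\<theta> has_derivative (\<lambda>h. d x \<bullet> h)) (at x)" and cont: "continuous_on UNIV d"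
  defines "g \<equiv> \<lambda>x. (1 / \<rho>) * divS (zoom p \<rho> x) * pull \<theta> x + Z (zoom p \<rho> x) \<bullet> pull_grad d x"
  shows "integrable lebesgue g" "integral\<^sup>L lebesgue g = 0"
proof -
  let ?\<phi> = "zoom p \<rho>"
  obtain B where B: "0 \<le> B" "\<And>x. norm (Z x) \<le> B" using Z_bounded by blast
  obtain L where L: "0 \<le> L" "\<And>x h i. \<bar>Z (x + h *\<^sub>R axis i 1) $ i - Z x $ i\<bar> \<le> L * \<bar>h\<bar>" using Z_Lipschitz_axis by blast
  obtain Bq Lq where q: "0 \<le> Bq" "0 \<le> Lq" "\<And>x. \<bar>pull \<theta> x\<bar> \<le> Bq"
    "\<And>x h i. x \<in> K \<Longrightarrow> x + h *\<^sub>R axis i 1 \<in> K \<Longrightarrow> \<bar>pull \<theta> (x + h *\<^sub>R axis i 1) - pull \<theta> x\<bar> \<le> Lq * \<bar>h\<bar>"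
    using pull_properties[OF der cont] by metis
  have c\<theta>: "continuous_on UNIV \<theta>"
    using der by (meson continuous_at_imp_continuous_on has_derivative_continuous)
  have \<phi>m: "?\<phi> \<in> borel_measurable borel"
    unfolding zoom_def[abs_def] by (intro borel_measurable_continuous_onI continuous_intros)
  have Zm: "(\<lambda>x. Z (?\<phi> x) $ i) \<in> borel_measurable borel" for i
    by (rule measurable_compose[OF measurable_compose[OF \<phi>m borel_measurable_Z]])
       (intro borel_measurable_continuous_onI continuous_intros)
  obtain R where R: "\<And>x. x \<in> K \<Longrightarrow> norm x \<le> R" using bounded_cbox bounded_iff by metis
  have Zc: "\<bar>Z x $ i\<bar> \<le> B" for x i using component_le_norm_cart[of "Z x" i] B(2)[of x] by linarith
  define D where "D i x = (1 / \<rho>) * dZ i (?\<phi> x) (axis i 1) * pull \<theta> x + Z (?\<phi> x) $ i * (pull_grad d x $ i)" for i x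
  have "integrable lebesgue (D i) \<and> integral\<^sup>L lebesgue (D i) = 0" for i
  proof -
    define P where "P x = Z (?\<phi> x) $ i * pull \<theta> x" for x
    have "P \<in> borel_measurable borel" unfolding P_def[abs_def] by (intro borel_measurable_times Zm borel_measurable_pull c\<theta>)
    moreover have "norm x \<le> R" if "P x \<noteq> 0" for x
      using that R[of x] by (auto simp: P_def pull_def split: if_splits)
    moreover have "\<bar>P x\<bar> \<le> B * Bq" for x
      unfolding P_def abs_mult using Zc q(3) B(1) by (intro mult_mono) auto
    moreover have "\<bar>P (x + h *\<^sub>R axis i 1) - P x\<bar> \<le> (B * Lq + L / \<rho> * Bq) * \<bar>h\<bar>" for x h
    proof -
      let ?y = "x + h *\<^sub>R axis i 1"
      have lz: "\<bar>Z (?\<phi> ?y) $ i - Z (?\<phi> x) $ i\<bar> \<le> L / \<rho> * \<bar>h\<bar>"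
        using L(2)[of "?\<phi> x" "h / \<rho>" i] \<rho> by (simp add: zoom_shift)
      have n: "0 \<le> B * Lq * \<bar>h\<bar>" "0 \<le> L / \<rho> * \<bar>h\<bar> * Bq" using B q L \<rho> by auto
      have m1: "\<bar>(Z (?\<phi> ?y) $ i - Z (?\<phi> x) $ i) * pull \<theta> w\<bar> \<le> L / \<rho> * \<bar>h\<bar> * Bq" for w
        unfolding abs_mult using lz q(3)[of w] by (intro mult_mono) (auto intro: order.trans)
      show ?thesis
      proof (cases "x \<in> K \<and> ?y \<in> K")
        case True
        have "P ?y - P x = Z (?\<phi> ?y) $ i * (pull \<theta> ?y - pull \<theta> x) + (Z (?\<phi> ?y) $ i - Z (?\<phi> x) $ i) * pull \<theta> x"
          by (simp add: P_def algebra_simps)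
        moreover have "\<bar>Z (?\<phi> ?y) $ i * (pull \<theta> ?y - pull \<theta> x)\<bar> \<le> B * (Lq * \<bar>h\<bar>)"
          unfolding abs_mult using Zc q(4) True B(1) by (intro mult_mono) auto
        ultimately show ?thesis using m1[of x] by (simp add: algebra_simps)
      next
        case False
        \<comment> \<open>For \<open>\<rho> \<le> 1\<close> the contracted field vanishes off \<open>K\<close>, where \<open>pull \<theta>\<close> may jump.\<close>
        have out: "Z (?\<phi> w) = 0" if "w \<notin> K" for w
          using zoom_mem_K[OF \<rho> p, of w] that by (auto simp: Z_def)
        have "P ?y - P x = (Z (?\<phi> ?y) $ i - Z (?\<phi> x) $ i) * pull \<theta> (if x \<in> K then x else ?y)"
          using False out by (auto simp: P_def pull_def)
        then have "\<bar>P ?y - P x\<bar> \<le> L / \<rho> * \<bar>h\<bar> * Bq" using m1 by simp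
        also have "\<dots> \<le> B * Lq * \<bar>h\<bar> + L / \<rho> * \<bar>h\<bar> * Bq" using n(1) by linarith
        also have "\<dots> = (B * Lq + L / \<rho> * Bq) * \<bar>h\<bar>" by algebra
        finally show ?thesis .
      qed
    qed
    moreover have "AE x in lebesgue. ((\<lambda>h. P (x + h *\<^sub>R axis i 1)) has_real_derivative D i x) (at 0)"
    proof (rule AE_I')
      show "skeleton \<union> {x. ?\<phi> x \<in> skeleton} \<in> null_sets lebesgue"
        unfolding negligible_iff_null_sets[symmetric]
        by (rule negligible_Un[OF negligible_skeleton negligible_zoom_skeleton[OF \<rho>(1)]])
      have "((\<lambda>h. P (x + h *\<^sub>R axis i 1)) has_real_derivative D i x) (at 0)"
        if "x \<notin> skeleton" "?\<phi> x \<notin> skeleton" for x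
      proof -
        have "((\<lambda>h. Z (?\<phi> x + h *\<^sub>R axis i 1) $ i) has_real_derivative dZ i (?\<phi> x) (axis i 1)) (at 0)"
          by (rule DERIV_along_axis[OF Z_has_derivative]) (use K_minus_skeleton that in blast)
        moreover have "((\<lambda>h. h / \<rho>) has_real_derivative 1 / \<rho>) (at 0)"
          using DERIV_cdivide[OF DERIV_ident, of \<rho>] .
        ultimately have "((\<lambda>h. Z (?\<phi> x + (h / \<rho>) *\<^sub>R axis i 1) $ i) has_real_derivative dZ i (?\<phi> x) (axis i 1) * (1 / \<rho>)) (at 0)"
          using DERIV_chain2[of "\<lambda>h. Z (?\<phi> x + h *\<^sub>R axis i 1) $ i" _ "\<lambda>h. h / \<rho>" 0 "1 / \<rho>" UNIV]
          by simp
        moreover have "((\<lambda>h. pull \<theta> (x + h *\<^sub>R axis i 1)) has_real_derivative pull_grad d x $ i) (at 0)"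
          using DERIV_along_axis[OF pull_has_derivative[OF der], of x "axis i 1"] K_minus_skeleton that
          by (auto simp: inner_axis)
        ultimately show ?thesis
          unfolding P_def D_def zoom_shift by (auto intro!: derivative_eq_intros)
      qed
      then show "{x \<in> space lebesgue. \<not> ((\<lambda>h. P (x + h *\<^sub>R axis i 1)) has_real_derivative D i x) (at 0)}
          \<subseteq> skeleton \<union> {x. ?\<phi> x \<in> skeleton}" by blast
    qed
    ultimately show ?thesis
      using integral_directional_derivative_eq_0[of P R "B * Bq" "axis i 1"] by blast
  qed
  moreover have "g = (\<lambda>x. \<Sum>i\<in>UNIV. D i x)"
    by (simp add: g_def D_def divS_eq sum.distrib sum_distrib_left sum_distrib_right inner_vec_def)
  ultimately show "integrable lebesgue g" "integral\<^sup>L lebesgue g = 0" by auto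
qed

end

section \<open>Bump kernels and Piola transforms\<close>

lemma flat_exp_continuous: "continuous_on S (flat_exp n)"
  using flat_exp_has_derivative by (meson DERIV_isCont continuous_at_imp_continuous_on)

definition bump_grad :: "real \<Rightarrow> real^'d::finite \<Rightarrow> real^'d \<Rightarrow> real^'d" where
  "bump_grad r z y = (- 2 * flat_exp 2 (r\<^sup>2 - (norm (y - z))\<^sup>2)) *\<^sub>R (y - z)"

text \<open>
  Exchanging centre and argument changes the sign. This turns a derivative acting on the argument of the kernel into
  one acting on its centre.
\<close>

lemma bump_grad_antisym: "bump_grad r z y = - bump_grad r y z"
  by (simp add: bump_grad_def norm_minus_commute algebra_simps)

lemma bump_has_derivative:
  "(bump r z has_derivative (\<lambda>h. bump_grad r z y \<bullet> h)) (at y)"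
proof -
  let ?t = "r\<^sup>2 - (norm (y - z))\<^sup>2"
  have f: "(flat_exp 0 has_derivative (\<lambda>s. flat_exp 2 ?t * s)) (at ?t)"
    using flat_exp_has_derivative[of 0 ?t] by (simp add: has_field_derivative_def numeral_2_eq_2)
  have g: "((\<lambda>y. r\<^sup>2 - (norm (y - z))\<^sup>2) has_derivative (\<lambda>h. - (2 * ((y - z) \<bullet> h)))) (at y)"
    unfolding power2_norm_eq_inner by (auto intro!: derivative_eq_intros simp: inner_commute)
  have "((\<lambda>y. flat_exp 0 (r\<^sup>2 - (norm (y - z))\<^sup>2)) has_derivative (\<lambda>h. flat_exp 2 ?t * (- (2 * ((y - z) \<bullet> h))))) (at y)"
    by (rule has_derivative_compose[OF g f])
  moreover have "(\<lambda>h. flat_exp 2 ?t * (- (2 * ((y - z) \<bullet> h)))) = (\<lambda>h. bump_grad r z y \<bullet> h)"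
    by (simp add: bump_grad_def fun_eq_iff)
  moreover have "bump r z = (\<lambda>y. flat_exp 0 (r\<^sup>2 - (norm (y - z))\<^sup>2))" by (simp add: fun_eq_iff bump_eq)
  ultimately show ?thesis by simp
qed

lemma gradient_bump: "gradient (bump r z) y = bump_grad r z y"
  using frechet_derivative_at[OF bump_has_derivative, of r z y, symmetric]
  by (simp add: gradient_def vec_eq_iff inner_axis)

lemma continuous_bump_grad: "continuous_on UNIV (bump_grad r z)"
  unfolding bump_grad_def[abs_def]
  by (intro continuous_intros continuous_on_compose2[OF flat_exp_continuous]) auto

lemma bump_measurable: "(\<lambda>p. bump r (fst p) (snd p)) \<in> borel_measurable (borel \<Otimes>\<^sub>M borel)"
  unfolding bump_eq borel_prod
  by (intro borel_measurable_continuous_onI continuous_on_compose2[OF flat_exp_continuous] continuous_intros) auto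

lemma bump_grad_measurable: "(\<lambda>p. bump_grad r (fst p) (snd p)) \<in> borel_measurable (borel \<Otimes>\<^sub>M borel)"
  unfolding bump_grad_def borel_prod
  by (intro borel_measurable_continuous_onI continuous_intros continuous_on_compose2[OF flat_exp_continuous]) auto

lemma bump_grad_bounded:
  assumes "0 < r" shows "norm (bump_grad r z y) \<le> 48 * r ^ 5"
proof (cases "norm (y - z) < r")
  case True
  let ?t = "r\<^sup>2 - (norm (y - z))\<^sup>2"
  have t: "0 \<le> ?t" "?t \<le> r\<^sup>2" using True by (auto intro: power_mono)
  have "\<bar>flat_exp 2 ?t\<bar> \<le> 24 * ?t\<^sup>2"
    using flat_exp_quadratic_bound[of 2 ?t] by (simp add: fact_numeral)
  also have "\<dots> \<le> 24 * (r\<^sup>2)\<^sup>2" using t by (intro mult_left_mono power_mono) auto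
  finally have "\<bar>flat_exp 2 ?t\<bar> * norm (y - z) \<le> 24 * (r\<^sup>2)\<^sup>2 * r"
    using True assms by (intro mult_mono) auto
  then show ?thesis by (simp add: bump_grad_def abs_mult eval_nat_numeral mult_ac)
next
  case False
  then have "r\<^sup>2 \<le> (norm (y - z))\<^sup>2" using assms by (intro power_mono) auto
  then have "flat_exp 2 (r\<^sup>2 - (norm (y - z))\<^sup>2) = 0" by (simp add: flat_exp_def)
  then show ?thesis using assms by (simp add: bump_grad_def)
qed

lemma bump_integral:
  fixes z :: "real^'d::finite"
  assumes "0 < r"
  shows "integrable lebesgue (bump r z)" "integral\<^sup>L lebesgue (bump r z) = integral\<^sup>L lebesgue (bump r (0::real^'d))"
    "0 < integral\<^sup>L lebesgue (bump r z)"
proof -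
  have c: "continuous_on S (bump r w)" for S and w :: "real^'d" by (rule smooth_expr_continuous[OF smooth_expr_bump])
  have m: "bump r w \<in> borel_measurable borel" for w :: "real^'d" by (rule borel_measurable_continuous_onI[OF c])
  have "bump r w = (\<lambda>x. indicator (cball w r) x *\<^sub>R bump r w x)" for w :: "real^'d"
    using bump_eq_0[OF assms] by (force simp: indicator_def)
  then have i: "integrable lborel (bump r w)" for w :: "real^'d"
    using borel_integrable_compact[OF compact_cball c, of w r w] by simp
  show il: "integrable lebesgue (bump r z)" using i[of z] m[of z] by (subst integrable_completion) simp_all
  have "integral\<^sup>L (distr lborel borel ((+) z)) (bump r z) = (LINT x|lborel. bump r z (z + x))"
    using m by (intro integral_distr) auto
  moreover have "bump r z (z + x) = bump r 0 x" for x by (simp add: bump_eq)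
  ultimately have "integral\<^sup>L lborel (bump r z) = integral\<^sup>L lborel (bump r (0::real^'d))"
    by (simp add: lborel_distr_plus)
  then show "integral\<^sup>L lebesgue (bump r z) = integral\<^sup>L lebesgue (bump r (0::real^'d))"
    using m by (simp add: integral_completion)
  have "integral\<^sup>L lebesgue (bump r z) \<noteq> 0"
  proof
    assume "integral\<^sup>L lebesgue (bump r z) = 0"
    then have "AE x in lebesgue. bump r z x = 0"
      using integral_nonneg_eq_0_iff_AE[OF il] bump_nonneg by (metis (no_types, lifting) AE_I2)
    then have "AE x in lebesgue. x \<notin> ball z r"
      by (rule AE_mp) (use bump_pos_iff[OF assms] in \<open>auto intro!: AE_I2 simp: less_le\<close>)
    then have "negligible (ball z r)"
      unfolding negligible_iff_null_sets using AE_iff_null_sets[of "ball z r" lebesgue] by auto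
    then show False using open_not_negligible[of "ball z r"] assms by simp
  qed
  moreover have "0 \<le> integral\<^sup>L lebesgue (bump r z)"
    by (intro integral_nonneg_AE AE_I2 bump_nonneg)
  ultimately show "0 < integral\<^sup>L lebesgue (bump r z)" by linarith
qed

context mesh begin

text \<open>
  The inverse parametrization. The default value lies outside \<open>U\<close>, so that functions vanishing off \<open>U\<close> are
  transported to functions vanishing off \<open>F ` U\<close>.
\<close>

definition unparam :: "real^'d \<Rightarrow> real^'d" where
  "unparam y = (if y \<in> F ` U then inv_into K F y else first_corner G)"

lemma unparam: "x \<in> U \<Longrightarrow> unparam (F x) = x"
  using U_subset_K inj_param by (auto simp: unparam_def inv_into_f_f)

lemma first_corner_notin_U: "first_corner G \<notin> U"
  using U_subset_box by (auto simp: mem_box)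

lemma unparam_U_iff: "unparam y \<in> U \<longleftrightarrow> y \<in> F ` U"
proof (cases "y \<in> F ` U")
  case True
  then obtain x where "x \<in> U" "y = F x" by blast
  then show ?thesis using unparam True by simp
next
  case False
  then show ?thesis using first_corner_notin_U by (simp add: unparam_def)
qed

lemma continuous_unparam: "continuous_on (F ` U) unparam"
proof -
  have "continuous_on (F ` K) (inv_into K F)"
    using continuous_on_inv[OF continuous_param compact_cbox] inj_param by (auto simp: inv_into_f_f)
  then have "continuous_on (F ` U) (inv_into K F)"
    by (rule continuous_on_subset) (use U_subset_K in blast)
  then show ?thesis by (rule continuous_on_eq) (simp add: unparam_def)
qed

lemma borel_measurable_unparam: "unparam \<in> borel_measurable borel"
proof -
  have "continuous_on (F ` U) (inv_into K F)"
    using continuous_unparam by (rule continuous_on_eq) (simp add: unparam_def)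
  then show ?thesis
    unfolding unparam_def[abs_def] using open_image_U by (intro borel_measurable_continuous_on_if) auto
qed

end

context mesh_field begin

lemma pull_grad_outside: "x \<notin> U \<Longrightarrow> pull_grad d x = 0"
  by (simp add: pull_grad_def)

text \<open>
  The factor $1/\det DF$ of the Piola transform and the $|\det DF|$ of the change of variables combine to the sign
  \<open>\<sigma>\<close>, and $DF$ passes to the gradient as its transpose.
\<close>

lemma push_pull:
  assumes dim: "CARD('d) = 2 \<or> CARD('d) = 3"
    and \<sigma>: "\<sigma> = 1 \<or> \<sigma> = - 1" "\<And>c x. c \<in> cells G \<Longrightarrow> x \<in> closed_ref_cell G c \<Longrightarrow> sgn (det (jac G c x)) = \<sigma>"
    and w: "\<And>x. x \<in> U \<Longrightarrow> w (F x) = (1 / det (J x)) *\<^sub>R (J x *v Y x)"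
  shows "integrable (lebesgue_on (domain G)) (\<lambda>y. w y \<bullet> d y) \<longleftrightarrow> integrable lebesgue (\<lambda>x. Y x \<bullet> pull_grad d x)" (is ?A)
    and "(LINT y|lebesgue_on (domain G). w y \<bullet> d y) = \<sigma> * (LINT x|lebesgue. Y x \<bullet> pull_grad d x)" (is ?B)
proof -
  have U: "U \<in> sets lebesgue" using open_U by auto
  have sg: "sgn (det (J x)) = \<sigma>" if x: "x \<in> U" for x
  proof -
    obtain c where c: "c \<in> cells G" "x \<in> ref_cell G c" using x by blast
    show ?thesis using \<sigma>(2)[OF c(1)] ref_cell_subset_closed c jac_eq_J[OF c] by (metis subsetD)
  qed
  have pt: "\<bar>det (J x)\<bar> * (w (F x) \<bullet> d (F x)) = \<sigma> * (Y x \<bullet> pull_grad d x)" if x: "x \<in> U" for x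
  proof -
    have "\<bar>det (J x)\<bar> * (1 / det (J x)) = \<sigma>"
      using sg[OF x] det_J_nonzero[OF x] by (simp add: sgn_div_norm abs_if split: if_splits)
    moreover have "(J x *v Y x) \<bullet> d (F x) = Y x \<bullet> pull_grad d x"
      using x by (simp add: pull_grad_def inner_commute[of "J x *v Y x"] inner_commute[of "Y x"] dot_lmul_matrix)
    moreover have "\<bar>det (J x)\<bar> * (w (F x) \<bullet> d (F x)) = (\<bar>det (J x)\<bar> * (1 / det (J x))) * ((J x *v Y x) \<bullet> d (F x))"
      by (simp add: w[OF x])
    ultimately show ?thesis by simp
  qed
  have restr: "(if x \<in> U then \<bar>det (J x)\<bar> * (w (F x) \<bullet> d (F x)) else 0) = \<sigma> * (Y x \<bullet> pull_grad d x)" for x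
    using pt by (simp add: pull_grad_outside)
  have 1: "integrable (lebesgue_on U) (\<lambda>x. \<bar>det (J x)\<bar> * (w (F x) \<bullet> d (F x))) \<longleftrightarrow> integrable lebesgue (\<lambda>x. \<sigma> * (Y x \<bullet> pull_grad d x))"
    unfolding Lebesgue_Measure.integrable_restrict_UNIV[OF U, symmetric] restr ..
  have 2: "(LINT x|lebesgue_on U. \<bar>det (J x)\<bar> * (w (F x) \<bullet> d (F x))) = (LINT x|lebesgue. \<sigma> * (Y x \<bullet> pull_grad d x))"
    unfolding Lebesgue_Measure.integral_restrict_UNIV[OF U, symmetric] restr ..
  have \<sigma>0: "\<sigma> \<noteq> 0" using \<sigma>(1) by auto
  show ?A unfolding domain_change_of_variables(1)[OF dim] 1 using \<sigma>0 by simp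
  show ?B unfolding domain_change_of_variables(2)[OF dim] 2 by simp
qed

definition pushed :: "real^'d \<Rightarrow> real \<Rightarrow> real^'d \<Rightarrow> real^'d" where
  "pushed p \<rho> x = (if x \<in> U then (1 / det (J x)) *\<^sub>R (J x *v Z (zoom p \<rho> x)) else 0)"

text \<open>
  The Piola transform of the contracted field, as a field on the physical domain.
\<close>

definition shrunk :: "real^'d \<Rightarrow> real \<Rightarrow> real^'d \<Rightarrow> real^'d" where
  "shrunk p \<rho> y = pushed p \<rho> (unparam y)"

lemma shrunk_param: "x \<in> U \<Longrightarrow> shrunk p \<rho> (F x) = (1 / det (J x)) *\<^sub>R (J x *v Z (zoom p \<rho> x))"
  by (simp add: shrunk_def unparam pushed_def)

lemma continuous_det_J: "continuous_on U (\<lambda>x. det (J x))"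
  unfolding det_def by (intro continuous_intros continuous_J)

lemma continuous_Piola:
  assumes "continuous_on A f" "A \<subseteq> U"
  shows "continuous_on A (\<lambda>x. (1 / det (J x)) *\<^sub>R (J x *v f x))"
proof -
  have "continuous_on A J" "continuous_on A (\<lambda>x. det (J x))"
    using continuous_J continuous_det_J assms(2) continuous_on_subset by blast+
  then show ?thesis unfolding matrix_vector_mult_def
    using assms det_J_nonzero by (intro continuous_intros) auto
qed

lemma continuous_zoom: "continuous_on A (zoom p \<rho>)"
  unfolding zoom_def[abs_def] by (intro continuous_intros)

lemma borel_measurable_pushed: "pushed p \<rho> \<in> borel_measurable borel"
proof -
  have zm: "(\<lambda>x. Z (zoom p \<rho> x)) \<in> borel_measurable borel"
    by (rule measurable_compose[OF borel_measurable_continuous_onI[OF continuous_zoom] borel_measurable_Z])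
  have jm: "(\<lambda>x. if x \<in> U then (1 / det (J x)) *\<^sub>R (J x *v axis j 1) else 0) \<in> borel_measurable borel" for j
    using open_U by (intro borel_measurable_continuous_on_if continuous_Piola continuous_on_const order_refl) auto
  have "pushed p \<rho> x = (\<Sum>j\<in>UNIV. Z (zoom p \<rho> x) $ j *\<^sub>R (if x \<in> U then (1 / det (J x)) *\<^sub>R (J x *v axis j 1) else 0))" for x
  proof (cases "x \<in> U")
    case True
    have "J x *v z = (\<Sum>j\<in>UNIV. z $ j *\<^sub>R (J x *v axis j 1))" for z
    proof -
      have "J x *v z = J x *v (\<Sum>j\<in>UNIV. z $ j *\<^sub>R axis j 1)"
        by (simp add: basis_expansion flip: scalar_mult_eq_scaleR)
      then show ?thesis by (simp add: linear_sum[OF matrix_vector_mul_linear] matrix_vector_mult_scaleR)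
    qed
    from this[of "Z (zoom p \<rho> x)"] show ?thesis
      using True by (simp only: pushed_def if_True scaleR_sum_right scaleR_left_commute)
  qed (simp add: pushed_def)
  then have eq: "pushed p \<rho> = (\<lambda>x. \<Sum>j\<in>UNIV. Z (zoom p \<rho> x) $ j *\<^sub>R (if x \<in> U then (1 / det (J x)) *\<^sub>R (J x *v axis j 1) else 0))"
    by blast
  have zj: "(\<lambda>x. Z (zoom p \<rho> x) $ j) \<in> borel_measurable borel" for j
    by (rule measurable_compose[OF zm]) (intro borel_measurable_continuous_onI continuous_intros)
  show ?thesis unfolding eq by (intro borel_measurable_sum borel_measurable_scaleR zj jm)
qed

lemma borel_measurable_shrunk: "shrunk p \<rho> \<in> borel_measurable borel"
  unfolding shrunk_def[abs_def] by (rule measurable_compose[OF borel_measurable_unparam borel_measurable_pushed])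

text \<open>
  The bound does not depend on \<open>\<rho>\<close>, as is needed for dominated convergence as \<open>\<rho>\<close> tends to $1$.
\<close>

lemma pushed_bounded:
  obtains B where "0 \<le> B" "\<And>p \<rho> x. norm (pushed p \<rho> x) \<le> B"
proof -
  obtain b where b: "0 \<le> b" "\<And>x. norm (Z x) \<le> b" using Z_bounded by blast
  have "\<exists>B. \<forall>x\<in>closed_ref_cell G c. \<forall>z\<in>cball 0 b. norm ((1 / det (jac G c x)) *\<^sub>R (jac G c x *v z)) \<le> B" if c: "c \<in> cells G" for c
  proof -
    let ?f = "\<lambda>q. (1 / det (jac G c (fst q))) *\<^sub>R (jac G c (fst q) *v snd q) :: real^'d"
    let ?P = "closed_ref_cell G c \<times> cball (0::real^'d) b"
    have cj: "continuous_on ?P (\<lambda>q. jac G c (fst q))" "continuous_on ?P (\<lambda>q. det (jac G c (fst q)))"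
      by (rule continuous_on_compose2[OF continuous_jac[OF c] continuous_on_fst[OF continuous_on_id]], force)
         (rule continuous_on_compose2[OF continuous_det_jac[OF c] continuous_on_fst[OF continuous_on_id]], force)
    have "continuous_on ?P ?f" unfolding matrix_vector_mult_def
      using cj det_jac_nonzero[OF c] by (intro continuous_intros) auto
    then have "bounded (?f ` ?P)"
      by (intro compact_imp_bounded compact_continuous_image compact_Times compact_closed_ref_cell compact_cball)
    then obtain B where B: "\<And>q. q \<in> ?P \<Longrightarrow> norm (?f q) \<le> B" unfolding bounded_iff by blast
    show ?thesis
    proof (intro exI[of _ B] ballI)
      fix x z assume "x \<in> closed_ref_cell G c" "z \<in> cball (0::real^'d) b"
      then show "norm ((1 / det (jac G c x)) *\<^sub>R (jac G c x *v z)) \<le> B" using B[of "(x, z)"] by simp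
    qed
  qed
  then obtain B where B: "\<And>c x z. c \<in> cells G \<Longrightarrow> x \<in> closed_ref_cell G c \<Longrightarrow> z \<in> cball 0 b \<Longrightarrow>
      norm ((1 / det (jac G c x)) *\<^sub>R (jac G c x *v z)) \<le> B c" by metis
  define M where "M = (\<Sum>c\<in>cells G. \<bar>B c\<bar>)"
  have "norm (pushed p \<rho> x) \<le> M" for p \<rho> x
  proof (cases "x \<in> U")
    case True
    then obtain c where c: "c \<in> cells G" "x \<in> ref_cell G c" by blast
    have "norm (pushed p \<rho> x) \<le> B c"
      using B[OF c(1), of x "Z (zoom p \<rho> x)"] b(2) ref_cell_subset_closed[of c] c True jac_eq_J[OF c]
      by (auto simp: pushed_def)
    also have "\<dots> \<le> \<bar>B c\<bar>" by simp
    also have "\<dots> \<le> M" unfolding M_def using c(1) finite_cells by (intro member_le_sum) auto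
    finally show ?thesis .
  qed (simp add: pushed_def M_def sum_nonneg)
  then show ?thesis using that[of M] by (simp add: M_def sum_nonneg)
qed

end

section \<open>Mollification of compactly supported velocities\<close>

context mesh_field begin

text \<open>
  The contracted field may jump where \<open>zoom p \<rho>\<close> meets the boundary of \<open>K\<close>, the transformation at the facets of the mesh.
  Off these null sets \<open>shrunk p \<rho>\<close> is continuous, so mollification converges there pointwise.
\<close>

definition smooth_points :: "real^'d \<Rightarrow> real \<Rightarrow> (real^'d) set" where
  "smooth_points p \<rho> = {x \<in> U. zoom p \<rho> x \<in> K\<^sub>o \<union> - K}"

lemma open_smooth_points: "open (smooth_points p \<rho>)"
proof -
  have o: "open (K\<^sub>o \<union> - K)"
    by (intro open_Un open_box open_Compl closed_cbox)
  have "smooth_points p \<rho> = U \<inter> zoom p \<rho> -` (K\<^sub>o \<union> - K)"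
    by (auto simp: smooth_points_def)
  then show ?thesis using continuous_open_preimage[OF continuous_zoom open_U o] by simp
qed

lemma frontier_K_skeleton: "x \<in> K \<Longrightarrow> x \<notin> skeleton \<Longrightarrow> x \<in> K\<^sub>o"
  using K_minus_skeleton U_subset_box by blast

lemma negligible_U_minus_smooth: "0 < \<rho> \<Longrightarrow> negligible (U - smooth_points p \<rho>)"
  by (rule negligible_subset[OF negligible_zoom_skeleton[of \<rho> p]])
     (auto simp: smooth_points_def dest: frontier_K_skeleton)

lemma continuous_Z_zoom: "continuous_on (smooth_points p \<rho>) (\<lambda>x. Z (zoom p \<rho> x))"
proof -
  have "continuous_on (K\<^sub>o) Z"
    using continuous_on_subset[OF continuous_S box_subset_cbox] by (rule continuous_on_eq) (use box_subset_cbox in \<open>auto simp: Z_def\<close>)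
  moreover have "continuous_on (- K) Z"
    using continuous_on_const[of "- K" "0 :: real^'d"] by (rule continuous_on_eq) (auto simp: Z_def)
  ultimately have "continuous_on (K\<^sub>o \<union> - K) Z"
    by (intro continuous_on_open_Un open_box open_Compl closed_cbox)
  then show ?thesis
    by (rule continuous_on_compose2[OF _ continuous_zoom]) (auto simp: smooth_points_def)
qed

lemma continuous_shrunk: "continuous_on (F ` smooth_points p \<rho>) (shrunk p \<rho>)"
proof -
  have sub: "smooth_points p \<rho> \<subseteq> U" by (auto simp: smooth_points_def)
  have "continuous_on (smooth_points p \<rho>) (\<lambda>x. (1 / det (J x)) *\<^sub>R (J x *v Z (zoom p \<rho> x)))"
    by (rule continuous_Piola[OF continuous_Z_zoom sub])
  then have c: "continuous_on (smooth_points p \<rho>) (pushed p \<rho>)"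
    by (rule continuous_on_eq) (use sub in \<open>auto simp: pushed_def\<close>)
  have u: "continuous_on (F ` smooth_points p \<rho>) unparam"
    by (rule continuous_on_subset[OF continuous_unparam]) (use sub in blast)
  show ?thesis unfolding shrunk_def[abs_def]
  proof (rule continuous_on_compose2[OF c u], rule image_subsetI)
    fix y assume "y \<in> F ` smooth_points p \<rho>"
    then obtain x where x: "x \<in> smooth_points p \<rho>" "y = F x" by blast
    then show "unparam y \<in> smooth_points p \<rho>" using unparam[OF subsetD[OF sub x(1)]] by simp
  qed
qed

lemma open_image_smooth_points: "open (F ` smooth_points p \<rho>)"
proof -
  have sub: "smooth_points p \<rho> \<subseteq> K" using U_subset_K by (auto simp: smooth_points_def)
  show ?thesis
    by (intro invariance_of_domain continuous_on_subset[OF continuous_param sub] inj_on_subset[OF inj_param sub] open_smooth_points)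
qed

lemma AE_domain_smooth_points:
  assumes "0 < \<rho>"
  shows "AE y in lebesgue_on (domain G). y \<in> F ` smooth_points p \<rho>"
proof -
  have "F differentiable_on (U - smooth_points p \<rho>)"
    unfolding differentiable_on_def using param_has_derivative_J
    by (meson DiffD1 differentiableI differentiable_at_withinI)
  then have "negligible (F ` (U - smooth_points p \<rho>))"
    by (intro negligible_differentiable_image_negligible negligible_U_minus_smooth assms) simp
  then have "negligible ((domain G - F ` U) \<union> F ` (U - smooth_points p \<rho>))"
    using negligible_Un negligible_domain_minus by blast
  then have "negligible (domain G - F ` smooth_points p \<rho>)"
    by (rule negligible_subset) blast
  then have "domain G - F ` smooth_points p \<rho> \<in> null_sets lebesgue" by (simp only: negligible_iff_null_sets)
  then have "AE y in lebesgue. y \<in> domain G \<longrightarrow> y \<in> F ` smooth_points p \<rho>"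
    by (rule AE_I') auto
  then show ?thesis using open_domain by (subst AE_restrict_space_iff) auto
qed

text \<open>
  The support is contained in the image of a contracted copy of \<open>K\<close>, a compact subset of the domain.
\<close>

lemma shrunk_support:
  assumes \<rho>: "0 < \<rho>" "\<rho> < 1" and p: "p \<in> K\<^sub>o"
  obtains r0 where "0 < r0" "\<And>z r. shrunk p \<rho> z \<noteq> 0 \<Longrightarrow> r \<le> r0 \<Longrightarrow> cball z r \<subseteq> domain G"
proof -
  define T where "T = (\<lambda>w. p + \<rho> *\<^sub>R (w - p)) ` K"
  have "compact T" unfolding T_def by (intro compact_continuous_image continuous_intros compact_cbox)
  have Tbox: "T \<subseteq> K\<^sub>o"
  proof
    fix x assume "x \<in> T"
    then obtain w where w: "w \<in> K" "x = p + \<rho> *\<^sub>R (w - p)" by (auto simp: T_def)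
    have "knot G i 1 < x $ i \<and> x $ i < knot G i (num_knots G i)" for i
    proof -
      let ?a = "knot G i 1" and ?b = "knot G i (num_knots G i)"
      have pi: "?a < p $ i" "p $ i < ?b" and wi: "?a \<le> w $ i" "w $ i \<le> ?b"
        using p[unfolded mem_box_K] w(1)[unfolded mem_K] by auto
      have xi: "x $ i = (1 - \<rho>) * p $ i + \<rho> * w $ i" unfolding w(2) by (simp add: algebra_simps)
      have "(1 - \<rho>) * ?a < (1 - \<rho>) * p $ i" "(1 - \<rho>) * p $ i < (1 - \<rho>) * ?b" "\<rho> * ?a \<le> \<rho> * w $ i" "\<rho> * w $ i \<le> \<rho> * ?b"
        using pi wi \<rho> by auto
      then show ?thesis unfolding xi by (simp add: algebra_simps)
    qed
    then show "x \<in> K\<^sub>o" unfolding mem_box_K by blast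
  qed
  have "compact (F ` T)"
    using continuous_on_subset[OF continuous_param order.trans[OF Tbox box_subset_cbox]] \<open>compact T\<close>
    by (rule compact_continuous_image)
  moreover have "F ` T \<subseteq> domain G" unfolding domain_def using Tbox by (rule image_mono)
  ultimately obtain e where e: "0 < e" "(\<Union>x\<in>F ` T. cball x e) \<subseteq> domain G"
    using compact_subset_open_imp_cball_epsilon_subset[OF _ open_domain] by blast
  have "cball z r \<subseteq> domain G" if "shrunk p \<rho> z \<noteq> 0" "r \<le> e" for z r
  proof -
    let ?x = "unparam z"
    have x: "?x \<in> U" using that(1) by (auto simp: shrunk_def pushed_def split: if_splits)
    then obtain x' where "x' \<in> U" "z = F x'" using unparam_U_iff[of z] by blast
    then have zx: "z = F ?x" using unparam[of x'] by simp
    have "Z (zoom p \<rho> ?x) \<noteq> 0" using that(1) x by (auto simp: shrunk_def pushed_def)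
    then have "zoom p \<rho> ?x \<in> K" by (auto simp: Z_def split: if_splits)
    moreover have "?x = p + \<rho> *\<^sub>R (zoom p \<rho> ?x - p)" using \<rho> by (simp add: zoom_def)
    ultimately have "?x \<in> T" unfolding T_def by blast
    then have "cball z e \<subseteq> domain G" using e(2) zx by blast
    then show ?thesis using that(2) by (meson order.trans subset_cball)
  qed
  then show ?thesis using that e(1) by blast
qed

text \<open>
  The function \<open>\<theta>\<close> ranges over functions on the whole space, in particular over bumps that are centred near the boundary.
\<close>

lemma shrunk_weakly_divergence_free:
  assumes dim: "CARD('d) = 2 \<or> CARD('d) = 3" and div0: "\<And>x. divS x = 0"
    and \<rho>: "0 < \<rho>" "\<rho> < 1" and p: "p \<in> K\<^sub>o"
    and der: "\<And>x. (\<theta> has_derivative (\<lambda>h. d x \<bullet> h)) (at x)" and cont: "continuous_on UNIV d"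
  shows "(LINT y|lebesgue_on (domain G). shrunk p \<rho> y \<bullet> d y) = 0"
proof -
  obtain \<sigma> where \<sigma>: "\<sigma> = 1 \<or> \<sigma> = - 1" "\<And>c x. c \<in> cells G \<Longrightarrow> x \<in> closed_ref_cell G c \<Longrightarrow> sgn (det (jac G c x)) = \<sigma>"
    using det_jac_sign by metis
  have "(LINT y|lebesgue_on (domain G). shrunk p \<rho> y \<bullet> d y) = \<sigma> * (LINT x|lebesgue. Z (zoom p \<rho> x) \<bullet> pull_grad d x)"
    by (rule push_pull(2)[OF dim \<sigma> shrunk_param])
  also have "(LINT x|lebesgue. Z (zoom p \<rho> x) \<bullet> pull_grad d x) = 0"
    using divergence_theorem_zoomed(2)[OF \<rho>(1) less_imp_le[OF \<rho>(2)] subsetD[OF box_subset_cbox p] der cont] by (simp add: div0)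
  finally show ?thesis by simp
qed

text \<open>
  Bump kernels centred at a point \<open>z\<close> of the support of the velocity are test functions. Summing the weak equations for
  \<open>g\<close> against the components of the velocity and integrating over \<open>z\<close> leaves, after an exchange of the integrals, the
  velocity tested with the gradient of a bump, which is $0$. The velocity itself is recovered as the kernels concentrate.
\<close>

lemma gradient_orthogonal_shrunk:
  assumes dim: "CARD('d) = 2 \<or> CARD('d) = 3" and div0: "\<And>x. divS x = 0"
    and \<rho>: "0 < \<rho>" "\<rho> < 1" and p: "p \<in> K\<^sub>o"
    and \<Phi>: "\<Phi> \<in> L2 (lebesgue_on (domain G))" and g: "is_weak_grad (domain G) \<Phi> g"
  shows "(LINT y|lebesgue_on (domain G). g y \<bullet> shrunk p \<rho> y) = 0"
proof -
  let ?M = "lebesgue_on (domain G)" and ?v = "shrunk p \<rho>"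
  interpret M: finite_measure ?M by (rule finite_measure_domain)
  interpret P: pair_sigma_finite ?M ?M by unfold_locales
  obtain B where B: "0 \<le> B" "\<And>y. norm (?v y) \<le> B" using pushed_bounded unfolding shrunk_def by metis
  have b2M: "f \<in> borel_measurable ?M" if "f \<in> borel_measurable borel" for f :: "real^'d \<Rightarrow> 'b::euclidean_space"
    using that by (intro measurable_restrict_space1 measurable_completion) simp
  have vM: "?v \<in> borel_measurable ?M" by (rule b2M[OF borel_measurable_shrunk])
  have gL2: "g \<in> L2 ?M" using g by (simp add: is_weak_grad_def)
  have gM: "g \<in> borel_measurable ?M" and \<Phi>M: "\<Phi> \<in> borel_measurable ?M" using gL2 \<Phi> by (auto simp: L2_def)
  have one: "(\<lambda>_. 1 :: real) \<in> L2 ?M" by (simp add: L2_def)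
  have L1: "integrable ?M (\<lambda>y. \<bar>f y\<bar>)" if "f \<in> L2 ?M" for f :: "real^'d \<Rightarrow> real"
    using L2_imp_integrable_inner[OF that one] by simp
  have ng: "integrable ?M (\<lambda>y. norm (g y))"
  proof -
    have "(\<lambda>y. norm (g y)) \<in> L2 ?M" using gL2 by (auto simp: L2_def)
    from L1[OF this] show ?thesis by simp
  qed
  have idm: "(\<lambda>q. q) \<in> (?M \<Otimes>\<^sub>M ?M) \<rightarrow>\<^sub>M (borel \<Otimes>\<^sub>M borel)"
  proof -
    have "(\<lambda>x. x) \<in> ?M \<rightarrow>\<^sub>M borel" by (rule b2M) simp
    then have "(\<lambda>q. (fst q, snd q)) \<in> (?M \<Otimes>\<^sub>M ?M) \<rightarrow>\<^sub>M (borel \<Otimes>\<^sub>M borel)"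
      by (intro measurable_Pair measurable_compose[OF measurable_fst] measurable_compose[OF measurable_snd])
    then show ?thesis by simp
  qed
  \<comment> \<open>Fubini's theorem applies to both double integrals, as each integrand is bounded by an integrable function of \<open>y\<close>.\<close>
  have dominated: "integrable (?M \<Otimes>\<^sub>M ?M) f"
    if fm: "f \<in> borel_measurable (?M \<Otimes>\<^sub>M ?M)" and h: "integrable ?M h" "\<And>y. 0 \<le> h y" and fb: "\<And>y z. \<bar>f (y, z)\<bar> \<le> h y"
    for f :: "(real^'d) \<times> (real^'d) \<Rightarrow> real" and h
  proof (rule Bochner_Integration.integrable_bound)
    show "integrable (?M \<Otimes>\<^sub>M ?M) (\<lambda>q. h (fst q))"
    proof (rule P.Fubini_integrable)
      show "(\<lambda>q. h (fst q)) \<in> borel_measurable (?M \<Otimes>\<^sub>M ?M)"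
        using h(1) by (intro measurable_compose[OF measurable_fst]) simp
      show "integrable ?M (\<lambda>x. LINT y|?M. norm (h (fst (x, y))))"
        using h(1) by simp
      show "AE x in ?M. integrable ?M (\<lambda>y. h (fst (x, y)))" by simp
    qed
    show "AE q in ?M \<Otimes>\<^sub>M ?M. norm (f q) \<le> norm (h (fst q))"
      using fb h(2) by (intro AE_I2) (metis abs_of_nonneg prod.collapse real_norm_def)
  qed (rule fm)
  have fstm: "(\<lambda>q. f (fst q)) \<in> borel_measurable (?M \<Otimes>\<^sub>M ?M)" and sndm: "(\<lambda>q. f (snd q)) \<in> borel_measurable (?M \<Otimes>\<^sub>M ?M)"
    if "f \<in> borel_measurable ?M" for f :: "real^'d \<Rightarrow> 'b::euclidean_space"
    using that measurable_compose[OF measurable_fst] measurable_compose[OF measurable_snd] by blast+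
  obtain r0 where r0: "0 < r0" "\<And>z r. ?v z \<noteq> 0 \<Longrightarrow> r \<le> r0 \<Longrightarrow> cball z r \<subseteq> domain G"
    using shrunk_support[OF \<rho> p] by blast
  have mollified: "(LINT y|?M. (LINT z|?M. (g y \<bullet> ?v z) * bump r y z)) = 0" if r: "0 < r" "r \<le> r0" for r
  proof -
    let ?f1 = "\<lambda>y z. (g y \<bullet> ?v z) * bump r y z"
    let ?f2 = "\<lambda>y z. \<Phi> y * (?v z \<bullet> bump_grad r y z)"
    have i1: "integrable (?M \<Otimes>\<^sub>M ?M) (\<lambda>q. ?f1 (fst q) (snd q))"
    proof (rule dominated)
      show "(\<lambda>q. ?f1 (fst q) (snd q)) \<in> borel_measurable (?M \<Otimes>\<^sub>M ?M)"
        by (intro borel_measurable_times borel_measurable_inner fstm sndm gM vM measurable_compose[OF idm bump_measurable])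
      show "integrable ?M (\<lambda>y. norm (g y) * B)" using ng by simp
      show "0 \<le> norm (g y) * B" for y using B(1) by simp
      show "\<bar>?f1 (fst (y, z)) (snd (y, z))\<bar> \<le> norm (g y) * B" for y z
      proof -
        have "\<bar>g y \<bullet> ?v z\<bar> \<le> norm (g y) * B"
          by (rule order.trans[OF Cauchy_Schwarz_ineq2]) (intro mult_left_mono B norm_ge_zero)
        then have "\<bar>g y \<bullet> ?v z\<bar> * bump r y z \<le> (norm (g y) * B) * 1"
          using B(1) bump_nonneg bump_le_1 by (intro mult_mono) auto
        then show ?thesis using bump_nonneg[of r y z] by (simp add: abs_mult)
      qed
    qed
    have i2: "integrable (?M \<Otimes>\<^sub>M ?M) (\<lambda>q. ?f2 (fst q) (snd q))"
    proof (rule dominated)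
      show "(\<lambda>q. ?f2 (fst q) (snd q)) \<in> borel_measurable (?M \<Otimes>\<^sub>M ?M)"
        by (intro borel_measurable_times borel_measurable_inner fstm sndm \<Phi>M vM measurable_compose[OF idm bump_grad_measurable])
      show "integrable ?M (\<lambda>y. \<bar>\<Phi> y\<bar> * (B * (48 * r ^ 5)))" using L1[OF \<Phi>] by simp
      show "0 \<le> \<bar>\<Phi> y\<bar> * (B * (48 * r ^ 5))" for y using B(1) r by simp
      show "\<bar>?f2 (fst (y, z)) (snd (y, z))\<bar> \<le> \<bar>\<Phi> y\<bar> * (B * (48 * r ^ 5))" for y z
      proof -
        have "\<bar>?v z \<bullet> bump_grad r y z\<bar> \<le> norm (?v z) * norm (bump_grad r y z)" by (rule Cauchy_Schwarz_ineq2)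
        also have "\<dots> \<le> B * (48 * r ^ 5)" using B bump_grad_bounded[OF r(1)] by (intro mult_mono) auto
        finally show ?thesis by (simp add: abs_mult mult_left_mono)
      qed
    qed
    \<comment> \<open>The definition of the weak gradient, componentwise, with the bump centred at \<open>z\<close>.\<close>
    have inner: "(LINT y|?M. ?f1 y z) = (LINT y|?M. ?f2 y z)" for z
    proof (cases "?v z = 0")
      case False
      have \<phi>: "bump r z \<in> test_functions (domain G)" by (rule bump_test_function[OF r(1) r0(2)[OF False r(2)]])
      have wk: "(LINT y|?M. \<Phi> y * bump_grad r z y $ i) = - (LINT y|?M. g y $ i * bump r z y)" for i
        using g \<phi> unfolding is_weak_grad_def gradient_bump[symmetric] by blast
      have gi: "integrable ?M (\<lambda>y. g y $ i * bump r z y)" for i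
      proof -
        have "continuous_on UNIV (\<lambda>y. bump r z y *\<^sub>R (axis i 1 :: real^'d))"
          by (intro continuous_intros smooth_expr_continuous[OF smooth_expr_bump])
        from L2_imp_integrable_inner[OF gL2 continuous_imp_L2_domain[OF this]]
        have "integrable ?M (\<lambda>y. g y \<bullet> (bump r z y *\<^sub>R axis i 1))" .
        then show ?thesis by (simp add: inner_axis mult.commute)
      qed
      have \<Phi>i: "integrable ?M (\<lambda>y. \<Phi> y * bump_grad r z y $ i)" for i
      proof -
        have "continuous_on UNIV (\<lambda>y. bump_grad r z y $ i)" using continuous_bump_grad by (intro continuous_intros)
        from L2_imp_integrable_inner[OF \<Phi> continuous_imp_L2_domain[OF this]] show ?thesis by simp
      qed
      have "(LINT y|?M. ?f1 y z) = (LINT y|?M. (\<Sum>i\<in>UNIV. ?v z $ i * (g y $ i * bump r z y)))"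
        by (simp add: inner_vec_def sum_distrib_left mult_ac bump_commute[of r _ z])
      also have "\<dots> = (\<Sum>i\<in>UNIV. ?v z $ i * (LINT y|?M. g y $ i * bump r z y))"
        using gi by simp
      also have "\<dots> = (\<Sum>i\<in>UNIV. ?v z $ i * - (LINT y|?M. \<Phi> y * bump_grad r z y $ i))"
        by (simp add: wk)
      also have "\<dots> = (LINT y|?M. (\<Sum>i\<in>UNIV. - (?v z $ i * (\<Phi> y * bump_grad r z y $ i))))"
        using \<Phi>i by simp
      also have "\<dots> = (LINT y|?M. ?f2 y z)"
        by (simp add: inner_vec_def sum_distrib_left mult_ac bump_grad_antisym[of r _ z] sum_negf)
      finally show ?thesis .
    qed simp
    have "(LINT y|?M. (LINT z|?M. ?f1 y z)) = (LINT z|?M. (LINT y|?M. ?f1 y z))"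
      using P.Fubini_integral[of ?f1] i1 by (simp add: case_prod_unfold)
    also have "\<dots> = (LINT z|?M. (LINT y|?M. ?f2 y z))" by (simp add: inner)
    also have "\<dots> = (LINT y|?M. (LINT z|?M. ?f2 y z))"
      using P.Fubini_integral[of ?f2] i2 by (simp add: case_prod_unfold)
    also have "\<dots> = (LINT y|?M. \<Phi> y * (LINT z|?M. ?v z \<bullet> bump_grad r y z))" by simp
    also have "\<dots> = 0"
      by (simp add: shrunk_weakly_divergence_free[OF dim div0 \<rho> p bump_has_derivative continuous_bump_grad])
    finally show ?thesis .
  qed
  \<comment> \<open>The mass of the kernels; near the boundary of the domain part of it may be cut off.\<close>
  define c where "c r = integral\<^sup>L lebesgue (bump r (0::real^'d))" for r
  have cpos: "0 < c r" if "0 < r" for r unfolding c_def by (rule bump_integral(3)[OF that])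
  have O: "domain G \<in> sets lebesgue" using open_domain by auto
  have bi: "integrable ?M (bump r y)" if "0 < r" for r y
    using integrable_mult_indicator[OF O bump_integral(1)[OF that, of y]] O by (simp add: integrable_restrict_space)
  have bc: "integral\<^sup>L ?M (bump r y) \<le> c r" if "0 < r" for r y
  proof -
    have "integral\<^sup>L ?M (bump r y) = (LINT x|lebesgue. indicator (domain G) x *\<^sub>R bump r y x)"
      using O by (simp add: integral_restrict_space)
    also have "\<dots> \<le> integral\<^sup>L lebesgue (bump r y)"
      using bump_integral(1)[OF that, of y] O bump_nonneg
      by (intro integral_mono integrable_mult_indicator) (auto simp: indicator_def)
    finally show ?thesis using bump_integral(2)[OF that, of y] by (simp add: c_def)
  qed
  have bceq: "integral\<^sup>L ?M (bump r y) = c r" if "0 < r" "ball y r \<subseteq> domain G" for r y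
  proof -
    have "integral\<^sup>L ?M (bump r y) = (LINT x|lebesgue. indicator (domain G) x *\<^sub>R bump r y x)"
      using O by (simp add: integral_restrict_space)
    also have "(\<lambda>x. indicator (domain G) x *\<^sub>R bump r y x) = bump r y"
      using bump_eq_0[OF that(1), of _ y] that(2) by (force simp: indicator_def)
    finally show ?thesis using bump_integral(2)[OF that(1), of y] by (simp add: c_def)
  qed
  have vb: "integrable ?M (\<lambda>z. (a \<bullet> ?v z) * bump r y z)" if "0 < r" for a r y
  proof (rule Bochner_Integration.integrable_bound)
    show "integrable ?M (\<lambda>z. norm a * B * bump r y z)" using bi[OF that] by simp
    show "(\<lambda>z. (a \<bullet> ?v z) * bump r y z) \<in> borel_measurable ?M"
      using bi[OF that, of y] vM by (intro borel_measurable_times borel_measurable_inner) auto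
    have "\<bar>a \<bullet> ?v z\<bar> \<le> norm a * B" for z
      by (rule order.trans[OF Cauchy_Schwarz_ineq2]) (intro mult_left_mono B norm_ge_zero)
    then show "AE z in ?M. norm ((a \<bullet> ?v z) * bump r y z) \<le> norm (norm a * B * bump r y z)"
      using B(1) bump_nonneg[of r y] by (intro AE_I2) (auto simp: abs_mult intro!: mult_right_mono)
  qed
  define R where "R n = r0 / real (Suc n)" for n
  have R: "0 < R n" "R n \<le> r0" for n using r0(1) by (auto simp: R_def field_simps)
  have Rlim: "R \<longlonglongrightarrow> 0" unfolding R_def[abs_def] by (rule LIMSEQ_Suc[OF lim_const_over_n])
  define H where "H n y = (1 / c (R n)) * (LINT z|?M. (g y \<bullet> ?v z) * bump (R n) y z)" for n y
  have H0: "integral\<^sup>L ?M (H n) = 0" for n unfolding H_def using mollified[OF R] by simp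
  have Hlim: "(\<lambda>n. H n y) \<longlonglongrightarrow> g y \<bullet> ?v y" if y: "y \<in> F ` smooth_points p \<rho>" for y
  proof (rule LIMSEQ_I)
    fix e :: real assume e: "0 < e"
    define e' where "e' = e / (2 * (norm (g y) + 1))"
    have ng1: "0 < norm (g y) + 1" using norm_ge_zero[of "g y"] by linarith
    have e': "0 < e'" using e ng1 by (simp add: e'_def)
    have O': "open (F ` smooth_points p \<rho>)" by (rule open_image_smooth_points)
    obtain d1 where d1: "0 < d1" "ball y d1 \<subseteq> F ` smooth_points p \<rho>" using O' y by (meson openE)
    have "isCont ?v y" using continuous_on_eq_continuous_at[OF O', THEN iffD1, OF continuous_shrunk] y by blast
    then obtain d2 where d2: "0 < d2" "\<And>z. dist z y < d2 \<Longrightarrow> dist (?v z) (?v y) < e'"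
      using e' unfolding continuous_at_eps_delta by metis
    have subD: "F ` smooth_points p \<rho> \<subseteq> domain G" using image_U_subset_domain by (auto simp: smooth_points_def)
    obtain N where N: "\<And>n. n \<ge> N \<Longrightarrow> R n < min d1 d2"
      using LIMSEQ_D[OF Rlim, of "min d1 d2"] d1(1) d2(1) R(1) by (auto simp: less_imp_le)
    have "norm (H n y - g y \<bullet> ?v y) < e" if n: "n \<ge> N" for n
    proof -
      let ?r = "R n"
      have Rd: "?r < d1" "?r < d2" using N[OF n] by auto
      have "ball y ?r \<subseteq> domain G" using d1(2) subD subset_ball[of ?r d1 y] Rd by fastforce
      then have cr: "integral\<^sup>L ?M (bump ?r y) = c ?r" by (rule bceq[OF R(1)])
      have "g y \<bullet> ?v y = (1 / c ?r) * (LINT z|?M. (g y \<bullet> ?v y) * bump ?r y z)"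
        using cpos[OF R(1)[of n]] cr by simp
      then have "H n y - g y \<bullet> ?v y = (1 / c ?r) * ((LINT z|?M. (g y \<bullet> ?v z) * bump ?r y z) - (LINT z|?M. (g y \<bullet> ?v y) * bump ?r y z))"
        by (simp add: H_def right_diff_distrib)
      also have "(LINT z|?M. (g y \<bullet> ?v z) * bump ?r y z) - (LINT z|?M. (g y \<bullet> ?v y) * bump ?r y z)
          = (LINT z|?M. (g y \<bullet> ?v z) * bump ?r y z - (g y \<bullet> ?v y) * bump ?r y z)"
        using vb[OF R(1)] bi[OF R(1)] by (intro Bochner_Integration.integral_diff[symmetric]) auto
      finally have eq: "H n y - g y \<bullet> ?v y = (1 / c ?r) * (LINT z|?M. (g y \<bullet> ?v z) * bump ?r y z - (g y \<bullet> ?v y) * bump ?r y z)" .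
      have "norm (LINT z|?M. (g y \<bullet> ?v z) * bump ?r y z - (g y \<bullet> ?v y) * bump ?r y z) \<le> (LINT z|?M. norm (g y) * e' * bump ?r y z)"
      proof (rule Bochner_Integration.integral_norm_bound_integral)
        show "integrable ?M (\<lambda>z. (g y \<bullet> ?v z) * bump ?r y z - (g y \<bullet> ?v y) * bump ?r y z)"
          using vb[OF R(1)] bi[OF R(1)] by (intro Bochner_Integration.integrable_diff) auto
        show "integrable ?M (\<lambda>z. norm (g y) * e' * bump ?r y z)" using bi[OF R(1)] by simp
        show "norm ((g y \<bullet> ?v z) * bump ?r y z - (g y \<bullet> ?v y) * bump ?r y z) \<le> norm (g y) * e' * bump ?r y z" for z
        proof (cases "z \<in> ball y ?r")
          case True
          then have "norm (?v z - ?v y) \<le> e'" using d2(2)[of z] Rd by (simp add: dist_norm norm_minus_commute less_imp_le)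
          then have "\<bar>g y \<bullet> (?v z - ?v y)\<bar> \<le> norm (g y) * e'"
            by (intro order.trans[OF Cauchy_Schwarz_ineq2] mult_left_mono) auto
          moreover have "(g y \<bullet> ?v z) * bump ?r y z - (g y \<bullet> ?v y) * bump ?r y z = (g y \<bullet> (?v z - ?v y)) * bump ?r y z"
            by (simp add: inner_diff_right left_diff_distrib)
          ultimately show ?thesis using bump_nonneg[of ?r y z] by (simp add: abs_mult mult_right_mono)
        next
          case False
          then show ?thesis using bump_eq_0[OF R(1) False] by simp
        qed
      qed
      also have "\<dots> = norm (g y) * e' * c ?r" using cr by simp
      finally have "norm (H n y - g y \<bullet> ?v y) \<le> (1 / c ?r) * (norm (g y) * e' * c ?r)"
        unfolding eq using cpos[OF R(1)[of n]] by (simp add: abs_mult pos_divide_le_eq)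
      also have "\<dots> = norm (g y) * e'" using cpos[OF R(1)[of n]] by simp
      also have "\<dots> \<le> (norm (g y) + 1) * e'" using e' by simp
      also have "\<dots> = e / 2"
      proof -
        have "a * (e / (2 * a)) = e / 2" if "0 < a" for a using that by (simp add: field_simps)
        from this[OF ng1] show ?thesis unfolding e'_def .
      qed
      also have "\<dots> < e" using e by simp
      finally show ?thesis .
    qed
    then show "\<exists>no. \<forall>n\<ge>no. norm (H n y - g y \<bullet> ?v y) < e" by blast
  qed
  have Hbd: "norm (H n y) \<le> norm (g y) * B" for n y
  proof -
    have "norm (LINT z|?M. (g y \<bullet> ?v z) * bump (R n) y z) \<le> (LINT z|?M. norm (g y) * B * bump (R n) y z)"
    proof (rule Bochner_Integration.integral_norm_bound_integral)
      show "integrable ?M (\<lambda>z. (g y \<bullet> ?v z) * bump (R n) y z)" by (rule vb[OF R(1)])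
      show "integrable ?M (\<lambda>z. norm (g y) * B * bump (R n) y z)" using bi[OF R(1)] by simp
      have "\<bar>g y \<bullet> ?v z\<bar> \<le> norm (g y) * B" for z
        by (rule order.trans[OF Cauchy_Schwarz_ineq2]) (intro mult_left_mono B norm_ge_zero)
      then show "norm ((g y \<bullet> ?v z) * bump (R n) y z) \<le> norm (g y) * B * bump (R n) y z" for z
        using bump_nonneg[of "R n" y z] by (simp add: abs_mult mult_right_mono)
    qed
    also have "\<dots> = norm (g y) * B * integral\<^sup>L ?M (bump (R n) y)" by simp
    also have "\<dots> \<le> norm (g y) * B * c (R n)" using bc[OF R(1)] B(1) by (intro mult_left_mono) auto
    finally have "norm (H n y) \<le> (1 / c (R n)) * (norm (g y) * B * c (R n))"
      unfolding H_def using cpos[OF R(1)[of n]] by (simp add: abs_mult pos_divide_le_eq)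
    then show ?thesis using cpos[OF R(1)[of n]] by simp
  qed
  have Hm: "H n \<in> borel_measurable ?M" for n
  proof -
    have "(\<lambda>q. (g (fst q) \<bullet> ?v (snd q)) * bump (R n) (fst q) (snd q)) \<in> borel_measurable (?M \<Otimes>\<^sub>M ?M)"
      by (intro borel_measurable_times borel_measurable_inner fstm sndm gM vM measurable_compose[OF idm bump_measurable])
    then have "(\<lambda>y. LINT z|?M. (g y \<bullet> ?v z) * bump (R n) y z) \<in> borel_measurable ?M"
      by (intro M.borel_measurable_lebesgue_integral) (simp add: case_prod_unfold)
    then show ?thesis unfolding H_def[abs_def] by (intro borel_measurable_times borel_measurable_const)
  qed
  have "(\<lambda>n. integral\<^sup>L ?M (H n)) \<longlonglongrightarrow> (LINT y|?M. g y \<bullet> ?v y)"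
  proof (rule integral_dominated_convergence)
    show "(\<lambda>y. g y \<bullet> ?v y) \<in> borel_measurable ?M" using gM vM by (rule borel_measurable_inner)
    show "H n \<in> borel_measurable ?M" for n by (rule Hm)
    show "integrable ?M (\<lambda>y. norm (g y) * B)" using ng by simp
    show "AE y in ?M. (\<lambda>n. H n y) \<longlonglongrightarrow> g y \<bullet> ?v y"
      using AE_domain_smooth_points[OF \<rho>(1)] by (rule AE_mp) (intro AE_I2 impI Hlim)
    show "AE y in ?M. norm (H n y) \<le> norm (g y) * B" for n using Hbd by (intro AE_I2)
  qed
  then show ?thesis by (simp add: H0 LIMSEQ_const_iff)
qed

end

section \<open>Piola coefficients of discrete velocities\<close>

context mesh begin

text \<open>
  The components of the pullback have regularity $\alpha$ in their own direction and $\alpha - 1 \ge 0$ in the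
  others, so they are continuous splines after correction on the skeleton.
\<close>

lemma velocity_Piola_coefficients:
  assumes v: "v \<in> velocity_space G k \<alpha>" and \<alpha>: "\<And>i l. 1 \<le> \<alpha> i l"
  obtains S where "\<And>i. piecewise_C1 (\<lambda>x. S x $ i)"
    and "\<And>x. x \<in> U \<Longrightarrow> v (F x) = (1 / det (J x)) *\<^sub>R (J x *v S x)"
proof -
  have "\<exists>S. piecewise_C1 S \<and> (\<forall>c\<in>cells G. \<forall>x\<in>ref_cell G c. piola_pullback G c v x $ i = S x)" for i
  proof -
    obtain s where s: "s \<in> tensor_spline_space G (\<lambda>j. if j = i then k j else k j - 1)
            (\<lambda>j l. if j = i then \<alpha> j l else \<alpha> j l - 1)"
      "\<forall>c\<in>cells G. \<forall>x\<in>ref_cell G c. piola_pullback G c v x $ i = s x"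
      using v unfolding velocity_space_def by blast
    have "0 \<le> (if j = i then \<alpha> j l else \<alpha> j l - 1)" for j l using \<alpha>[of j l] \<alpha>[of i l] by auto
    then obtain S where S: "piecewise_C1 S" "\<And>x. x \<in> U \<Longrightarrow> S x = s x"
      using tensor_spline_piecewise_C1[OF s(1)] by blast
    have "piola_pullback G c v x $ i = S x" if "c \<in> cells G" "x \<in> ref_cell G c" for c x
    proof -
      have "x \<in> U" using that by blast
      then show ?thesis using s(2) S(2)[of x] that by simp
    qed
    then show ?thesis using S(1) by blast
  qed
  then obtain T where T: "\<And>i. piecewise_C1 (T i)" "\<And>i c x. c \<in> cells G \<Longrightarrow> x \<in> ref_cell G c \<Longrightarrow> piola_pullback G c v x $ i = T i x"
    by metis
  define S where "S x = (\<chi> i. T i x)" for x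
  have "v (F x) = (1 / det (J x)) *\<^sub>R (J x *v S x)" if x: "x \<in> U" for x
  proof -
    obtain c where c: "c \<in> cells G" "x \<in> ref_cell G c" using x by blast
    have "S x = det (J x) *\<^sub>R (matrix_inv (J x) *v v (F x))"
      using T(2)[OF c] jac_eq_J[OF c] by (simp add: S_def vec_eq_iff piola_pullback_def)
    then have "J x *v S x = det (J x) *\<^sub>R v (F x)"
      by (simp add: matrix_vector_mult_scaleR matrix_vector_mul_assoc matrix_inv_mult[OF det_J_nonzero[OF x]])
    then show ?thesis using det_J_nonzero[OF x] by simp
  qed
  moreover have "piecewise_C1 (\<lambda>x. S x $ i)" for i using T(1)[of i] by (simp add: S_def)
  ultimately show ?thesis using that by blast
qed

text \<open>
  The normal is parallel to $(DF)^{-T} e_i$, so that $v\cdot n$ is a multiple of the \<open>i\<close>-th component of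
  $(DF)^{-1} v$, that is, of \<open>S x $ i\<close>.
\<close>

lemma boundary_facet_normal_component_0:
  assumes dim: "CARD('d) = 2 \<or> CARD('d) = 3" and v: "v \<in> H1n G"
    and S: "\<And>i. piecewise_C1 (\<lambda>x. S x $ i)"
    and vS: "\<And>x. x \<in> U \<Longrightarrow> v (F x) = (1 / det (J x)) *\<^sub>R (J x *v S x)"
    and e: "(c, i, up) \<in> boundary_facets G" and x0: "x0 \<in> ref_facet G (c, i, up)"
  shows "S x0 $ i = 0"
proof -
  let ?C = "closed_ref_cell G c" and ?R = "ref_facet G (c, i, up)" and ?M = "facet_measure G (c, i, up)"
  have c: "c \<in> cells G" using e by (auto simp: boundary_facets_def)
  have Sc: "continuous_on K (\<lambda>x. S x $ j)" for j using S[of j] unfolding piecewise_C1_def by blast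
  have SC: "continuous_on ?C (\<lambda>x. S x $ j)" for j
    using Sc closed_ref_cell_subset_K[OF c] by (rule continuous_on_subset)
  have "continuous_on ?C (\<lambda>x. \<chi> j. S x $ j)" by (rule continuous_on_vec_lambda[OF SC])
  then have SCv: "continuous_on ?C S" by simp
  define V where "V x = (1 / det (jac G c x)) *\<^sub>R (jac G c x *v S x)" for x
  have Vc: "continuous_on ?C (\<lambda>x. V x $ j)" for j
    unfolding V_def matrix_vector_mult_def vector_scaleR_component vec_lambda_beta
    using continuous_jac[OF c] continuous_det_jac[OF c] det_jac_nonzero[OF c] SCv
    by (intro continuous_intros) auto
  have Vv: "V x $ j = v (F x) $ j" if "x \<in> ref_cell G c" for x j
  proof -
    have "x \<in> U" using that c by blast
    then show ?thesis using vS[of x] jac_eq_J[OF c that] by (simp add: V_def)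
  qed
  obtain g where g: "\<And>j. has_trace G (\<lambda>x. v x $ j) (\<lambda>x. g x $ j)"
    "\<And>e. e \<in> boundary_facets G \<Longrightarrow> AE x in facet_measure G e. g (F x) \<bullet> facet_normal G e x = 0"
    and vH: "\<And>j. (\<lambda>x. v x $ j) \<in> H1 (domain G)"
    using v unfolding H1n_def by blast
  have "AE x in ?M. g (F x) $ j = V x $ j" for j
    by (rule trace_eq_boundary_limit[OF dim e vH g(1) Vc Vv])
  then have "AE x in ?M. \<forall>j\<in>UNIV. g (F x) $ j = V x $ j"
    by (intro AE_finite_allI) auto
  then have "AE x in ?M. S x $ i = 0"
    using g(2)[OF e] AE_space
  proof eventually_elim
    case (elim x)
    then have x: "x \<in> ?C" using ref_facet_subset_closed[OF c] unfolding space_facet_measure by blast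
    have gV: "g (F x) = V x" using elim(1) by (simp add: vec_eq_iff)
    let ?A = "jac G c x" and ?s = "if up then 1 else - 1 :: real"
    have A: "det ?A \<noteq> 0" by (rule det_jac_nonzero[OF c x])
    let ?n = "transpose (matrix_inv ?A) *v axis i ?s"
    have "V x \<bullet> sgn ?n = 0" using elim(2) gV by simp
    then have "V x \<bullet> ?n = 0" by (auto simp: sgn_div_norm)
    then have "(matrix_inv ?A *v V x) \<bullet> axis i ?s = 0"
      by (simp add: transpose_matrix_vector inner_commute[of "V x"] dot_lmul_matrix inner_commute[of "axis i ?s"])
    moreover have "matrix_inv ?A *v V x = (1 / det ?A) *\<^sub>R S x"
      by (simp add: V_def matrix_vector_mult_scaleR matrix_vector_mul_assoc matrix_inv_mult[OF A])
    ultimately show ?case using A by (simp add: inner_axis split: if_splits)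
  qed
  then show ?thesis
    by (rule AE_facet_measure_continuous_0[OF c continuous_on_subset[OF SC ref_facet_subset_closed[OF c]] _ x0])
qed

text \<open>
  Every point of a closed face of the box is a limit of points of an open facet.
\<close>

lemma normal_component_0:
  assumes dim: "CARD('d) = 2 \<or> CARD('d) = 3" and v: "v \<in> H1n G"
    and S: "\<And>i. piecewise_C1 (\<lambda>x. S x $ i)"
    and vS: "\<And>x. x \<in> U \<Longrightarrow> v (F x) = (1 / det (J x)) *\<^sub>R (J x *v S x)"
    and x: "x \<in> K" and xi: "x $ i = knot G i 1 \<or> x $ i = knot G i (num_knots G i)"
  shows "S x $ i = 0"
proof -
  define up where "up \<longleftrightarrow> x $ i \<noteq> knot G i 1"
  obtain c0 where c0: "c0 \<in> cells G" "x \<in> closed_ref_cell G c0" using K_cell[OF x] .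
  \<comment> \<open>A cell that contains \<open>x\<close> in its closure and touches the face.\<close>
  define c where "c = c0(i := if up then num_knots G i - 1 else 1)"
  have n2: "2 \<le> num_knots G i" by (rule num_knots_ge_2)
  have c: "c \<in> cells G" using c0(1) n2 by (auto simp: c_def cells_def)
  have e: "(c, i, up) \<in> boundary_facets G" using c n2 by (auto simp: boundary_facets_def c_def)
  have fc: "facet_coord G (c, i, up) = x $ i" using xi n2 by (auto simp: c_def up_def)
  define mid where "mid = (\<chi> j. if j = i then x $ i else (knot G j (c j) + knot G j (Suc (c j))) / 2)"
  have yR: "x + s *\<^sub>R (mid - x) \<in> ref_facet G (c, i, up)" if s: "0 < s" "s \<le> 1" for s
    unfolding mem_ref_facet fc
  proof (rule conjI, goal_cases)
    case 1
    show ?case by (simp add: mid_def)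
  next
    case 2
    show ?case
    proof (rule allI, rule impI)
      fix j assume j: "j \<noteq> i"
      let ?a = "knot G j (c j)" and ?b = "knot G j (Suc (c j))"
      have ab: "?a < ?b" by (rule cell_knots(3)[OF c])
      have xj: "?a \<le> x $ j" "x $ j \<le> ?b" using c0(2) j by (auto simp: mem_closed_ref_cell c_def)
      have y: "(x + s *\<^sub>R (mid - x)) $ j = (1 - s) * x $ j + s * ((?a + ?b) / 2)"
        using j by (simp add: mid_def algebra_simps)
      have "(1 - s) * ?a \<le> (1 - s) * x $ j" "(1 - s) * x $ j \<le> (1 - s) * ?b" "s * ?a < s * ((?a + ?b) / 2)" "s * ((?a + ?b) / 2) < s * ?b"
        using s xj ab by (auto intro: mult_left_mono)
      moreover have "(1 - s) * ?a + s * ?a = ?a" "(1 - s) * ?b + s * ?b = ?b"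
        by (simp_all add: left_diff_distrib)
      ultimately show "?a < (x + s *\<^sub>R (mid - x)) $ j \<and> (x + s *\<^sub>R (mid - x)) $ j < ?b"
        unfolding y by linarith
    qed
  qed
  define y where "y n = x + (1 / real (Suc n)) *\<^sub>R (mid - x)" for n
  have yR': "y n \<in> ref_facet G (c, i, up)" for n unfolding y_def by (rule yR) auto
  have yK: "y n \<in> K" for n using yR' ref_facet_subset_closed[OF c] closed_ref_cell_subset_K[OF c] by blast
  have "(\<lambda>n. 1 / real (Suc n)) \<longlonglongrightarrow> 0" by (rule LIMSEQ_Suc[OF lim_1_over_n])
  then have "(\<lambda>n. x + (1 / real (Suc n)) *\<^sub>R (mid - x)) \<longlonglongrightarrow> x + 0 *\<^sub>R (mid - x)"
    by (intro tendsto_intros)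
  then have "y \<longlonglongrightarrow> x" unfolding y_def[abs_def] by simp
  moreover have "continuous_on K (\<lambda>x. S x $ i)" using S[of i] unfolding piecewise_C1_def by blast
  ultimately have "(\<lambda>n. S (y n) $ i) \<longlonglongrightarrow> S x $ i"
    using x yK unfolding continuous_on_sequentially by (auto simp: o_def)
  moreover have "S (y n) $ i = 0" for n
    by (rule boundary_facet_normal_component_0[OF dim v S vS e yR'])
  ultimately show ?thesis by (simp add: LIMSEQ_const_iff)
qed

end

context mesh_field begin

lemma zoom_1: "zoom p 1 x = x"
  by (simp add: zoom_def)

lemma Z_eq_S: "x \<in> U \<Longrightarrow> Z x = S x"
  using U_subset_K by (auto simp: Z_def)

text \<open>
  If the divergence of \<open>S\<close> had a sign at some point, it would keep it in a neighbourhood. The weak equation tested with a bump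
  around the image of this point, pulled back and integrated by parts, then says that a nonnegative function
  that is positive near the point has integral $0$.
\<close>

lemma weakly_divergence_free_imp_divS_0:
  assumes dim: "CARD('d) = 2 \<or> CARD('d) = 3"
    and vS: "\<And>x. x \<in> U \<Longrightarrow> v (F x) = (1 / det (J x)) *\<^sub>R (J x *v S x)"
    and vH: "\<And>j. (\<lambda>x. v x $ j) \<in> H1 (domain G)"
    and div: "AE y in lebesgue_on (domain G). weak_div (domain G) v y = 0"
  shows "divS x0 = 0"
proof (rule ccontr)
  let ?M = "lebesgue_on (domain G)"
  assume ne: "divS x0 \<noteq> 0"
  then have x0: "x0 \<in> U" by (auto simp: divS_def split: if_splits)
  have dc: "continuous_on U divS"
  proof -
    have "continuous_on U (\<lambda>x. \<Sum>i\<in>UNIV. frechet_derivative (\<lambda>x. S x $ i) (at x) (axis i 1))"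
      by (intro continuous_on_sum piecewise_C1_continuous_partial S_piecewise_C1)
    then show ?thesis by (rule continuous_on_eq) (simp add: divS_def)
  qed
  define N where "N = U \<inter> (\<lambda>x. divS x * divS x0) -` {0<..}"
  have oN: "open N" unfolding N_def
    by (rule continuous_open_preimage) (intro continuous_intros dc open_U open_greaterThan)+
  have x0N: "x0 \<in> N" 
  proof -
    have "0 < divS x0 * divS x0" using ne by (metis not_real_square_gt_zero)
    then show ?thesis using x0 by (simp add: N_def)
  qed
  have NK: "N \<subseteq> K" using U_subset_K by (auto simp: N_def)
  have "open (F ` N)"
    by (intro invariance_of_domain continuous_on_subset[OF continuous_param NK] inj_on_subset[OF inj_param NK] oN)
  then obtain r where r: "0 < r" "cball (F x0) r \<subseteq> F ` N" using x0N by (meson open_contains_cball imageI)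
  have ND: "F ` N \<subseteq> domain G" using image_U_subset_domain by (auto simp: N_def)
  let ?\<phi> = "bump r (F x0)" and ?d = "bump_grad r (F x0)"
  have \<phi>: "?\<phi> \<in> test_functions (domain G)" by (rule bump_test_function[OF r(1) order.trans[OF r(2) ND]])
  have vL2: "(\<lambda>x. v x $ j) \<in> L2 ?M" for j using vH[of j] by (simp add: H1_def)
  let ?W = "\<lambda>j. weak_grad (domain G) (\<lambda>x. v x $ j)"
  have W: "is_weak_grad (domain G) (\<lambda>x. v x $ j) (?W j)" for j by (rule H1_weak_grad[OF vH])
  have c\<phi>: "continuous_on UNIV ?\<phi>" by (rule smooth_expr_continuous[OF smooth_expr_bump])
  have i1: "integrable ?M (\<lambda>y. v y $ j * ?d y $ j)" for j
  proof -
    have "continuous_on UNIV (\<lambda>y. ?d y $ j)" using continuous_bump_grad by (intro continuous_intros)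
    from L2_imp_integrable_inner[OF vL2 continuous_imp_L2_domain[OF this]] show ?thesis by simp
  qed
  have i2: "integrable ?M (\<lambda>y. ?W j y $ j * ?\<phi> y)" for j
  proof -
    have "continuous_on UNIV (\<lambda>y. ?\<phi> y *\<^sub>R (axis j 1 :: real^'d))" by (intro continuous_intros c\<phi>)
    moreover have "?W j \<in> L2 ?M" using W by (simp add: is_weak_grad_def)
    ultimately have "integrable ?M (\<lambda>y. ?W j y \<bullet> (?\<phi> y *\<^sub>R axis j 1))"
      using L2_imp_integrable_inner continuous_imp_L2_domain by blast
    then show ?thesis by (simp add: inner_axis mult.commute)
  qed
  have wk: "(LINT y|?M. v y $ j * ?d y $ j) = - (LINT y|?M. ?W j y $ j * ?\<phi> y)" for j
    using W[of j] \<phi> unfolding is_weak_grad_def gradient_bump[symmetric] by blast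
  have "(LINT y|?M. v y \<bullet> ?d y) = (\<Sum>j\<in>UNIV. LINT y|?M. v y $ j * ?d y $ j)"
    using i1 by (simp add: inner_vec_def)
  also have "\<dots> = - (\<Sum>j\<in>UNIV. LINT y|?M. ?W j y $ j * ?\<phi> y)"
    unfolding wk by (rule sum_negf)
  also have "(\<Sum>j\<in>UNIV. LINT y|?M. ?W j y $ j * ?\<phi> y) = (LINT y|?M. (\<Sum>j\<in>UNIV. ?W j y $ j * ?\<phi> y))"
    using i2 by simp
  also have "\<dots> = (LINT y|?M. weak_div (domain G) v y * ?\<phi> y)"
    by (simp add: weak_div_def weak_vgrad_def sum_distrib_right)
  also have "\<dots> = 0"
  proof (rule integral_eq_zero_AE)
    show "AE y in ?M. weak_div (domain G) v y * ?\<phi> y = 0" using div by eventually_elim simp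
  qed
  finally have v0: "(LINT y|?M. v y \<bullet> ?d y) = 0" by simp
  have vi: "integrable ?M (\<lambda>y. v y \<bullet> ?d y)" using i1 by (simp add: inner_vec_def)
  obtain \<sigma> where \<sigma>: "\<sigma> = 1 \<or> \<sigma> = - 1" "\<And>c x. c \<in> cells G \<Longrightarrow> x \<in> closed_ref_cell G c \<Longrightarrow> sgn (det (jac G c x)) = \<sigma>"
    using det_jac_sign by metis
  have vZ: "v (F x) = (1 / det (J x)) *\<^sub>R (J x *v Z x)" if "x \<in> U" for x using vS[OF that] Z_eq_S[OF that] by simp
  have Zi: "integrable lebesgue (\<lambda>x. Z x \<bullet> pull_grad ?d x)" using push_pull(1)[OF dim \<sigma> vZ] vi by blast
  have Z0: "(LINT x|lebesgue. Z x \<bullet> pull_grad ?d x) = 0" using push_pull(2)[OF dim \<sigma> vZ, where d = ?d] v0 \<sigma>(1) by auto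
  have x0K: "x0 \<in> K" using x0 U_subset_K by blast
  note dt = divergence_theorem_zoomed[of 1, OF zero_less_one order_refl x0K bump_has_derivative[of r "F x0"] continuous_bump_grad, unfolded zoom_1]
  let ?g = "\<lambda>x. divS x * pull ?\<phi> x"
  have gi: "integrable lebesgue ?g" using Bochner_Integration.integrable_diff[OF dt(1) Zi] by simp
  have g0: "integral\<^sup>L lebesgue ?g = 0"
    using Bochner_Integration.integral_diff[OF dt(1) Zi] dt(2) Z0 by simp
  have xN: "x \<in> N" if "pull ?\<phi> x \<noteq> 0" for x
  proof -
    have x: "x \<in> K" "?\<phi> (F x) \<noteq> 0" using that by (auto simp: pull_def split: if_splits)
    then have "F x \<in> cball (F x0) r" using bump_eq_0[OF r(1), of "F x" "F x0"] ball_subset_cball by blast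
    then have "F x \<in> F ` N" using r(2) by blast
    then show ?thesis using x(1) NK inj_param by (meson inj_on_image_mem_iff)
  qed
  have nn: "0 \<le> ?g x * divS x0" for x
  proof (cases "pull ?\<phi> x = 0")
    case False
    then have "0 < divS x * divS x0" using xN by (simp add: N_def)
    moreover have "0 \<le> pull ?\<phi> x" by (simp add: pull_def bump_nonneg)
    ultimately have "0 \<le> (divS x * divS x0) * pull ?\<phi> x" by simp
    then show ?thesis by (simp add: mult_ac)
  qed simp
  have "integral\<^sup>L lebesgue (\<lambda>x. ?g x * divS x0) = 0" using g0 by simp
  moreover have "integrable lebesgue (\<lambda>x. ?g x * divS x0)" using gi by simp
  ultimately have ae: "AE x in lebesgue. ?g x * divS x0 = 0"
    using integral_nonneg_eq_0_iff_AE[of lebesgue "\<lambda>x. ?g x * divS x0"] nn by blast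
  have oP: "open (N \<inter> F -` ball (F x0) r)"
    by (rule continuous_open_preimage[OF continuous_on_subset[OF continuous_param NK] oN open_ball])
  have "?g x * divS x0 \<noteq> 0" if "x \<in> N \<inter> F -` ball (F x0) r" for x
  proof -
    have "divS x * divS x0 \<noteq> 0" using that by (auto simp: N_def)
    moreover have "0 < ?\<phi> (F x)" using that bump_pos_iff[OF r(1)] by auto
    moreover have "x \<in> K" using that NK by blast
    ultimately show ?thesis by (auto simp: pull_def)
  qed
  then have "AE x in lebesgue. x \<notin> N \<inter> F -` ball (F x0) r"
    using ae by (elim AE_mp) (intro AE_I2, blast)
  then have "negligible (N \<inter> F -` ball (F x0) r)"
    unfolding negligible_iff_null_sets
    using AE_iff_null_sets[of "N \<inter> F -` ball (F x0) r" lebesgue] oP by auto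
  moreover have "x0 \<in> N \<inter> F -` ball (F x0) r" using x0N r(1) by simp
  ultimately show False using open_not_negligible[OF oP] by blast
qed

end

section \<open>Orthogonality of gradients and divergence-free velocities\<close>

context mesh_field begin

lemma AE_domain_image_U: "AE y in lebesgue_on (domain G). y \<in> F ` U"
proof -
  have "domain G - F ` U \<in> null_sets lebesgue"
    using negligible_domain_minus by (simp only: negligible_iff_null_sets)
  then have "AE y in lebesgue. y \<in> domain G \<longrightarrow> y \<in> F ` U"
    by (rule AE_I') auto
  then show ?thesis using open_domain by (subst AE_restrict_space_iff) auto
qed

lemma shrunk_tendsto:
  assumes \<rho>: "\<rho> \<longlonglongrightarrow> 1" and x: "x \<in> U"
  shows "(\<lambda>n. shrunk p (\<rho> n) (F x)) \<longlonglongrightarrow> (1 / det (J x)) *\<^sub>R (J x *v S x)"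
proof -
  have xb: "x \<in> K\<^sub>o" using x U_subset_box by blast
  have "(\<lambda>n. zoom p (\<rho> n) x) \<longlonglongrightarrow> p + (1 / 1) *\<^sub>R (x - p)"
    unfolding zoom_def using \<rho> by (intro tendsto_intros) auto
  then have zl: "(\<lambda>n. zoom p (\<rho> n) x) \<longlonglongrightarrow> x" by simp
  have "isCont Z x"
  proof -
    have "continuous_on (K\<^sub>o) Z"
      using continuous_on_subset[OF continuous_S box_subset_cbox] by (rule continuous_on_eq) (use box_subset_cbox in \<open>auto simp: Z_def\<close>)
    then show ?thesis using continuous_on_eq_continuous_at[OF open_box] xb by blast
  qed
  from isCont_tendsto_compose[OF this zl] have Zl: "(\<lambda>n. Z (zoom p (\<rho> n) x)) \<longlonglongrightarrow> S x"
    using Z_eq_S[OF x] by simp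
  have "(\<lambda>n. J x *v Z (zoom p (\<rho> n) x)) \<longlonglongrightarrow> J x *v S x"
    by (rule bounded_linear.tendsto[OF matrix_vector_mul_bounded_linear Zl])
  then show ?thesis unfolding shrunk_param[OF x] by (intro tendsto_intros)
qed

text \<open>
  The contracted velocities converge to \<open>v\<close> pointwise as \<open>\<rho>\<close> tends to $1$, because \<open>S\<close> is continuous.
\<close>

lemma gradient_orthogonal:
  assumes dim: "CARD('d) = 2 \<or> CARD('d) = 3"
    and vS: "\<And>x. x \<in> U \<Longrightarrow> v (F x) = (1 / det (J x)) *\<^sub>R (J x *v S x)"
    and vH: "\<And>j. (\<lambda>x. v x $ j) \<in> H1 (domain G)"
    and div: "AE y in lebesgue_on (domain G). weak_div (domain G) v y = 0"
    and \<Phi>: "\<Phi> \<in> L2 (lebesgue_on (domain G))" and g: "is_weak_grad (domain G) \<Phi> g"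
  shows "(LINT y|lebesgue_on (domain G). g y \<bullet> v y) = 0"
proof -
  let ?M = "lebesgue_on (domain G)"
  interpret M: finite_measure ?M by (rule finite_measure_domain)
  have div0: "divS x = 0" for x by (rule weakly_divergence_free_imp_divS_0[OF dim vS vH div])
  define p where "p = (1 / 2) *\<^sub>R (first_corner G + last_corner G)"
  have p: "p \<in> K\<^sub>o"
    unfolding mem_box_K
  proof
    fix i
    have "knot G i 1 < knot G i (num_knots G i)" using knot_less[of 1 "num_knots G i" i] num_knots_ge_2[of i] by simp
    then show "knot G i 1 < p $ i \<and> p $ i < knot G i (num_knots G i)"
      by (simp add: p_def first_corner_def last_corner_def)
  qed
  define \<rho> where "\<rho> n = 1 - 1 / real (Suc (Suc n))" for n
  have \<rho>: "0 < \<rho> n" "\<rho> n < 1" for n by (auto simp: \<rho>_def)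
  have "(\<lambda>n. 1 / real (Suc (Suc n))) \<longlonglongrightarrow> 0" by (intro LIMSEQ_Suc lim_1_over_n)
  then have "\<rho> \<longlonglongrightarrow> 1 - 0" unfolding \<rho>_def[abs_def] by (intro tendsto_intros)
  then have \<rho>1: "\<rho> \<longlonglongrightarrow> 1" by simp
  obtain B where B: "0 \<le> B" "\<And>p \<rho> y. norm (shrunk p \<rho> y) \<le> B" using pushed_bounded unfolding shrunk_def by metis
  have gL2: "g \<in> L2 ?M" using g by (simp add: is_weak_grad_def)
  then have gM: "g \<in> borel_measurable ?M" by (simp add: L2_def)
  have sM: "shrunk p r \<in> borel_measurable ?M" for r
    using borel_measurable_shrunk by (intro measurable_restrict_space1 measurable_completion) simp
  have vM: "v \<in> borel_measurable ?M"
  proof -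
    have "(\<lambda>x. v x $ j) \<in> borel_measurable ?M" for j using vH[of j] by (simp add: H1_def L2_def)
    then show ?thesis by (subst borel_measurable_euclidean_space) (auto simp: Basis_vec_def inner_axis)
  qed
  have ng: "integrable ?M (\<lambda>y. norm (g y))"
  proof -
    have "(\<lambda>y. norm (g y)) \<in> L2 ?M" using gL2 by (auto simp: L2_def)
    moreover have "(\<lambda>_. 1 :: real) \<in> L2 ?M" by (simp add: L2_def)
    ultimately have "integrable ?M (\<lambda>y. norm (g y) \<bullet> 1)" by (rule L2_imp_integrable_inner)
    then show ?thesis by simp
  qed
  have "(\<lambda>n. LINT y|?M. g y \<bullet> shrunk p (\<rho> n) y) \<longlonglongrightarrow> (LINT y|?M. g y \<bullet> v y)"
  proof (rule integral_dominated_convergence)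
    show "(\<lambda>y. g y \<bullet> v y) \<in> borel_measurable ?M" using gM vM by (rule borel_measurable_inner)
    show "(\<lambda>y. g y \<bullet> shrunk p (\<rho> n) y) \<in> borel_measurable ?M" for n using gM sM by (rule borel_measurable_inner)
    show "integrable ?M (\<lambda>y. norm (g y) * B)" using ng by simp
    show "AE y in ?M. (\<lambda>n. g y \<bullet> shrunk p (\<rho> n) y) \<longlonglongrightarrow> g y \<bullet> v y"
      using AE_domain_image_U
    proof eventually_elim
      case (elim y)
      then obtain x where x: "x \<in> U" "y = F x" by blast
      have "(\<lambda>n. shrunk p (\<rho> n) y) \<longlonglongrightarrow> v y"
        using shrunk_tendsto[OF \<rho>1 x(1), of p] vS[OF x(1)] x(2) by simp
      then show ?case by (intro tendsto_intros)
    qed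
    show "AE y in ?M. norm (g y \<bullet> shrunk p (\<rho> n) y) \<le> norm (g y) * B" for n
      unfolding real_norm_def
      by (intro AE_I2 order.trans[OF Cauchy_Schwarz_ineq2] mult_left_mono B norm_ge_zero)
  qed
  then show ?thesis
    using gradient_orthogonal_shrunk[OF dim div0 \<rho> p \<Phi> g] by (simp add: LIMSEQ_const_iff)
qed

end

context mesh begin

theorem weak_gradient_orthogonal_divfree_velocity:
  assumes dim: "CARD('d) = 2 \<or> CARD('d) = 3"
    and v: "v \<in> divfree_velocity_space G k' \<alpha>'" and \<Phi>: "\<Phi> \<in> H1 (domain G)"
  shows "L2_inner (lebesgue_on (domain G)) (weak_grad (domain G) \<Phi>) v = 0"
proof -
  have vv: "v \<in> velocity_space G (\<lambda>_. k' + 1) (\<lambda>_ _. int \<alpha>' + 1)"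
    and div: "AE x in lebesgue_on (domain G). weak_div (domain G) v x = 0"
    using v by (auto simp: divfree_velocity_space_def)
  obtain S where S: "\<And>i. piecewise_C1 (\<lambda>x. S x $ i)"
    and vS: "\<And>x. x \<in> U \<Longrightarrow> v (F x) = (1 / det (J x)) *\<^sub>R (J x *v S x)"
    by (rule velocity_Piola_coefficients[OF vv]) auto
  have vn: "v \<in> H1n G" using vv by (simp add: velocity_space_def)
  interpret mesh_field G m S
  proof
    show "piecewise_C1 (\<lambda>x. S x $ i)" for i by (rule S)
    show "S x $ i = 0" if "x \<in> K" "x $ i = knot G i 1 \<or> x $ i = knot G i (num_knots G i)" for x i
      by (rule normal_component_0[OF dim vn S vS that])
  qed
  have vH: "(\<lambda>x. v x $ j) \<in> H1 (domain G)" for j using vn by (simp add: H1n_def)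
  have \<Phi>L2: "\<Phi> \<in> L2 (lebesgue_on (domain G))" using \<Phi> by (simp add: H1_def)
  show ?thesis
    unfolding L2_inner_def by (rule gradient_orthogonal[OF dim vS vH div \<Phi>L2 H1_weak_grad[OF \<Phi>]])
qed

end

lemma L2_inner_add_left:
  assumes "f \<in> L2 M" "g \<in> L2 M" "v \<in> L2 M"
  shows "L2_inner M (\<lambda>x. f x + g x) v = L2_inner M f v + L2_inner M g v"
  using L2_imp_integrable_inner[OF assms(1,3)] L2_imp_integrable_inner[OF assms(2,3)]
  by (simp add: L2_inner_def inner_add_left)

lemma H1n_L2:
  assumes "v \<in> H1n G"
  shows "v \<in> L2 (lebesgue_on (domain G))"
proof -
  have c: "(\<lambda>x. v x $ j) \<in> L2 (lebesgue_on (domain G))" for j using assms by (simp add: H1n_def H1_def)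
  then have "v \<in> borel_measurable (lebesgue_on (domain G))"
    by (subst borel_measurable_euclidean_space) (auto simp: Basis_vec_def inner_axis L2_def)
  moreover have "integrable (lebesgue_on (domain G)) (\<lambda>x. \<Sum>j\<in>UNIV. (norm (v x $ j))\<^sup>2)"
    using c by (intro Bochner_Integration.integrable_sum) (simp add: L2_def)
  ultimately show ?thesis
    by (simp add: L2_def norm_vec_def L2_set_def sum_nonneg)
qed

theorem theorem1:
  fixes G :: "('d::finite) patch"
    and k' \<alpha>' :: nat
    and \<rho> \<nu> C\<^sub>N \<gamma> T :: real
    and f :: "real \<Rightarrow> real^'d \<Rightarrow> real^'d"
    and \<Phi> :: "real \<Rightarrow> real^'d \<Rightarrow> real"
    and u0 :: "real^'d \<Rightarrow> real^'d"
    and u :: "real \<Rightarrow> real^'d \<Rightarrow> real^'d"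
  assumes "CARD('d) = 2 \<or> CARD('d) = 3"
    and "1 \<le> k'"
    and "regular_patch (\<alpha>' + 2) G"
    and "quasi_uniform \<rho> G"
    and "0 < \<nu>" and "0 < C\<^sub>N" and "0 \<le> \<gamma>" and "0 < T"
    and "\<And>t. t \<in> {0<..T} \<Longrightarrow> f t \<in> L2 (lebesgue_on (domain G))"
    and "\<And>t. t \<in> {0<..T} \<Longrightarrow> \<Phi> t \<in> H1 (domain G)"
  shows "semidiscrete_solution G k' \<alpha>' \<nu> C\<^sub>N \<gamma> T f u0 u \<longleftrightarrow>
         semidiscrete_solution G k' \<alpha>' \<nu> C\<^sub>N \<gamma> T (\<lambda>t x. f t x + weak_grad (domain G) (\<Phi> t) x) u0 u"
proof -
  interpret mesh G "\<alpha>' + 2" using assms(3) by unfold_locales auto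
  let ?M = "lebesgue_on (domain G)"
  have eq: "L2_inner ?M (\<lambda>x. f t x + weak_grad (domain G) (\<Phi> t) x) v = L2_inner ?M (f t) v"
    if t: "t \<in> {0<..T}" and v: "v \<in> divfree_velocity_space G k' \<alpha>'" for t v
  proof -
    have vL2: "v \<in> L2 ?M"
      using v by (intro H1n_L2) (simp add: divfree_velocity_space_def velocity_space_def)
    have gL2: "weak_grad (domain G) (\<Phi> t) \<in> L2 ?M"
      using H1_weak_grad[OF assms(10)[OF t]] by (simp add: is_weak_grad_def)
    show ?thesis
      using L2_inner_add_left[OF assms(9)[OF t] gL2 vL2]
        weak_gradient_orthogonal_divfree_velocity[OF assms(1) v assms(10)[OF t]] by simp
  qed
  show ?thesis unfolding semidiscrete_solution_def Let_def
    by (intro conj_cong refl ball_cong ex_cong1) (simp_all only: eq)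
qed

end
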